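(* Let $1\leq p<\infty$ and let $\rho\in L^{1}(\mathbb{R}^{d})$ be nonnegative, identified with the representative described in the context. Suppose there exist $\theta_0\in(0,1)$, a set $\Lambda\subset\mathbb{S}^{d-1}$ with $\mathcal{H}^{d-1}(\Lambda)>0$, and $\mathbf{v}_0\in\Lambda$ such that $\rho_{\theta_0}(r\mathbf{v})=\rho_{\theta_0}(r\mathbf{v}_0)$ for all $\mathbf{v}\in\Lambda$ and $r>0$, and $$\lim_{\delta\to0}\frac{\delta^{p}}{\int_0^\delta\rho_{\theta_0}(r\mathbf{v}_0)\,r^{d-1}\,dr}=0.$$ Let $\{\mathbf{u}_n\}$ be a sequence bounded in $\mathcal{S}_{\rho,p}(\mathbb{R}^d)$, i.e. $\sup_n\big(\|\mathbf{u}_n\|_{L^p(\mathbb{R}^d)}+|\mathbf{u}_n|_{\mathcal{S}_{\rho,p}(\mathbb{R}^d)}\big)<\infty$. Then for every open bounded $D\subset\mathbb{R}^d$, the sequence $\{\mathbf{u}_n|_D\}$ is precompact in $L^{p}(D;\mathbb{R}^{d})$.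
   Context: For $\mathbf{u}:\mathbb{R}^d\to\mathbb{R}^d$, $\mathscr{D}(\mathbf{u})(\mathbf{x},\mathbf{y})=\frac{\mathbf{u}(\mathbf{y})-\mathbf{u}(\mathbf{x})}{|\mathbf{y}-\mathbf{x}|}\cdot\frac{\mathbf{y}-\mathbf{x}}{|\mathbf{y}-\mathbf{x}|}$ and $|\mathbf{u}|^{p}_{\mathcal{S}_{\rho,p}(\mathbb{R}^d)}=\int_{\mathbb{R}^d}\int_{\mathbb{R}^d}\rho(\mathbf{y}-\mathbf{x})|\mathscr{D}(\mathbf{u})(\mathbf{x},\mathbf{y})|^{p}\,d\mathbf{y}\,d\mathbf{x}$; $\mathcal{S}_{\rho,p}(\mathbb{R}^d)$ is the set of $\mathbf{u}\in L^p(\mathbb{R}^d;\mathbb{R}^d)$ with finite seminorm. The kernel $\rho$ is identified with the representative $\rho(\mathbf{x})=\lim_{h\to0}\frac{1}{|B_h(\mathbf{x})|}\int_{B_h(\mathbf{x})}\rho(\boldsymbol{\xi})\,d\boldsymbol{\xi}$ if $\mathbf{x}$ is a Lebesgue point of $\rho$, and $\rho(\mathbf{x})=\infty$ otherwise. For $\theta_0\in(0,1)$, $\mathbf{v}\in\mathbb{S}^{d-1}$ and $r>0$, $\rho_{\theta_0}(r\mathbf{v})=\inf_{\theta\in[\theta_0,1]}\rho(\theta r\mathbf{v})\,\theta^{-p}$. *)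

theory Defs
  imports "HOL-Analysis.Analysis"
begin

text \<open>Outer Hausdorff measure of integer dimension m (normalised as usual;
  the empty set has zero contribution and 0^0 = 1, so that H^0 is counting measure).\<close>
definition hausdorff_outer :: "nat \<Rightarrow> 'a::euclidean_space set \<Rightarrow> ennreal" where
  "hausdorff_outer m A =
     (SUP \<delta>\<in>{0<..}. INF C\<in>{C :: nat \<Rightarrow> 'a set. A \<subseteq> (\<Union>i. C i) \<and>
                      (\<forall>i. bounded (C i) \<and> diameter (C i) \<le> \<delta>)}.
        (\<Sum>i. (if C i = {} then 0
               else ennreal ((pi powr (real m / 2) / Gamma (real m / 2 + 1)) / 2 ^ m
                              * diameter (C i) ^ m))))"

definition lebesgue_point :: "('a::euclidean_space \<Rightarrow> real) \<Rightarrow> 'a \<Rightarrow> real \<Rightarrow> bool" where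
  "lebesgue_point f x c \<longleftrightarrow>
     ((\<lambda>h. (1 / measure lebesgue (ball x h)) * (\<integral>\<xi>\<in>ball x h. \<bar>f \<xi> - c\<bar> \<partial>lebesgue))
        \<longlongrightarrow> 0) (at_right 0)"

definition kernel_rep :: "('a::euclidean_space \<Rightarrow> real) \<Rightarrow> 'a \<Rightarrow> ennreal" where
  "kernel_rep f x =
     (if \<exists>c. lebesgue_point f x c
      then ennreal (Lim (at_right 0)
             (\<lambda>h. (1 / measure lebesgue (ball x h)) * (\<integral>\<xi>\<in>ball x h. f \<xi> \<partial>lebesgue)))
      else \<infinity>)"

definition rho_theta :: "('a::euclidean_space \<Rightarrow> real) \<Rightarrow> real \<Rightarrow> real \<Rightarrow> 'a \<Rightarrow> ennreal" where
  "rho_theta f p \<theta>0 x = (INF \<theta>\<in>{\<theta>0..1}. kernel_rep f (\<theta> *\<^sub>R x) * ennreal (\<theta> powr (- p)))"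

definition proj_diff :: "('a::euclidean_space \<Rightarrow> 'a) \<Rightarrow> 'a \<Rightarrow> 'a \<Rightarrow> real" where
  "proj_diff u x y = ((u y - u x) /\<^sub>R norm (y - x)) \<bullet> ((y - x) /\<^sub>R norm (y - x))"

definition S_seminorm_p :: "('a::euclidean_space \<Rightarrow> real) \<Rightarrow> real \<Rightarrow> ('a \<Rightarrow> 'a) \<Rightarrow> ennreal" where
  "S_seminorm_p f p u =
     (\<integral>\<^sup>+ x. (\<integral>\<^sup>+ y. kernel_rep f (y - x) * ennreal (\<bar>proj_diff u x y\<bar> powr p) \<partial>lebesgue) \<partial>lebesgue)"

definition Lp_pow :: "real \<Rightarrow> 'a::euclidean_space set \<Rightarrow> ('a \<Rightarrow> 'b::real_normed_vector) \<Rightarrow> ennreal" where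
  "Lp_pow p D u = (\<integral>\<^sup>+ x\<in>D. ennreal (norm (u x) powr p) \<partial>lebesgue)"

end

theory Submission
  imports Defs "HOL-Complex_Analysis.Great_Picard" "HOL-Library.Diagonal_Subsequence"
begin

text \<open>
  Fix \<open>\<theta>0 < \<theta> < 1\<close> and \<open>\<delta> > 0\<close>. Put \<open>\<Psi>(z) = \<integral> \<bar>(u(x + z) - u(x)) \<bullet> z\<bar>^p dx\<close>, so that the p-th power of the seminorm is
  \<open>\<integral> \<rho>(z) \<Psi>(z) \<bar>z\<bar>^(-2p) dz\<close>. Telescoping along a segment gives \<open>\<Psi>(k z) \<le> k^(2p) \<Psi>(z)\<close>, which compares
  the shell \<open>\<theta>\<delta> \<le> \<bar>z\<bar> \<le> \<delta>\<close> with its rescalings by \<open>1/k\<close>. Over the cone on \<open>\<Lambda>\<close>, the kernel on the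
  \<open>k\<close>-th rescaled shell is bounded below by a multiple of \<open>\<rho>_\<theta>0\<close> at any radius in \<open>[\<delta>/k, \<delta>/(k-1)]\<close>. Summing
  over \<open>k\<close>, where \<open>\<Sum> 1/k\<close> over the \<open>k\<close> with \<open>\<theta>\<delta> \<le> k\<bar>z\<bar> \<le> \<delta>\<close> is at most \<open>1/\<theta>\<close>, bounds the
  oscillation of \<open>u\<close> at scale \<open>\<delta>\<close> in the directions of the cone by a multiple of
  \<open>\<delta>^p / \<integral>\<^sub>0\<^sup>\<delta> \<rho>_\<theta>0(r v0) r^(d-1) dr\<close>, without polar coordinates.

  A Vitali covering by tubes shows that the cone over a set of positive Hausdorff measure is not
  Lebesgue null, so \<open>\<integral> z \<otimes> z\<close> over it is positive definite and \<open>u(x)\<close> is recovered, up to the above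
  oscillation, from \<open>\<integral> \<phi>(z) (u(x + \<delta> z) \<bullet> z) z dz\<close> with a Lipschitz cutoff \<open>\<phi>\<close>. For fixed \<open>\<delta>\<close>
  these averages of a bounded sequence are equicontinuous, hence Arzela-Ascoli and a diagonal argument
  give a subsequence that is Cauchy in \<open>L^p(D)\<close>.
\<close>

section \<open>Power means and Lebesgue measure\<close>

text \<open>The oscillation is controlled only in the directions of a cone over an arbitrary,
  possibly non-measurable set, so nothing can be integrated over that cone itself. The remedy is one
  Borel set \<open>E\<close> that contains the truncated cone and on which the kernel inequalities
  hold for the scales 1, 1/2, 1/3, ... It has to serve every scale, since the positive definite
  matrix built from it fixes the constants before the scale is chosen. The gap between \<theta>0 and
  \<theta> pays for replacing an interval of radii by its end point: for r in
  [\<delta>/k, \<delta>/(k-1)], \<open>norm z\<close> in [\<theta>, 1] and v = z/|z|, the point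
  (\<delta>/k) z is s r v with \<theta> (k-1)/k <= s <= 1, and s is at least \<theta>0 once k is
  large. The exponent 2p of the telescoping bound is exactly that of the weight |z|^(-2p), so no
  power of k remains from it. Compactness is tested on differences of two members of the sequence:
  oscillation and averages are linear in u before the p-th power is taken. The scale and the cutoff
  are chosen first, the tail of the subsequence afterwards.\<close>

lemma powr_tangent_le:
  fixes a t p :: real
  assumes "1 \<le> p" "0 < a" "0 \<le> t"
  shows "p * a powr (p - 1) * t \<le> t powr p + (p - 1) * a powr p"
proof (cases "p = 1")
  case False
  \<comment> \<open>With the conjugate exponent, (a^(p-1))^q = a^p, and Young's inequality for t and
    a^(p-1) says that t^p lies above its tangent at a.\<close>
  define q where "q = p / (p - 1)"
  have "p > 1" using assms False by simp
  then have "q > 1" "1 / p + 1 / q = 1" by (auto simp: q_def field_simps)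
  then have "t * a powr (p - 1) \<le> t powr p / p + (a powr (p - 1)) powr q / q"
    using \<open>p > 1\<close> assms by (intro Youngs_inequality) auto
  also have "(a powr (p - 1)) powr q = a powr p"
    using \<open>p > 1\<close> by (simp add: powr_powr q_def)
  also have "t powr p / p + a powr p / q = (t powr p + (p - 1) * a powr p) / p"
    using \<open>p > 1\<close> by (simp add: q_def field_simps)
  finally show ?thesis using \<open>p > 1\<close> by (simp add: field_simps)
qed (use assms in auto)

text \<open>Jensen's inequality for a weight of mass at most \<kappa>: the tangent bound at a =
  |integral of F| / \<kappa> is integrated against \<open>g\<close>, so the mass enters only
  linearly and an upper bound on it suffices. A non-integrable \<open>F\<close> has Bochner integral
  0, which makes the claim trivial.\<close>

lemma norm_integral_powr_le:
  fixes F :: "'b \<Rightarrow> 'c::{banach,second_countable_topology}" and g h :: "'b \<Rightarrow> real"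
  assumes p: "1 \<le> p" and \<kappa>: "0 < \<kappa>"
    and [measurable]: "g \<in> borel_measurable M" "h \<in> borel_measurable M"
    and g0: "\<And>z. 0 \<le> g z" and h0: "\<And>z. 0 \<le> h z"
    and g: "(\<integral>\<^sup>+ z. ennreal (g z) \<partial>M) \<le> ennreal \<kappa>"
    and F: "\<And>z. norm (F z) \<le> g z * h z"
  shows "ennreal (norm (\<integral>z. F z \<partial>M) powr p)
           \<le> ennreal (\<kappa> powr (p - 1)) * (\<integral>\<^sup>+ z. ennreal (g z * h z powr p) \<partial>M)"
proof (cases "integrable M F \<and> norm (\<integral>z. F z \<partial>M) \<noteq> 0")
  case True
  define a where "a = norm (\<integral>z. F z \<partial>M) / \<kappa>"
  have a: "a > 0" using True \<kappa> by (simp add: a_def)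
  define X where "X = (\<integral>\<^sup>+ z. ennreal (g z * h z powr p) \<partial>M)"
  have "ennreal (p * a powr (p-1) * (a * \<kappa>)) = ennreal (p * a powr (p-1)) * ennreal (norm (\<integral>z. F z \<partial>M))"
    using a p \<kappa> by (simp add: a_def flip: ennreal_mult)
  also have "\<dots> \<le> ennreal (p * a powr (p-1)) * (\<integral>\<^sup>+ z. ennreal (norm (F z)) \<partial>M)"
    using True by (intro mult_left_mono integral_norm_bound_ennreal) auto
  also have "\<dots> \<le> ennreal (p * a powr (p-1)) * (\<integral>\<^sup>+ z. ennreal (g z * h z) \<partial>M)"
    by (intro mult_left_mono nn_integral_mono ennreal_leI F) auto
  also have "\<dots> = (\<integral>\<^sup>+ z. ennreal (p * a powr (p-1) * (g z * h z)) \<partial>M)"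
    using p a g0 h0 by (subst nn_integral_cmult[symmetric]) (auto intro!: nn_integral_cong simp: ennreal_mult)
  also have "\<dots> \<le> (\<integral>\<^sup>+ z. ennreal (g z * h z powr p) + ennreal ((p-1) * a powr p) * ennreal (g z) \<partial>M)"
  proof (intro nn_integral_mono)
    fix z
    have "g z * (p * a powr (p-1) * h z) \<le> g z * (h z powr p + (p-1) * a powr p)"
      by (intro mult_left_mono powr_tangent_le p a h0 g0)
    then have "p * a powr (p-1) * (g z * h z) \<le> g z * h z powr p + (p-1) * a powr p * g z"
      by (simp add: algebra_simps)
    then show "ennreal (p * a powr (p-1) * (g z * h z))
        \<le> ennreal (g z * h z powr p) + ennreal ((p-1) * a powr p) * ennreal (g z)"
      using p g0 h0 by (simp flip: ennreal_mult ennreal_plus)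
  qed
  also have "\<dots> = X + ennreal ((p-1) * a powr p) * (\<integral>\<^sup>+ z. ennreal (g z) \<partial>M)"
    by (simp add: X_def nn_integral_add nn_integral_cmult)
  also have "\<dots> \<le> X + ennreal ((p-1) * a powr p) * ennreal \<kappa>"
    by (intro add_left_mono mult_left_mono g) auto
  finally have main: "ennreal (p * a powr (p-1) * (a * \<kappa>)) \<le> X + ennreal ((p-1) * a powr p * \<kappa>)"
    using p \<kappa> by (simp add: ennreal_mult)
  have ap: "a powr (p-1) * a = a powr p" using a by (simp add: powr_diff)
  \<comment> \<open>If X is infinite there is nothing to show; otherwise (p-1) a^p \<kappa> may be
    subtracted in the reals, which turns the factor p into 1.\<close>
  have "ennreal (a powr p * \<kappa>) \<le> X"
  proof (cases X)
    case (real x)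
    then have "p * a powr (p-1) * (a * \<kappa>) \<le> x + (p-1) * a powr p * \<kappa>"
      using main p \<kappa> by (simp flip: ennreal_plus)
    moreover have "p * a powr (p-1) * (a * \<kappa>) = p * ((a powr (p-1) * a) * \<kappa>)"
      by (simp only: mult_ac)
    then have "p * a powr (p-1) * (a * \<kappa>) = p * (a powr p * \<kappa>)" unfolding ap .
    ultimately have "p * (a powr p * \<kappa>) \<le> x + (p-1) * a powr p * \<kappa>" by metis
    then have "a powr p * \<kappa> \<le> x" by (simp add: algebra_simps)
    then show ?thesis using real by simp
  qed simp
  then have "ennreal (\<kappa> powr (p-1)) * ennreal (a powr p * \<kappa>) \<le> ennreal (\<kappa> powr (p-1)) * X"
    by (intro mult_left_mono) auto
  moreover have "\<kappa> powr (p-1) * (a powr p * \<kappa>) = norm (\<integral>z. F z \<partial>M) powr p"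
    using \<kappa> by (simp add: a_def powr_diff powr_divide)
  ultimately show ?thesis unfolding X_def using \<kappa> by (simp flip: ennreal_mult)
next
  case False
  then have "norm (\<integral>z. F z \<partial>M) = 0" using not_integrable_integral_eq by auto
  then show ?thesis by simp
qed

text \<open>The finite counterpart of \<open>norm_integral_powr_le\<close>, with the tangent taken
  at the arithmetic mean s.\<close>

lemma powr_sum_le:
  fixes a :: "'i \<Rightarrow> real"
  assumes "1 \<le> p" "finite I" "\<And>i. i \<in> I \<Longrightarrow> 0 \<le> a i"
  shows "(\<Sum>i\<in>I. a i) powr p \<le> real (card I) powr (p - 1) * (\<Sum>i\<in>I. a i powr p)"
proof (cases "I = {} \<or> (\<Sum>i\<in>I. a i) = 0")
  case False
  then have n: "card I > 0" using assms by (simp add: card_gt_0_iff)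
  define s where "s = (\<Sum>i\<in>I. a i) / card I"
  have S: "(\<Sum>i\<in>I. a i) = s * card I" using n by (simp add: s_def)
  have "(\<Sum>i\<in>I. a i) > 0" using False assms by (simp add: order.strict_iff_order sum_nonneg)
  then have s: "s > 0" using n by (simp add: s_def)
  have "(\<Sum>i\<in>I. p * s powr (p - 1) * a i) \<le> (\<Sum>i\<in>I. a i powr p + (p - 1) * s powr p)"
    using assms s by (intro sum_mono powr_tangent_le) auto
  then have "p * s powr (p - 1) * (s * card I) \<le> (\<Sum>i\<in>I. a i powr p) + card I * ((p - 1) * s powr p)"
    by (simp add: sum.distrib S flip: sum_distrib_left)
  moreover have "s powr (p - 1) * s = s powr p" using s by (simp add: powr_diff)
  moreover have "p * s powr (p - 1) * (s * card I) = p * (card I * (s powr (p - 1) * s))"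
    by (simp only: mult_ac)
  ultimately have "p * (card I * s powr p) \<le> (\<Sum>i\<in>I. a i powr p) + card I * ((p - 1) * s powr p)"
    by metis
  then have "card I * s powr p \<le> (\<Sum>i\<in>I. a i powr p)"
    by (simp add: algebra_simps)
  then have "real (card I) powr (p - 1) * (card I * s powr p) \<le> real (card I) powr (p - 1) * (\<Sum>i\<in>I. a i powr p)"
    by (intro mult_left_mono) auto
  moreover have "real (card I) powr (p - 1) * (card I * s powr p) = (s * card I) powr p"
    using n s by (simp add: powr_diff powr_mult)
  ultimately show ?thesis by (simp add: S)
qed (use assms in \<open>auto intro!: mult_nonneg_nonneg sum_nonneg\<close>)

section \<open>Affine substitutions and Borel representatives\<close>

lemma nn_integral_lborel_affine:
  fixes f :: "'a::euclidean_space \<Rightarrow> ennreal"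
  assumes [measurable]: "f \<in> borel_measurable borel" and "c \<noteq> 0"
  shows "(\<integral>\<^sup>+ x. f x \<partial>lborel) = ennreal (\<bar>c\<bar> ^ DIM('a)) * (\<integral>\<^sup>+ x. f (t + c *\<^sub>R x) \<partial>lborel)"
  by (subst lborel_affine[OF \<open>c \<noteq> 0\<close>, of t])
     (simp add: nn_integral_density nn_integral_distr nn_integral_cmult)

text \<open>Borel representatives make (x, z) -> u (x + z) measurable for the product sigma-algebra,
  as the exchanges of integrals below require, while the integrals themselves ignore null
  sets.\<close>

lemma borel_version_lebesgue:
  fixes f :: "'a::euclidean_space \<Rightarrow> 'b::euclidean_space"
  assumes [measurable]: "f \<in> borel_measurable lebesgue"
  shows "\<exists>f' \<in> borel_measurable borel. AE x in lborel. f x = f' x"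
proof -
  have "\<exists>g. g \<in> borel_measurable lborel \<and> (AE x in lborel. f x \<bullet> b = g x)" for b
    using completion_ex_borel_measurable_real[of "\<lambda>x. f x \<bullet> b" lborel] by auto
  then obtain g where [measurable]: "\<And>b. g b \<in> borel_measurable lborel"
    and g: "\<And>b. AE x in lborel. f x \<bullet> b = g b x" by metis
  have "AE x in lborel. \<forall>b\<in>Basis. f x \<bullet> b = g b x"
    using g by (intro AE_finite_allI) auto
  then have "AE x in lborel. f x = (\<Sum>b\<in>Basis. g b x *\<^sub>R b)"
  proof eventually_elim
    case (elim x)
    have "f x = (\<Sum>b\<in>Basis. (f x \<bullet> b) *\<^sub>R b)" by (simp add: euclidean_representation)
    also have "\<dots> = (\<Sum>b\<in>Basis. g b x *\<^sub>R b)" using elim by (intro sum.cong) auto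
    finally show ?case .
  qed
  then show ?thesis by (intro bexI[of _ "\<lambda>x. \<Sum>b\<in>Basis. g b x *\<^sub>R b"]) auto
qed

section \<open>Measurability of the kernel representative\<close>

text \<open>Comparability of radii within a factor 2 lets a radius of the form 1/n control the
  smaller radii near it.\<close>

lemma tendsto_zero_at_right_sequence:
  fixes \<phi> :: "real \<Rightarrow> real"
  assumes nonneg: "\<And>h. 0 \<le> \<phi> h"
    and dbl: "\<And>h h'. 0 < h \<Longrightarrow> h \<le> h' \<Longrightarrow> h' \<le> 2 * h \<Longrightarrow> \<phi> h \<le> C * \<phi> h'"
  shows "(\<phi> \<longlongrightarrow> 0) (at_right 0) \<longleftrightarrow> (\<lambda>n. \<phi> (1 / Suc n)) \<longlonglongrightarrow> 0"
proof
  assume "(\<phi> \<longlongrightarrow> 0) (at_right 0)"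
  moreover have "filterlim (\<lambda>n. 1 / real (Suc n)) (at_right 0) sequentially"
    using LIMSEQ_inverse_real_of_nat by (auto simp: filterlim_at inverse_eq_divide)
  ultimately show "(\<lambda>n. \<phi> (1 / Suc n)) \<longlonglongrightarrow> 0" by (rule filterlim_compose)
next
  assume L: "(\<lambda>n. \<phi> (1 / Suc n)) \<longlonglongrightarrow> 0"
  \<comment> \<open>Shifted by one so that \<open>Suc (N h)\<close> is the floor i of 1/h.\<close>
  define N where "N h = nat \<lfloor>1 / h\<rfloor> - 1" for h :: real
  have "filterlim (\<lambda>h::real. 1 / h) at_top (at_right 0)"
    using filterlim_inverse_at_top_right by (simp add: inverse_eq_divide)
  then have "filterlim (\<lambda>h::real. nat \<lfloor>1 / h\<rfloor>) sequentially (at_right 0)"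
    by (intro filterlim_compose[OF filterlim_nat_sequentially] filterlim_compose[OF filterlim_floor_sequentially])
  then have "filterlim N sequentially (at_right 0)"
    unfolding N_def by (rule filterlim_compose[OF filterlim_minus_const_nat_at_top])
  then have "((\<lambda>h. \<phi> (1 / Suc (N h))) \<longlongrightarrow> 0) (at_right 0)"
    by (rule filterlim_compose[OF L])
  then have lim: "((\<lambda>h. C * \<phi> (1 / Suc (N h))) \<longlongrightarrow> 0) (at_right 0)"
    by (rule tendsto_mult_right_zero)
  have le: "\<forall>\<^sub>F h in at_right 0. \<phi> h \<le> C * \<phi> (1 / Suc (N h))"
  proof (rule eventually_at_rightI[of 0 1])
    fix h :: real assume "h \<in> {0<..<1}"
    then have h: "0 < h" "h < 1" by auto
    define i where "i = \<lfloor>1 / h\<rfloor>"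
    have i: "i \<le> 1 / h" "1 / h < i + 1" by (auto simp: i_def)
    have "1 \<le> 1 / h" using h by simp
    then have "i \<ge> 1" unfolding i_def by (simp add: le_floor_iff)
    then have e: "real (Suc (N h)) = i" by (simp add: N_def flip: i_def)
    \<comment> \<open>From i >= 1 and 1/h < i + 1 <= 2 i follows h <= 1/i <= 2 h, the range covered
      by the doubling hypothesis.\<close>
    have "1 / h \<le> 2 * i" using i \<open>i \<ge> 1\<close> by linarith
    then show "\<phi> h \<le> C * \<phi> (1 / Suc (N h))" unfolding e using i h \<open>i \<ge> 1\<close> by (intro dbl) (auto simp: field_simps)
  qed simp
  have ge: "\<forall>\<^sub>F h in at_right 0. 0 \<le> \<phi> h" by (simp add: nonneg)
  show "(\<phi> \<longlongrightarrow> 0) (at_right 0)"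
    by (rule tendsto_sandwich[OF ge le tendsto_const lim])
qed

section \<open>Averages over balls\<close>

definition ball_avg :: "('a::euclidean_space \<Rightarrow> real) \<Rightarrow> 'a \<Rightarrow> real \<Rightarrow> real" where
  "ball_avg f x h = (1 / measure lborel (ball x h)) * (\<integral>\<xi>. indicator (ball x h) \<xi> * f \<xi> \<partial>lborel)"

lemma ball_avg_abs_nonneg: "0 \<le> ball_avg (\<lambda>\<xi>. \<bar>f \<xi>\<bar>) x h"
  unfolding ball_avg_def by (intro mult_nonneg_nonneg integral_nonneg_AE) auto

lemma integrable_ball_times:
  fixes g :: "'a::euclidean_space \<Rightarrow> real"
  assumes "integrable lborel g"
  shows "integrable lborel (\<lambda>\<xi>. indicator (ball x h) \<xi> * g \<xi>)"
  using integrable_mult_indicator[of "ball x h" lborel g] assms by simp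

lemma integrable_indicator_ball: "integrable lborel (indicator (ball x h) :: 'a::euclidean_space \<Rightarrow> real)"
  using emeasure_bounded_finite[of "ball x h"] by (intro integrable_real_indicator) (auto simp: less_top)

lemma integrable_ball_diff:
  fixes g :: "'a::euclidean_space \<Rightarrow> real"
  assumes "integrable lborel g"
  shows "integrable lborel (\<lambda>\<xi>. indicator (ball x h) \<xi> * (g \<xi> - c))"
proof -
  have "integrable lborel (\<lambda>\<xi>. indicator (ball x h) \<xi> * g \<xi> - c * indicator (ball x h) \<xi>)"
    using integrable_ball_times[OF assms] integrable_indicator_ball
    by (intro Bochner_Integration.integrable_diff) auto
  then show ?thesis by (simp add: algebra_simps)
qed

text \<open>The larger ball contains the smaller one and has at most \<open>2 ^ DIM('a)\<close>
  times its volume. This supplies the hypothesis \<open>dbl\<close> of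
  \<open>tendsto_zero_at_right_sequence\<close>.\<close>

lemma ball_avg_doubling:
  fixes g :: "'a::euclidean_space \<Rightarrow> real"
  assumes "integrable lborel g" and h: "0 < h" "h \<le> h'" "h' \<le> 2 * h"
  shows "ball_avg (\<lambda>\<xi>. \<bar>g \<xi> - c\<bar>) x h \<le> 2 ^ DIM('a) * ball_avg (\<lambda>\<xi>. \<bar>g \<xi> - c\<bar>) x h'"
proof -
  have int: "integrable lborel (\<lambda>\<xi>. indicator (ball x r) \<xi> * \<bar>g \<xi> - c\<bar>)" for r
    using integrable_abs[OF integrable_ball_diff[OF assms(1), of x r c]] by (simp add: abs_mult)
  have I: "(\<integral>\<xi>. indicator (ball x h) \<xi> * \<bar>g \<xi> - c\<bar> \<partial>lborel) \<le> (\<integral>\<xi>. indicator (ball x h') \<xi> * \<bar>g \<xi> - c\<bar> \<partial>lborel)"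
    using h int by (intro integral_mono) (auto simp: indicator_def)
  have "measure lborel (ball x h') \<le> 2 ^ DIM('a) * measure lborel (ball x h)"
    using h content_ball_conv_unit_ball[of h x] content_ball_conv_unit_ball[of h' x]
      power_mono[of h' "2 * h" "DIM('a)"]
    by (auto simp: power_mult_distrib intro!: mult_right_mono)
  moreover have pos: "measure lborel (ball x h) > 0" "measure lborel (ball x h') > 0"
    using h by (auto intro!: content_ball_pos)
  ultimately have "1 / measure lborel (ball x h) \<le> 2 ^ DIM('a) * (1 / measure lborel (ball x h'))"
    by (simp add: field_simps)
  then show ?thesis unfolding ball_avg_def mult.assoc[symmetric]
    using I pos by (intro mult_mono) (auto intro!: integral_nonneg_AE)
qed

text \<open>Through this bound a Lebesgue value c, if there is one, is the limit of the averages and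
  hence unique.\<close>

lemma ball_avg_diff_le:
  fixes g :: "'a::euclidean_space \<Rightarrow> real"
  assumes "integrable lborel g" and "0 < h"
  shows "\<bar>ball_avg g x h - c\<bar> \<le> ball_avg (\<lambda>\<xi>. \<bar>g \<xi> - c\<bar>) x h"
proof -
  have m: "measure lborel (ball x h) > 0" using assms by (auto intro!: content_ball_pos)
  have "(\<integral>\<xi>. indicator (ball x h) \<xi> * (g \<xi> - c) \<partial>lborel)
      = (\<integral>\<xi>. indicator (ball x h) \<xi> * g \<xi> - c * indicator (ball x h) \<xi> \<partial>lborel)"
    by (simp add: algebra_simps)
  also have "\<dots> = (\<integral>\<xi>. indicator (ball x h) \<xi> * g \<xi> \<partial>lborel) - c * measure lborel (ball x h)"
    using integrable_ball_times[OF assms(1)] integrable_indicator_ball by (subst Bochner_Integration.integral_diff) auto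
  finally have "ball_avg g x h - c = (1 / measure lborel (ball x h)) * (\<integral>\<xi>. indicator (ball x h) \<xi> * (g \<xi> - c) \<partial>lborel)"
    using m by (simp add: ball_avg_def field_simps)
  then have "\<bar>ball_avg g x h - c\<bar> = (1 / measure lborel (ball x h)) * \<bar>\<integral>\<xi>. indicator (ball x h) \<xi> * (g \<xi> - c) \<partial>lborel\<bar>"
    using m by (simp add: abs_mult)
  also have "\<dots> \<le> (1 / measure lborel (ball x h)) * (\<integral>\<xi>. \<bar>indicator (ball x h) \<xi> * (g \<xi> - c)\<bar> \<partial>lborel)"
    using m by (intro mult_left_mono integral_abs_bound) auto
  finally show ?thesis by (simp add: ball_avg_def abs_mult)
qed

text \<open>By doubling, Lebesgue points are detected along the radii \<open>1/n\<close>, and the only candidate value is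
  the limit of the averages, so no uncountable quantifier over values remains.\<close>

lemma kernel_rep_measurable:
  fixes f :: "'a::euclidean_space \<Rightarrow> real"
  assumes int: "integrable lebesgue f"
  shows "kernel_rep f \<in> borel_measurable borel"
proof -
  obtain g where g[measurable]: "g \<in> borel_measurable borel" and fg: "AE x in lborel. f x = g x"
    using borel_version_lebesgue[OF borel_measurable_integrable[OF int]] by blast
  have fg': "AE x in lebesgue. f x = g x" by (rule AE_completion[OF fg])
  have gl: "g \<in> borel_measurable lborel" using g by simp
  then have "g \<in> borel_measurable lebesgue" by (rule measurable_completion)
  then have "integrable lebesgue g" by (rule integrable_cong_AE_imp[OF int _ fg'])
  then have gi: "integrable lborel g" unfolding integrable_completion[OF gl] .
  \<comment> \<open>Stated for a general Borel function F so that it covers both the oscillation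
    averages, F t = |t - c|, and the plain averages, F t = t.\<close>
  have avg: "(1 / measure lebesgue (ball x h)) * (\<integral>\<xi>\<in>ball x h. F (f \<xi>) \<partial>lebesgue) = ball_avg (\<lambda>\<xi>. F (g \<xi>)) x h"
    if F: "F \<in> borel_measurable borel" for F :: "real \<Rightarrow> real" and x h
  proof -
    have i: "indicat_real (ball x h) \<in> borel_measurable lebesgue"
      by (intro borel_measurable_indicator) auto
    have gm: "(\<lambda>\<xi>. indicat_real (ball x h) \<xi> * F (g \<xi>)) \<in> borel_measurable lborel"
      using measurable_compose[OF g F] by (intro borel_measurable_times borel_measurable_indicator) auto
    have fm: "(\<lambda>\<xi>. indicat_real (ball x h) \<xi> * F (f \<xi>)) \<in> borel_measurable lebesgue"
      using i measurable_compose[OF borel_measurable_integrable[OF int] F] by (rule borel_measurable_times)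
    have "(\<integral>\<xi>\<in>ball x h. F (f \<xi>) \<partial>lebesgue) = (\<integral>\<xi>. indicator (ball x h) \<xi> * F (f \<xi>) \<partial>lebesgue)"
      by (simp add: set_lebesgue_integral_def)
    also have "\<dots> = (\<integral>\<xi>. indicator (ball x h) \<xi> * F (g \<xi>) \<partial>lebesgue)"
    proof (rule integral_cong_AE[OF fm measurable_completion[OF gm]])
      show "AE \<xi> in lebesgue. indicat_real (ball x h) \<xi> * F (f \<xi>) = indicat_real (ball x h) \<xi> * F (g \<xi>)"
        using fg' by eventually_elim simp
    qed
    also have "\<dots> = (\<integral>\<xi>. indicator (ball x h) \<xi> * F (g \<xi>) \<partial>lborel)"
      by (rule integral_completion[OF gm])
    finally show ?thesis by (simp add: ball_avg_def measure_completion)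
  qed
  have abs_meas: "(\<lambda>t. \<bar>t - c\<bar>) \<in> borel_measurable borel" for c :: real by measurable
  define A where "A c x n = ball_avg (\<lambda>\<xi>. \<bar>g \<xi> - c\<bar>) x (1 / Suc n)" for c x n
  have leb: "lebesgue_point f x c \<longleftrightarrow> A c x \<longlonglongrightarrow> 0" for x c
  proof -
    have "lebesgue_point f x c \<longleftrightarrow> (ball_avg (\<lambda>\<xi>. \<bar>g \<xi> - c\<bar>) x \<longlongrightarrow> 0) (at_right 0)"
      unfolding lebesgue_point_def avg[OF abs_meas] ..
    also have "\<dots> \<longleftrightarrow> A c x \<longlonglongrightarrow> 0"
      unfolding A_def
      by (rule tendsto_zero_at_right_sequence[OF ball_avg_abs_nonneg ball_avg_doubling[OF gi]])
    finally show ?thesis .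
  qed
  define c where "c x = lim (\<lambda>n. ball_avg g x (1 / Suc n))" for x
  have val: "c x = l \<and> Lim (at_right 0) (ball_avg g x) = l" if "lebesgue_point f x l" for x l
  proof -
    have "(ball_avg (\<lambda>\<xi>. \<bar>g \<xi> - l\<bar>) x \<longlongrightarrow> 0) (at_right 0)"
      using that unfolding lebesgue_point_def avg[OF abs_meas] .
    moreover have "\<forall>\<^sub>F h in at_right 0. norm (ball_avg g x h - l) \<le> ball_avg (\<lambda>\<xi>. \<bar>g \<xi> - l\<bar>) x h"
      by (rule eventually_at_rightI[of 0 1]) (simp_all add: ball_avg_diff_le[OF gi])
    ultimately have "((\<lambda>h. ball_avg g x h - l) \<longlongrightarrow> 0) (at_right 0)"
      by (rule Lim_null_comparison[rotated])
    then have L: "(ball_avg g x \<longlongrightarrow> l) (at_right 0)" by (simp add: LIM_zero_iff)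
    moreover have "filterlim (\<lambda>n. 1 / real (Suc n)) (at_right 0) sequentially"
      using LIMSEQ_inverse_real_of_nat by (auto simp: filterlim_at inverse_eq_divide)
    ultimately have "(\<lambda>n. ball_avg g x (1 / Suc n)) \<longlonglongrightarrow> l" by (rule filterlim_compose)
    then have "c x = l" unfolding c_def by (rule limI)
    moreover have "Lim (at_right 0) (ball_avg g x) = l" by (rule tendsto_Lim[OF _ L]) simp
    ultimately show ?thesis ..
  qed
  \<comment> \<open>Also correct where the averages diverge: then no number is a Lebesgue value, in
    particular not the unspecified one returned by \<open>lim\<close>.\<close>
  have eq: "kernel_rep f x = (if A (c x) x \<longlonglongrightarrow> 0 then ennreal (c x) else \<infinity>)" for x
  proof (cases "\<exists>l. lebesgue_point f x l")
    case True
    then obtain l where l: "lebesgue_point f x l" by blast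
    have "(\<lambda>h. (1 / measure lebesgue (ball x h)) * (\<integral>\<xi>\<in>ball x h. f \<xi> \<partial>lebesgue)) = ball_avg g x"
      by (rule ext, rule avg[of "\<lambda>t. t"]) measurable
    then show ?thesis using val[OF l] l True leb[of x "c x"]
      unfolding kernel_rep_def by simp
  next
    case False
    then show ?thesis using leb[of x "c x"] by (simp add: kernel_rep_def)
  qed
  have ind: "(\<lambda>z::'a \<times> 'a. indicator (ball (fst z) h) (snd z) :: real) \<in> borel_measurable (borel \<Otimes>\<^sub>M borel)" for h
  proof -
    have "(\<lambda>z::'a \<times> 'a. indicator (ball (fst z) h) (snd z) :: real) = (\<lambda>z. if dist (fst z) (snd z) < h then 1 else 0)"
      by (auto simp: indicator_def)
    also have "\<dots> \<in> borel_measurable (borel \<Otimes>\<^sub>M borel)" by measurable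
    finally show ?thesis .
  qed
  have vol: "measure lborel (ball x h) = measure lborel (ball (0::'a) h)" if "h \<ge> 0" for x :: 'a and h
    using content_ball_conv_unit_ball[OF that, of x] content_ball_conv_unit_ball[OF that, of "0::'a"] by simp
  have meas_eq: "borel_measurable (borel \<Otimes>\<^sub>M lborel) = (borel_measurable (borel \<Otimes>\<^sub>M borel) :: ('a \<times> 'a \<Rightarrow> real) set)"
    by (intro measurable_cong_sets sets_pair_measure_cong) auto
  \<comment> \<open>\<open>G\<close> may depend on the centre because the constant subtracted in the
    oscillation average is \<open>c x\<close>.\<close>
  have avg_meas: "(\<lambda>x. ball_avg (G x) x h) \<in> borel_measurable borel"
    if G: "(\<lambda>z. G (fst z) (snd z)) \<in> borel_measurable (borel \<Otimes>\<^sub>M borel)" and h: "h \<ge> 0" for G :: "'a \<Rightarrow> 'a \<Rightarrow> real" and h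
  proof -
    have "(\<lambda>z. indicator (ball (fst z) h) (snd z) * G (fst z) (snd z)) \<in> borel_measurable (borel \<Otimes>\<^sub>M borel)"
      by (rule borel_measurable_times[OF ind G])
    then have "case_prod (\<lambda>x \<xi>. indicator (ball x h) \<xi> * G x \<xi>) \<in> borel_measurable (borel \<Otimes>\<^sub>M lborel)"
      unfolding split_beta' meas_eq .
    then have "(\<lambda>x. \<integral>\<xi>. indicator (ball x h) \<xi> * G x \<xi> \<partial>lborel) \<in> borel_measurable borel"
      by (rule lborel.borel_measurable_lebesgue_integral)
    moreover have "(\<lambda>x. ball_avg (G x) x h)
        = (\<lambda>x. (1 / measure lborel (ball (0::'a) h)) * (\<integral>\<xi>. indicator (ball x h) \<xi> * G x \<xi> \<partial>lborel))"
    proof (rule ext)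
      fix x show "ball_avg (G x) x h
          = (1 / measure lborel (ball (0::'a) h)) * (\<integral>\<xi>. indicator (ball x h) \<xi> * G x \<xi> \<partial>lborel)"
        unfolding ball_avg_def using vol[OF h, of x] by simp
    qed
    ultimately show ?thesis by simp
  qed
  have g2: "(\<lambda>z::'a \<times> 'a. g (snd z)) \<in> borel_measurable (borel \<Otimes>\<^sub>M borel)"
    by (rule measurable_compose[OF measurable_snd g])
  have [measurable]: "(\<lambda>x. ball_avg g x (1 / Suc n)) \<in> borel_measurable borel" for n
    by (rule avg_meas[OF g2]) simp
  have c: "c \<in> borel_measurable borel" unfolding c_def by measurable
  have c1: "(\<lambda>z::'a \<times> 'a. c (fst z)) \<in> borel_measurable (borel \<Otimes>\<^sub>M borel)"
    by (rule measurable_compose[OF measurable_fst c])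
  have [measurable]: "(\<lambda>x. A (c x) x n) \<in> borel_measurable borel" for n
    unfolding A_def
    by (rule avg_meas[OF borel_measurable_abs[OF borel_measurable_diff[OF g2 c1]]]) simp
  have A0: "0 \<le> A (c x) x n" for x n
    unfolding A_def by (rule ball_avg_abs_nonneg)
  \<comment> \<open>For nonnegative sequences convergence to 0 is the vanishing of the limsup, and
    the limsup is a measurable function of x.\<close>
  have lim: "A (c x) x \<longlonglongrightarrow> 0 \<longleftrightarrow> limsup (\<lambda>n. ennreal (A (c x) x n)) = 0" for x
  proof -
    have "A (c x) x \<longlonglongrightarrow> 0 \<longleftrightarrow> (\<lambda>n. ennreal (A (c x) x n)) \<longlonglongrightarrow> ennreal 0"
      by (rule tendsto_ennreal_iff[symmetric]) (simp_all add: A0 del: tendsto_ennreal_iff)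
    also have "\<dots> \<longleftrightarrow> limsup (\<lambda>n. ennreal (A (c x) x n)) = 0"
      using Liminf_le_Limsup[OF trivial_limit_sequentially, of "\<lambda>n. ennreal (A (c x) x n)"]
      unfolding tendsto_iff_Liminf_eq_Limsup[OF trivial_limit_sequentially] ennreal_0
      by (metis le_zero_eq)
    finally show ?thesis .
  qed
  have L: "(\<lambda>x. limsup (\<lambda>n. ennreal (A (c x) x n))) \<in> borel_measurable borel"
    by (rule borel_measurable_limsup) measurable
  have "kernel_rep f = (\<lambda>x. if limsup (\<lambda>n. ennreal (A (c x) x n)) = 0 then ennreal (c x) else \<infinity>)"
    by (rule ext) (simp only: eq lim)
  also have "\<dots> \<in> borel_measurable borel"
  proof (rule measurable_If)
    show "(\<lambda>x. ennreal (c x)) \<in> borel_measurable borel" by (rule measurable_compose[OF c measurable_ennreal])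
    show "{x \<in> space borel. limsup (\<lambda>n. ennreal (A (c x) x n)) = 0} \<in> sets borel"
      using measurable_sets[OF L, of "{0}"] unfolding vimage_def Int_def by (simp add: conj_commute)
  qed simp
  finally show ?thesis .
qed

section \<open>The shell estimate\<close>

text \<open>The function \<Psi> of the overview. Keeping the division by |z| outside makes it behave
  well under z -> k z and vanish at z = 0.\<close>

definition pair_osc :: "real \<Rightarrow> ('a::euclidean_space \<Rightarrow> 'a) \<Rightarrow> 'a \<Rightarrow> ennreal" where
  "pair_osc p u z = (\<integral>\<^sup>+ x. ennreal (\<bar>(u (x + z) - u x) \<bullet> z\<bar> powr p) \<partial>lborel)"

lemma pair_osc_measurable [measurable]:
  assumes [measurable]: "u \<in> borel_measurable borel"
  shows "pair_osc p u \<in> borel_measurable borel"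
  unfolding pair_osc_def[abs_def] by measurable

text \<open>Each of the two normalisations in \<open>proj_diff\<close> costs one factor |z|, hence
  the exponent 2p. At z = 0 both sides are 0, because \<open>powr\<close> with base 0 is 0.\<close>

lemma proj_diff_powr:
  "\<bar>proj_diff u x (x + z)\<bar> powr p = norm z powr (- 2 * p) * \<bar>(u (x + z) - u x) \<bullet> z\<bar> powr p"
proof (cases "z = 0")
  case False
  have "\<bar>proj_diff u x (x + z)\<bar> = \<bar>(u (x + z) - u x) \<bullet> z\<bar> / (norm z)\<^sup>2"
    using False by (simp add: proj_diff_def abs_mult power2_eq_square divide_inverse)
  moreover have "((norm z)\<^sup>2) powr p = norm z powr (2 * p)"
    using False by (simp add: powr_powr flip: powr_numeral)
  ultimately show ?thesis using False by (simp add: powr_divide powr_minus_divide)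
qed (simp add: proj_diff_def)

text \<open>Substitution y = x + z followed by Tonelli. The original \<open>u0\<close> may be
  exchanged for its Borel version because, for almost every x, they agree at x itself and at almost
  every y.\<close>

lemma nn_integral_kernel_pair_osc:
  fixes u0 u :: "'a::euclidean_space \<Rightarrow> 'a"
  assumes K[measurable]: "kernel_rep f \<in> borel_measurable borel"
    and u[measurable]: "u \<in> borel_measurable borel" and eq: "AE x in lborel. u0 x = u x"
  shows "(\<integral>\<^sup>+ z. kernel_rep f z * (ennreal (norm z powr (- 2 * p)) * pair_osc p u z) \<partial>lborel)
           = S_seminorm_p f p u0"
proof -
  have "S_seminorm_p f p u0
      = (\<integral>\<^sup>+ x. (\<integral>\<^sup>+ y. kernel_rep f (y - x) * ennreal (\<bar>proj_diff u0 x y\<bar> powr p) \<partial>lborel) \<partial>lborel)"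
    by (simp add: S_seminorm_p_def nn_integral_completion)
  also have "\<dots> = (\<integral>\<^sup>+ x. (\<integral>\<^sup>+ y. kernel_rep f (y - x) * ennreal (\<bar>proj_diff u x y\<bar> powr p) \<partial>lborel) \<partial>lborel)"
  proof (rule nn_integral_cong_AE)
    show "AE x in lborel. (\<integral>\<^sup>+ y. kernel_rep f (y - x) * ennreal (\<bar>proj_diff u0 x y\<bar> powr p) \<partial>lborel)
        = (\<integral>\<^sup>+ y. kernel_rep f (y - x) * ennreal (\<bar>proj_diff u x y\<bar> powr p) \<partial>lborel)"
      using eq
    proof eventually_elim
      case (elim x)
      show ?case
        by (rule nn_integral_cong_AE, use eq in eventually_elim) (simp add: proj_diff_def elim)
    qed
  qed
  also have "\<dots> = (\<integral>\<^sup>+ x. (\<integral>\<^sup>+ z. kernel_rep f z * ennreal (\<bar>proj_diff u x (x + z)\<bar> powr p) \<partial>lborel) \<partial>lborel)"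
  proof (rule nn_integral_cong)
    fix x :: 'a
    show "(\<integral>\<^sup>+ y. kernel_rep f (y - x) * ennreal (\<bar>proj_diff u x y\<bar> powr p) \<partial>lborel)
        = (\<integral>\<^sup>+ z. kernel_rep f z * ennreal (\<bar>proj_diff u x (x + z)\<bar> powr p) \<partial>lborel)"
      unfolding proj_diff_def
      by (subst nn_integral_lborel_affine[where c = 1 and t = x]) simp_all
  qed
  also have "\<dots> = (\<integral>\<^sup>+ x. (\<integral>\<^sup>+ z. (kernel_rep f z * ennreal (norm z powr (- 2 * p)))
                     * ennreal (\<bar>(u (x + z) - u x) \<bullet> z\<bar> powr p) \<partial>lborel) \<partial>lborel)"
    by (simp add: proj_diff_powr ennreal_mult mult.assoc)
  also have "\<dots> = (\<integral>\<^sup>+ z. (\<integral>\<^sup>+ x. (kernel_rep f z * ennreal (norm z powr (- 2 * p)))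
                     * ennreal (\<bar>(u (x + z) - u x) \<bullet> z\<bar> powr p) \<partial>lborel) \<partial>lborel)"
    by (rule lborel_pair.Fubini') measurable
  also have "\<dots> = (\<integral>\<^sup>+ z. (kernel_rep f z * ennreal (norm z powr (- 2 * p))) * pair_osc p u z \<partial>lborel)"
    unfolding pair_osc_def by (intro nn_integral_cong nn_integral_cmult) measurable
  finally show ?thesis by (simp add: mult.assoc)
qed

text \<open>The increment over k z splits into k increments over z, all with the same integral by
  translation invariance. The power k^(2p) is made of k^(p-1) from the power mean, k from the number
  of terms and k^p from pairing with k z instead of z.\<close>

lemma pair_osc_multiple:
  fixes u :: "'a::euclidean_space \<Rightarrow> 'a"
  assumes p: "1 \<le> p" and u[measurable]: "u \<in> borel_measurable borel" and k: "1 \<le> k"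
  shows "pair_osc p u (real k *\<^sub>R z) \<le> ennreal (real k powr (2 * p)) * pair_osc p u z"
proof -
  define D where "D i x = (u (x + real (Suc i) *\<^sub>R z) - u (x + real i *\<^sub>R z)) \<bullet> z" for i x
  have [measurable]: "D i \<in> borel_measurable borel" for i unfolding D_def[abs_def] by measurable
  have shift: "(\<integral>\<^sup>+ x. ennreal (\<bar>D i x\<bar> powr p) \<partial>lborel) = pair_osc p u z" for i
  proof -
    have "pair_osc p u z = (\<integral>\<^sup>+ x. ennreal (\<bar>(u (real i *\<^sub>R z + x + z) - u (real i *\<^sub>R z + x)) \<bullet> z\<bar> powr p) \<partial>lborel)"
      unfolding pair_osc_def by (subst nn_integral_lborel_affine[where c = 1 and t = "real i *\<^sub>R z"]) simp_all
    then show ?thesis by (simp add: D_def algebra_simps)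
  qed
  have pw: "\<bar>(u (x + real k *\<^sub>R z) - u x) \<bullet> (real k *\<^sub>R z)\<bar> powr p
      \<le> real k powr (2 * p - 1) * (\<Sum>i<k. \<bar>D i x\<bar> powr p)" for x
  proof -
    have "(\<Sum>i<k. D i x) = (\<Sum>i<k. u (x + real (Suc i) *\<^sub>R z) - u (x + real i *\<^sub>R z)) \<bullet> z"
      by (simp add: D_def inner_sum_left)
    also have "\<dots> = (u (x + real k *\<^sub>R z) - u x) \<bullet> z"
      by (subst sum_lessThan_telescope) simp
    finally have "\<bar>(u (x + real k *\<^sub>R z) - u x) \<bullet> (real k *\<^sub>R z)\<bar> = real k * \<bar>\<Sum>i<k. D i x\<bar>"
      by (simp add: abs_mult)
    also have "\<dots> \<le> real k * (\<Sum>i<k. \<bar>D i x\<bar>)"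
      by (intro mult_left_mono sum_abs) auto
    finally have "\<bar>(u (x + real k *\<^sub>R z) - u x) \<bullet> (real k *\<^sub>R z)\<bar> powr p \<le> (real k * (\<Sum>i<k. \<bar>D i x\<bar>)) powr p"
      using p by (intro powr_mono2) auto
    also have "\<dots> = real k powr p * (\<Sum>i<k. \<bar>D i x\<bar>) powr p"
      by (simp add: powr_mult sum_nonneg)
    also have "\<dots> \<le> real k powr p * (real k powr (p - 1) * (\<Sum>i<k. \<bar>D i x\<bar> powr p))"
      using powr_sum_le[OF p, of "{..<k}" "\<lambda>i. \<bar>D i x\<bar>"] by (intro mult_left_mono) auto
    also have "\<dots> = real k powr (2 * p - 1) * (\<Sum>i<k. \<bar>D i x\<bar> powr p)"
      using powr_add[of "real k" p "p - 1"] by (simp add: algebra_simps)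
    finally show ?thesis .
  qed
  have "pair_osc p u (real k *\<^sub>R z) \<le> (\<integral>\<^sup>+ x. ennreal (real k powr (2 * p - 1)) * (\<Sum>i<k. ennreal (\<bar>D i x\<bar> powr p)) \<partial>lborel)"
    unfolding pair_osc_def
    using pw by (intro nn_integral_mono) (simp add: ennreal_mult[symmetric] sum_nonneg)
  also have "\<dots> = ennreal (real k powr (2 * p - 1)) * (of_nat k * pair_osc p u z)"
    by (simp add: nn_integral_cmult nn_integral_sum shift del: sum_ennreal)
  also have "\<dots> = ennreal (real k powr (2 * p)) * pair_osc p u z"
    using k by (simp add: ennreal_of_nat_eq_real_of_nat mult.assoc[symmetric] powr_diff flip: ennreal_mult)
  finally show ?thesis .
qed

text \<open>At most \<delta>/t indices satisfy k t <= \<delta>, and each contributes at most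
  t/(\<theta>\<delta>). For t = 0 the lower constraint fails since \<theta>\<delta> > 0.\<close>

lemma sum_inverse_scaling_le:
  fixes \<delta> \<theta> t :: real
  assumes "0 < \<theta>" "0 < \<delta>" "0 \<le> t"
  shows "(\<Sum>k<n. if 1 \<le> k \<and> \<theta> * \<delta> \<le> real k * t \<and> real k * t \<le> \<delta> then 1 / real k else 0) \<le> 1 / \<theta>"
proof (cases "t = 0")
  case False
  then have t: "t > 0" using assms by simp
  define I where "I = {k. k < n \<and> 1 \<le> k \<and> \<theta> * \<delta> \<le> real k * t \<and> real k * t \<le> \<delta>}"
  have "I \<subseteq> {1..nat \<lfloor>\<delta> / t\<rfloor>}"
    using t by (auto simp: I_def le_nat_floor pos_le_divide_eq)
  then have "card I \<le> nat \<lfloor>\<delta> / t\<rfloor>" using card_mono[of "{1..nat \<lfloor>\<delta> / t\<rfloor>}" I] by simp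
  then have "real (card I) \<le> real (nat \<lfloor>\<delta> / t\<rfloor>)" by simp
  also have "\<dots> \<le> \<delta> / t" using t assms by simp
  finally have c: "real (card I) \<le> \<delta> / t" .
  have "(\<Sum>k<n. if 1 \<le> k \<and> \<theta> * \<delta> \<le> real k * t \<and> real k * t \<le> \<delta> then 1 / real k else 0) = (\<Sum>k\<in>I. 1 / real k)"
    unfolding I_def by (rule sum.mono_neutral_cong_right) auto
  also have "\<dots> \<le> (\<Sum>k\<in>I. t / (\<theta> * \<delta>))"
    using assms t by (intro sum_mono) (auto simp: I_def field_simps)
  also have "\<dots> = real (card I) * (t / (\<theta> * \<delta>))" by simp
  also have "\<dots> \<le> (\<delta> / t) * (t / (\<theta> * \<delta>))" using c t assms by (intro mult_right_mono) auto
  also have "\<dots> = 1 / \<theta>" using t assms by simp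
  finally show ?thesis .
next
  case True
  then have "(\<Sum>k<n. if 1 \<le> k \<and> \<theta> * \<delta> \<le> real k * t \<and> real k * t \<le> \<delta> then 1 / real k else 0) = 0"
    using assms by (intro sum.neutral) (auto simp: not_le)
  then show ?thesis using assms by simp
qed

text \<open>\<open>P k\<close> stands for a lower bound, up to the constant \<open>c\<close>, of the
  kernel on the k-th rescaled shell. For each k the substitution z = k w produces
  \<open>k ^ DIM('a)\<close>, so the weight leaves 1/k, and the overlap of the shells is counted by
  \<open>sum_inverse_scaling_le\<close>.\<close>

lemma shell_estimate:
  fixes u :: "'a::euclidean_space \<Rightarrow> 'a" and K :: "'a \<Rightarrow> ennreal" and P :: "nat \<Rightarrow> ennreal"
  assumes p: "1 \<le> p" and u[measurable]: "u \<in> borel_measurable borel"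
    and K[measurable]: "K \<in> borel_measurable borel"
    and S[measurable]: "S \<in> sets borel"
    and shell: "\<And>z. z \<in> S \<Longrightarrow> \<theta> * \<delta> \<le> norm z \<and> norm z \<le> \<delta>"
    and \<theta>: "0 < \<theta>" and \<delta>: "0 < \<delta>" and k0: "1 \<le> k0"
    and P: "\<And>z k. z \<in> S \<Longrightarrow> k0 \<le> k \<Longrightarrow> P k \<le> c * K (z /\<^sub>R real k)"
  shows "(\<Sum>k. if k0 \<le> k then P k * ennreal (1 / real k ^ (DIM('a) + 1)) else 0)
            * (\<integral>\<^sup>+ z. indicator S z * pair_osc p u z \<partial>lborel)
         \<le> ennreal (\<delta> powr (2 * p) / \<theta>) * (c * (\<integral>\<^sup>+ z. K z * (ennreal (norm z powr (- 2 * p)) * pair_osc p u z) \<partial>lborel))"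
proof -
  define G where "G w = K w * (ennreal (norm w powr (- 2 * p)) * pair_osc p u w)" for w
  have [measurable]: "G \<in> borel_measurable borel" unfolding G_def[abs_def] by measurable
  define H where "H = (\<integral>\<^sup>+ z. indicator S z * pair_osc p u z \<partial>lborel)"
  \<comment> \<open>The share of the point w in the k-th inequality after the change of
    variables.\<close>
  define a where "a k w = (if k0 \<le> k then ennreal (1 / real k) * indicator S (real k *\<^sub>R w) else 0)" for k w
  have [measurable]: "a k \<in> borel_measurable borel" for k unfolding a_def[abs_def] by measurable
  define C where "C = ennreal (\<delta> powr (2 * p)) * c"
  have step: "P k * ennreal (1 / real k ^ (DIM('a) + 1)) * H
      \<le> C * (\<integral>\<^sup>+ w. ennreal (1 / real k) * indicator S (real k *\<^sub>R w) * G w \<partial>lborel)" if k: "k0 \<le> k" for k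
  proof -
    have k1: "1 \<le> k" using k k0 by simp
    have "P k * H = (\<integral>\<^sup>+ z. P k * (indicator S z * pair_osc p u z) \<partial>lborel)"
      unfolding H_def by (intro nn_integral_cmult[symmetric]) measurable
    also have "\<dots> \<le> (\<integral>\<^sup>+ z. C * (ennreal (1) * indicator S z * G (z /\<^sub>R real k)) \<partial>lborel)"
    proof (rule nn_integral_mono)
      fix z
      show "P k * (indicator S z * pair_osc p u z) \<le> C * (ennreal 1 * indicator S z * G (z /\<^sub>R real k))"
      proof (cases "z \<in> S")
        case True
        have n: "0 < norm z" "norm z \<le> \<delta>"
          using shell[OF True] mult_pos_pos[OF \<theta> \<delta>] by linarith+
        have "pair_osc p u z \<le> ennreal (real k powr (2 * p)) * pair_osc p u (z /\<^sub>R real k)"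
          using pair_osc_multiple[OF p u k1, of "z /\<^sub>R real k"] k1 by simp
        \<comment> \<open>The bound |z| <= \<delta> trades the telescoping factor for the weight
          |z/k|^(-2p) of the seminorm, at the fixed price \<delta>^(2p).\<close>
        also have "real k powr (2 * p) \<le> \<delta> powr (2 * p) * norm (z /\<^sub>R real k) powr (- 2 * p)"
        proof -
          have "norm (z /\<^sub>R real k) = norm z / real k" by (simp add: divide_inverse mult.commute)
          then have X: "norm (z /\<^sub>R real k) powr (- 2 * p) = real k powr (2 * p) / norm z powr (2 * p)"
            using n k1 powr_minus_divide[of "norm z / real k" "2 * p"] by (simp add: powr_divide)
          have "norm z powr (2 * p) \<le> \<delta> powr (2 * p)"
            using n p by (intro powr_mono2) auto
          then have "norm z powr (2 * p) * norm (z /\<^sub>R real k) powr (- 2 * p) \<le> \<delta> powr (2 * p) * norm (z /\<^sub>R real k) powr (- 2 * p)"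
            by (intro mult_right_mono) auto
          moreover have "norm z powr (2 * p) * norm (z /\<^sub>R real k) powr (- 2 * p) = real k powr (2 * p)"
            unfolding X using n by simp
          ultimately show ?thesis by (simp only:)
        qed
        finally have "pair_osc p u z \<le> ennreal (\<delta> powr (2 * p) * norm (z /\<^sub>R real k) powr (- 2 * p)) * pair_osc p u (z /\<^sub>R real k)"
          by (simp add: mult_right_mono ennreal_leI)
        then have "P k * pair_osc p u z \<le> (c * K (z /\<^sub>R real k)) *
            (ennreal (\<delta> powr (2 * p) * norm (z /\<^sub>R real k) powr (- 2 * p)) * pair_osc p u (z /\<^sub>R real k))"
          using P[OF True k] by (intro mult_mono) auto
        also have "\<dots> = C * G (z /\<^sub>R real k)"
          unfolding C_def G_def by (simp only: ennreal_mult[OF powr_ge_zero powr_ge_zero] mult_ac)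
        finally show ?thesis using True by simp
      qed simp
    qed
    also have "\<dots> = C * (\<integral>\<^sup>+ z. indicator S z * G (z /\<^sub>R real k) \<partial>lborel)"
      by (subst nn_integral_cmult[symmetric]) simp_all
    also have "(\<integral>\<^sup>+ z. indicator S z * G (z /\<^sub>R real k) \<partial>lborel)
       = ennreal (real k ^ DIM('a)) * (\<integral>\<^sup>+ w. indicator S (real k *\<^sub>R w) * G w \<partial>lborel)"
      using k1 by (subst nn_integral_lborel_affine[where c = "real k" and t = 0]) simp_all
    finally have "P k * H \<le> C * (ennreal (real k ^ DIM('a)) * (\<integral>\<^sup>+ w. indicator S (real k *\<^sub>R w) * G w \<partial>lborel))" .
    then have "ennreal (1 / real k ^ (DIM('a) + 1)) * (P k * H) \<le> ennreal (1 / real k ^ (DIM('a) + 1)) *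
        (C * (ennreal (real k ^ DIM('a)) * (\<integral>\<^sup>+ w. indicator S (real k *\<^sub>R w) * G w \<partial>lborel)))"
      by (rule mult_left_mono) simp
    also have "\<dots> = C * ((ennreal (1 / real k ^ (DIM('a) + 1)) * ennreal (real k ^ DIM('a))) * (\<integral>\<^sup>+ w. indicator S (real k *\<^sub>R w) * G w \<partial>lborel))"
      by (simp only: mult_ac)
    also have "ennreal (1 / real k ^ (DIM('a) + 1)) * ennreal (real k ^ DIM('a)) = ennreal (1 / real k)"
      using k1 by (simp flip: ennreal_mult)
    also have "ennreal (1 / real k) * (\<integral>\<^sup>+ w. indicator S (real k *\<^sub>R w) * G w \<partial>lborel)
        = (\<integral>\<^sup>+ w. ennreal (1 / real k) * indicator S (real k *\<^sub>R w) * G w \<partial>lborel)"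
      by (subst nn_integral_cmult[symmetric]) (simp_all add: mult.assoc)
    finally show ?thesis by (simp add: mult_ac)
  qed
  have "(\<Sum>k. if k0 \<le> k then P k * ennreal (1 / real k ^ (DIM('a) + 1)) else 0) * H
      = (\<Sum>k. (if k0 \<le> k then P k * ennreal (1 / real k ^ (DIM('a) + 1)) else 0) * H)"
    by simp
  also have "\<dots> \<le> (\<Sum>k. C * (\<integral>\<^sup>+ w. a k w * G w \<partial>lborel))"
    by (intro suminf_le summableI) (use step in \<open>auto simp: a_def\<close>)
  also have "\<dots> = C * (\<Sum>k. (\<integral>\<^sup>+ w. a k w * G w \<partial>lborel))" by simp
  also have "(\<Sum>k. (\<integral>\<^sup>+ w. a k w * G w \<partial>lborel)) = (\<integral>\<^sup>+ w. (\<Sum>k. a k w * G w) \<partial>lborel)"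
    by (intro nn_integral_suminf[symmetric]) measurable
  \<comment> \<open>The point w lies in the k-th shell only if \<theta>\<delta> <= k |w| <=
    \<delta>, so the coefficients of \<open>G w\<close> sum to at most 1/\<theta>.\<close>
  also have "\<dots> \<le> (\<integral>\<^sup>+ w. ennreal (1 / \<theta>) * G w \<partial>lborel)"
  proof (rule nn_integral_mono)
    fix w :: 'a
    have "(\<Sum>k<n. a k w) \<le> ennreal (1 / \<theta>)" for n
    proof -
      have "(\<Sum>k<n. a k w) \<le> (\<Sum>k<n. ennreal (if 1 \<le> k \<and> \<theta> * \<delta> \<le> real k * norm w \<and> real k * norm w \<le> \<delta> then 1 / real k else 0))"
      proof (rule sum_mono)
        fix k
        show "a k w \<le> ennreal (if 1 \<le> k \<and> \<theta> * \<delta> \<le> real k * norm w \<and> real k * norm w \<le> \<delta> then 1 / real k else 0)"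
          using shell[of "real k *\<^sub>R w"] k0 by (auto simp: a_def indicator_def)
      qed
      also have "\<dots> \<le> ennreal (1 / \<theta>)"
        using sum_inverse_scaling_le[OF \<theta> \<delta>, of "norm w" n] by (subst sum_ennreal) (auto intro: ennreal_leI)
      finally show ?thesis .
    qed
    then have "(\<Sum>k. a k w) \<le> ennreal (1 / \<theta>)" by (intro suminf_le_const summableI)
    then show "(\<Sum>k. a k w * G w) \<le> ennreal (1 / \<theta>) * G w" by (simp add: mult_right_mono)
  qed
  also have "\<dots> = ennreal (1 / \<theta>) * (\<integral>\<^sup>+ w. G w \<partial>lborel)" by (rule nn_integral_cmult) measurable
  also have "C * (ennreal (1 / \<theta>) * (\<integral>\<^sup>+ w. G w \<partial>lborel))
      = (ennreal (\<delta> powr (2 * p)) * ennreal (1 / \<theta>)) * (c * (\<integral>\<^sup>+ w. G w \<partial>lborel))"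
    unfolding C_def by (simp only: mult_ac)
  also have "ennreal (\<delta> powr (2 * p)) * ennreal (1 / \<theta>) = ennreal (\<delta> powr (2 * p) / \<theta>)"
    using \<theta> by (simp flip: ennreal_mult)
  finally show ?thesis unfolding H_def G_def by (simp add: mult_left_mono)
qed

text \<open>The intervals [\<delta>/k, \<delta>/(k-1)] with k >= k0 cover the range of r, and each
  has length \<delta>/(k(k-1)). In the application \<open>Q\<close> is an uncountable infimum of
  unclear measurability, so it is only bounded from above by step functions.\<close>

lemma radial_integral_le_sum:
  fixes Q :: "real \<Rightarrow> ennreal"
  assumes \<delta>: "0 < \<delta>" and k0: "2 \<le> k0" and N: "1 \<le> N"
  shows "(\<integral>\<^sup>+ r\<in>{0<..<\<delta> / (real k0 - 1)}. Q r * ennreal (r ^ (N - 1)) \<partial>lborel)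
     \<le> ennreal (2 ^ N * \<delta> ^ N) * (\<Sum>k. if k0 \<le> k
          then (SUP r\<in>{\<delta> / real k..\<delta> / (real k - 1)}. Q r) * ennreal (1 / real k ^ (N + 1)) else 0)"
proof -
  define I where "I k = {\<delta> / real k..\<delta> / (real k - 1)}" for k
  define P where "P k = (SUP r\<in>I k. Q r)" for k
  define b where "b k r = (if k0 \<le> k then P k * ennreal ((\<delta> / (real k - 1)) ^ (N - 1)) * indicator (I k) r else 0)" for k r
  have [measurable]: "b k \<in> borel_measurable borel" for k
    unfolding b_def[abs_def] I_def by measurable
  have "(\<integral>\<^sup>+ r\<in>{0<..<\<delta> / (real k0 - 1)}. Q r * ennreal (r ^ (N - 1)) \<partial>lborel) \<le> (\<integral>\<^sup>+ r. (\<Sum>k. b k r) \<partial>lborel)"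
  proof (rule nn_integral_mono)
    fix r :: real
    show "Q r * ennreal (r ^ (N - 1)) * indicator {0<..<\<delta> / (real k0 - 1)} r \<le> (\<Sum>k. b k r)"
    proof (cases "r \<in> {0<..<\<delta> / (real k0 - 1)}")
      case True
      then have r: "0 < r" "r < \<delta> / (real k0 - 1)" by auto
      \<comment> \<open>This k satisfies k - 1 <= \<delta>/r <= k, which is membership of r in
        \<open>I k\<close>.\<close>
      define k where "k = nat \<lfloor>\<delta> / r\<rfloor> + 1"
      have dr: "real k0 - 1 < \<delta> / r" using r k0 by (simp add: field_simps)
      then have "int k0 - 1 \<le> \<lfloor>\<delta> / r\<rfloor>" by (simp add: le_floor_iff)
      then have k: "k0 \<le> k" "real k - 1 = of_int \<lfloor>\<delta> / r\<rfloor>" using k0 by (auto simp: k_def)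
      then have kr: "real k - 1 \<le> \<delta> / r" "\<delta> / r \<le> real k" by linarith+
      have k1: "1 \<le> real k - 1" using k k0 by linarith
      have rI: "\<delta> / real k \<le> r" "r \<le> \<delta> / (real k - 1)" using kr r k1 by (auto simp: field_simps)
      then have "r \<in> I k" by (simp add: I_def)
      have "Q r * ennreal (r ^ (N - 1)) \<le> P k * ennreal ((\<delta> / (real k - 1)) ^ (N - 1))"
        using rI r \<open>r \<in> I k\<close> unfolding P_def
        by (intro mult_mono ennreal_leI power_mono SUP_upper) auto
      also have "\<dots> = (\<Sum>i\<in>{k}. b i r)" using k \<open>r \<in> I k\<close> by (simp add: b_def)
      also have "\<dots> \<le> (\<Sum>i. b i r)" by (intro sum_le_suminf summableI) auto
      finally show ?thesis using True by simp
    qed simp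
  qed
  also have "\<dots> = (\<Sum>k. (\<integral>\<^sup>+ r. b k r \<partial>lborel))" by (intro nn_integral_suminf) measurable
  also have "\<dots> \<le> (\<Sum>k. ennreal (2 ^ N * \<delta> ^ N) * (if k0 \<le> k then P k * ennreal (1 / real k ^ (N + 1)) else 0))"
  proof (intro suminf_le summableI)
    fix k
    show "(\<integral>\<^sup>+ r. b k r \<partial>lborel) \<le> ennreal (2 ^ N * \<delta> ^ N) * (if k0 \<le> k then P k * ennreal (1 / real k ^ (N + 1)) else 0)"
    proof (cases "k0 \<le> k")
      case True
      then have k: "2 \<le> real k" using k0 by simp
      have le: "\<delta> / real k \<le> \<delta> / (real k - 1)" using k \<delta> by (intro divide_left_mono) auto
      have "(\<integral>\<^sup>+ r. b k r \<partial>lborel) = P k * ennreal ((\<delta> / (real k - 1)) ^ (N - 1)) * emeasure lborel (I k)"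
        unfolding b_def I_def using True by (simp add: nn_integral_cmult_indicator)
      also have "emeasure lborel (I k) = ennreal (\<delta> / (real k - 1) - \<delta> / real k)"
        unfolding I_def using le by simp
      also have "P k * ennreal ((\<delta> / (real k - 1)) ^ (N - 1)) * ennreal (\<delta> / (real k - 1) - \<delta> / real k)
          = P k * ennreal ((\<delta> / (real k - 1)) ^ (N - 1) * (\<delta> / (real k - 1) - \<delta> / real k))"
        using le \<delta> k by (simp add: ennreal_mult mult.assoc)
      also have "(\<delta> / (real k - 1)) ^ (N - 1) * (\<delta> / (real k - 1) - \<delta> / real k) = (\<delta> / (real k - 1)) ^ N * (1 / real k)"
      proof -
        have "\<delta> / (real k - 1) - \<delta> / real k = \<delta> / (real k - 1) * (1 / real k)"
          using k by (simp add: field_simps)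
        moreover have "(\<delta> / (real k - 1)) ^ N = (\<delta> / (real k - 1)) ^ (N - 1) * (\<delta> / (real k - 1))"
          using N by (metis Suc_diff_1 power_Suc2 less_eq_Suc_le One_nat_def)
        ultimately show ?thesis by simp
      qed
      \<comment> \<open>From k >= 2 follows k - 1 >= k/2; this is where \<open>2 ^ N\<close> comes
        from.\<close>
      also have "\<dots> \<le> (2 * \<delta> / real k) ^ N * (1 / real k)"
        using k \<delta> by (intro mult_right_mono power_mono) (auto simp: field_simps)
      also have "\<dots> = (2 ^ N * \<delta> ^ N) * (1 / real k ^ (N + 1))"
        by (simp add: power_mult_distrib power_divide)
      finally have "(\<integral>\<^sup>+ r. b k r \<partial>lborel) \<le> P k * ennreal ((2 ^ N * \<delta> ^ N) * (1 / real k ^ (N + 1)))"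
        by (simp add: mult_left_mono ennreal_leI)
      also have "\<dots> = ennreal (2 ^ N * \<delta> ^ N) * (P k * ennreal (1 / real k ^ (N + 1)))"
        using \<delta> by (subst ennreal_mult) (simp_all add: mult_ac)
      finally show ?thesis using True by simp
    qed (simp add: b_def)
  qed
  also have "\<dots> = ennreal (2 ^ N * \<delta> ^ N) * (\<Sum>k. if k0 \<le> k then P k * ennreal (1 / real k ^ (N + 1)) else 0)"
    by simp
  finally show ?thesis unfolding P_def I_def .
qed

text \<open>Rescaling the shell to unit size makes the powers \<open>\<delta> ^ DIM('a)\<close>
  cancel. One of the two factors \<delta>^p in \<open>shell_estimate\<close> is used up by pairing
  with \<delta> z; the remaining one is the numerator in the hypothesis on the kernel.\<close>

lemma scaled_osc_estimate:
  fixes u :: "'a::euclidean_space \<Rightarrow> 'a" and K :: "'a \<Rightarrow> ennreal" and Q :: "real \<Rightarrow> ennreal"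
  assumes p: "1 \<le> p" and u[measurable]: "u \<in> borel_measurable borel"
    and K[measurable]: "K \<in> borel_measurable borel"
    and E[measurable]: "E \<in> sets borel"
    and shell: "\<And>z. z \<in> E \<Longrightarrow> \<theta> \<le> norm z \<and> norm z \<le> 1"
    and \<theta>: "0 < \<theta>" and \<delta>: "0 < \<delta>" and k0: "2 \<le> k0"
    and P: "\<And>z k. z \<in> E \<Longrightarrow> k0 \<le> k \<Longrightarrow>
       (SUP r\<in>{\<delta> / real k..\<delta> / (real k - 1)}. Q r) \<le> c * K ((\<delta> / real k) *\<^sub>R z)"
  shows "(\<integral>\<^sup>+ r\<in>{0<..<\<delta> / (real k0 - 1)}. Q r * ennreal (r ^ (DIM('a) - 1)) \<partial>lborel)
           * (\<integral>\<^sup>+ z. indicator E z * (\<integral>\<^sup>+ x. ennreal (\<bar>(u (x + \<delta> *\<^sub>R z) - u x) \<bullet> z\<bar> powr p) \<partial>lborel) \<partial>lborel)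
        \<le> ennreal (2 ^ DIM('a) / \<theta> * \<delta> powr p)
            * (c * (\<integral>\<^sup>+ z. K z * (ennreal (norm z powr (- 2 * p)) * pair_osc p u z) \<partial>lborel))"
proof -
  define J where "J = c * (\<integral>\<^sup>+ z. K z * (ennreal (norm z powr (- 2 * p)) * pair_osc p u z) \<partial>lborel)"
  define m where "m = (\<integral>\<^sup>+ r\<in>{0<..<\<delta> / (real k0 - 1)}. Q r * ennreal (r ^ (DIM('a) - 1)) \<partial>lborel)"
  define P where "P k = (SUP r\<in>{\<delta> / real k..\<delta> / (real k - 1)}. Q r)" for k
  define \<Sigma> where "\<Sigma> = (\<Sum>k. if k0 \<le> k then P k * ennreal (1 / real k ^ (DIM('a) + 1)) else 0)"
  define X where "X = (\<integral>\<^sup>+ z. indicator E z * (\<integral>\<^sup>+ x. ennreal (\<bar>(u (x + \<delta> *\<^sub>R z) - u x) \<bullet> z\<bar> powr p) \<partial>lborel) \<partial>lborel)"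
  define S where "S = (\<lambda>z. z /\<^sub>R \<delta>) -` E"
  have [measurable]: "S \<in> sets borel"
    unfolding S_def using measurable_sets[of "\<lambda>z::'a. z /\<^sub>R \<delta>" borel borel E] by simp
  have ind: "indicator S (\<delta> *\<^sub>R z) = (indicator E z :: ennreal)" for z
    using \<delta> by (simp add: S_def indicator_def)
  have osc: "pair_osc p u (\<delta> *\<^sub>R z) = ennreal (\<delta> powr p) * (\<integral>\<^sup>+ x. ennreal (\<bar>(u (x + \<delta> *\<^sub>R z) - u x) \<bullet> z\<bar> powr p) \<partial>lborel)" for z
    unfolding pair_osc_def using \<delta>
    by (subst nn_integral_cmult[symmetric]) (simp_all add: abs_mult powr_mult ennreal_mult)
  have "(\<integral>\<^sup>+ z. indicator S z * pair_osc p u z \<partial>lborel)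
      = ennreal (\<delta> ^ DIM('a)) * (\<integral>\<^sup>+ z. indicator S (\<delta> *\<^sub>R z) * pair_osc p u (\<delta> *\<^sub>R z) \<partial>lborel)"
    using \<delta> by (subst nn_integral_lborel_affine[where c = \<delta> and t = 0]) simp_all
  also have "(\<integral>\<^sup>+ z. indicator S (\<delta> *\<^sub>R z) * pair_osc p u (\<delta> *\<^sub>R z) \<partial>lborel) = ennreal (\<delta> powr p) * X"
    unfolding X_def ind osc
    by (subst nn_integral_cmult[symmetric]) (simp_all add: mult_ac)
  finally have SX: "(\<integral>\<^sup>+ z. indicator S z * pair_osc p u z \<partial>lborel) = ennreal (\<delta> ^ DIM('a)) * (ennreal (\<delta> powr p) * X)" .
  have main: "\<Sigma> * (\<integral>\<^sup>+ z. indicator S z * pair_osc p u z \<partial>lborel) \<le> ennreal (\<delta> powr (2 * p) / \<theta>) * J"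
    unfolding \<Sigma>_def J_def
  proof (rule shell_estimate[OF p u K _ _ \<theta> \<delta>])
    show "\<theta> * \<delta> \<le> norm z \<and> norm z \<le> \<delta>" if "z \<in> S" for z
      using that shell[of "z /\<^sub>R \<delta>"] \<delta> by (auto simp: S_def field_simps)
    show "P k \<le> c * K (z /\<^sub>R real k)" if "z \<in> S" "k0 \<le> k" for z k
    proof -
      have "(\<delta> / real k) *\<^sub>R (z /\<^sub>R \<delta>) = z /\<^sub>R real k" using \<delta> by (simp add: divide_inverse)
      moreover have "P k \<le> c * K ((\<delta> / real k) *\<^sub>R (z /\<^sub>R \<delta>))"
        unfolding P_def by (rule P) (use that in \<open>simp_all add: S_def\<close>)
      ultimately show ?thesis by (simp only:)
    qed
  qed (use k0 in auto)
  have "m * X \<le> (ennreal (2 ^ DIM('a) * \<delta> ^ DIM('a)) * \<Sigma>) * X"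
    unfolding m_def \<Sigma>_def P_def by (intro mult_right_mono radial_integral_le_sum \<delta> k0) auto
  also have "\<dots> = ennreal (2 ^ DIM('a) / \<delta> powr p) * (\<Sigma> * (ennreal (\<delta> ^ DIM('a)) * (ennreal (\<delta> powr p) * X)))"
  proof -
    have "ennreal (2 ^ DIM('a) * \<delta> ^ DIM('a)) = ennreal (2 ^ DIM('a) / \<delta> powr p) * ennreal (\<delta> ^ DIM('a)) * ennreal (\<delta> powr p)"
      using \<delta> by (simp flip: ennreal_mult)
    then show ?thesis by (simp only: mult_ac)
  qed
  also have "\<dots> \<le> ennreal (2 ^ DIM('a) / \<delta> powr p) * (ennreal (\<delta> powr (2 * p) / \<theta>) * J)"
    using main unfolding SX by (rule mult_left_mono) simp
  also have "\<dots> = ennreal (2 ^ DIM('a) / \<theta> * \<delta> powr p) * J"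
  proof -
    have "2 ^ DIM('a) / \<delta> powr p * (\<delta> powr (2 * p) / \<theta>) = 2 ^ DIM('a) / \<theta> * \<delta> powr p"
      using \<delta> powr_add[of \<delta> p p] by simp
    then show ?thesis using \<theta> by (simp add: mult.assoc[symmetric] flip: ennreal_mult)
  qed
  finally show ?thesis unfolding m_def X_def J_def .
qed

section \<open>Cones over sets of positive Hausdorff measure\<close>

text \<open>Disjoint balls along the axis, in place of a formula in polar coordinates, give the
  exponent \<open>DIM('a) - 1\<close>, which matches the gauge of the Hausdorff measure.\<close>

lemma tube_measure_ge:
  fixes v :: "'a::euclidean_space"
  assumes v: "norm v = 1" and a: "0 < a" "a < 1" and r: "0 < r" "r \<le> 1 - a"
  shows "ennreal ((1 - a) / 4 * (a / 2) ^ (DIM('a) - 1) * measure lborel (ball (0::'a) 1) * r ^ (DIM('a) - 1))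
    \<le> emeasure lborel {z::'a. a \<le> norm z \<and> norm z \<le> 1 \<and> z /\<^sub>R norm z \<in> cball v r}"
    (is "_ \<le> emeasure lborel ?T")
proof -
  \<comment> \<open>the tube contains about \<open>1 / r\<close> disjoint balls of radius \<open>q\<close> centred on its axis\<close>
  define q where "q = a * r / 2"
  have q: "q > 0" "2 * q \<le> 1 - a"
    using a r mult_mono[of a 1 r "1 - a"] by (auto simp: q_def)
  \<comment> \<open>The balls are strung along an axis of length 1 - a at spacing 2q; rounding down
    loses at most a factor 2 because (1-a)/(2q) >= 1.\<close>
  define n where "n = nat \<lfloor>(1 - a) / (2 * q)\<rfloor>"
  define s where "s j = a + q + 2 * q * real j" for j
  have x1: "1 \<le> (1 - a) / (2 * q)" using q by simp
  then have n: "real n \<le> (1 - a) / (2 * q)" "(1 - a) / (4 * q) \<le> real n"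
  proof -
    define y where "y = (1 - a) / (2 * q)"
    have "1 \<le> \<lfloor>y\<rfloor>" using x1 by (simp add: y_def le_floor_iff)
    moreover from this have "real n = of_int \<lfloor>y\<rfloor>" by (simp add: n_def y_def)
    moreover have "(1 - a) / (4 * q) = y / 2" by (simp add: y_def)
    ultimately show "real n \<le> (1 - a) / (2 * q)" "(1 - a) / (4 * q) \<le> real n"
      unfolding y_def[symmetric] by linarith+
  qed
  have sn: "a + q \<le> s j" "s j \<le> 1 - q" if "j < n" for j
  proof -
    show "a + q \<le> s j" using q by (simp add: s_def)
    have "2 * q * (real j + 1) \<le> 2 * q * real n" using that q by (intro mult_left_mono) auto
    also have "\<dots> \<le> 1 - a" using n(1) q by (simp add: field_simps)
    finally show "s j \<le> 1 - q" by (simp add: s_def algebra_simps)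
  qed
  have sub: "ball (s j *\<^sub>R v) q \<subseteq> ?T" if "j < n" for j
  proof
    fix z assume "z \<in> ball (s j *\<^sub>R v) q"
    then have z: "norm (z - s j *\<^sub>R v) < q" by (simp add: dist_norm norm_minus_commute)
    have s: "a < s j" "0 < s j" using sn(1)[OF that] q a by linarith+
    have nz: "\<bar>norm z - s j\<bar> < q"
      using z norm_triangle_ineq3[of z "s j *\<^sub>R v"] v s by simp
    then have nz': "a \<le> norm z" "norm z \<le> 1" "0 < norm z" using sn[OF that] a by linarith+
    \<comment> \<open>Scaling by \<open>norm z\<close> splits the deviation of the direction into a
      radial and a Euclidean error, each smaller than q.\<close>
    have "norm z * dist v (z /\<^sub>R norm z) = norm (norm z *\<^sub>R (v - z /\<^sub>R norm z))"
      by (simp add: dist_norm)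
    also have "norm z *\<^sub>R (v - z /\<^sub>R norm z) = (norm z - s j) *\<^sub>R v - (z - s j *\<^sub>R v)"
      using nz' by (simp add: algebra_simps)
    also have "norm \<dots> \<le> \<bar>norm z - s j\<bar> + norm (z - s j *\<^sub>R v)"
      using norm_triangle_ineq4[of "(norm z - s j) *\<^sub>R v" "z - s j *\<^sub>R v"] v by simp
    also have "\<dots> \<le> 2 * q" using nz z by simp
    \<comment> \<open>Here the value q = a r / 2 is used: 2 q = a r, and \<open>norm z\<close> is at
      least a.\<close>
    also have "\<dots> \<le> norm z * r" using nz' r by (simp add: q_def)
    finally have "dist v (z /\<^sub>R norm z) \<le> r" using nz' by simp
    then show "z \<in> ?T" using nz' by simp
  qed
  have disj: "disjoint_family_on (\<lambda>j. ball (s j *\<^sub>R v) q) {..<n}"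
    unfolding disjoint_family_on_def
  proof (intro ballI impI)
    fix i j :: nat assume "i \<noteq> j"
    then have "1 \<le> \<bar>real i - real j\<bar>" by linarith
    then have "2 * q \<le> 2 * q * \<bar>real i - real j\<bar>" using q by simp
    also have "\<dots> = \<bar>s i - s j\<bar>" using q by (simp add: s_def abs_mult flip: right_diff_distrib)
    also have "\<dots> = dist (s i *\<^sub>R v) (s j *\<^sub>R v)" using v by (simp add: dist_norm flip: scaleR_left_diff_distrib)
    finally have d: "2 * q \<le> dist (s i *\<^sub>R v) (s j *\<^sub>R v)" .
    show "ball (s i *\<^sub>R v) q \<inter> ball (s j *\<^sub>R v) q = {}"
    proof (rule ccontr)
      assume "ball (s i *\<^sub>R v) q \<inter> ball (s j *\<^sub>R v) q \<noteq> {}"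
      then obtain z where "dist (s i *\<^sub>R v) z < q" "dist (s j *\<^sub>R v) z < q" by auto
      then show False using d dist_triangle2[of "s i *\<^sub>R v" "s j *\<^sub>R v" z] by linarith
    qed
  qed
  have T[measurable]: "?T \<in> sets borel"
    unfolding mem_cball by measurable
  have eb: "emeasure lborel (ball x q) = ennreal (q ^ DIM('a) * measure lborel (ball (0::'a) 1))" for x :: 'a
    using content_ball_conv_unit_ball[of q x] q emeasure_bounded_finite[of "ball x q"]
    by (subst emeasure_eq_ennreal_measure) (auto simp: less_top)
  have "(1 - a) / 4 * (a / 2) ^ (DIM('a) - 1) * measure lborel (ball (0::'a) 1) * r ^ (DIM('a) - 1)
      = (1 - a) / (4 * q) * (q ^ DIM('a) * measure lborel (ball (0::'a) 1))"
  proof -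
    have "q ^ DIM('a) = q * q ^ (DIM('a) - 1)" using DIM_positive[where 'a='a] by (metis Suc_diff_1 power_Suc)
    moreover have "q ^ (DIM('a) - 1) = (a / 2) ^ (DIM('a) - 1) * r ^ (DIM('a) - 1)"
      by (simp add: q_def flip: power_mult_distrib)
    ultimately show ?thesis using q by simp
  qed
  also have "\<dots> \<le> real n * (q ^ DIM('a) * measure lborel (ball (0::'a) 1))"
    using n(2) q by (intro mult_right_mono) auto
  finally have "ennreal ((1 - a) / 4 * (a / 2) ^ (DIM('a) - 1) * measure lborel (ball (0::'a) 1) * r ^ (DIM('a) - 1))
     \<le> ennreal (real n * (q ^ DIM('a) * measure lborel (ball (0::'a) 1)))" by (rule ennreal_leI)
  also have "\<dots> = (\<Sum>j<n. emeasure lborel (ball (s j *\<^sub>R v) q))"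
    unfolding eb using q by (simp add: ennreal_mult ennreal_of_nat_eq_real_of_nat)
  also have "\<dots> = emeasure lborel (\<Union>j<n. ball (s j *\<^sub>R v) q)"
    by (intro sum_emeasure disj) auto
  also have "\<dots> \<le> emeasure lborel ?T"
    using sub by (intro emeasure_mono) auto
  finally show ?thesis .
qed

text \<open>Disjoint balls centred on \<Lambda> carry disjoint tubes, and these fit into an open set
  of measure at most \<epsilon> around the null set. A tube of radius r has volume at least c1 r^m,
  so the sum of the r^m is small, while the fivefold balls from Vitali's lemma still cover
  \<Lambda>.\<close>

lemma hausdorff_outer_null_cone:
  fixes \<Lambda> :: "'a::euclidean_space set"
  assumes \<Lambda>: "\<Lambda> \<subseteq> sphere 0 1" and a: "0 < a" "a < 1"
    and sub: "{z. a \<le> norm z \<and> norm z \<le> 1 \<and> z /\<^sub>R norm z \<in> \<Lambda>} \<subseteq> E"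
    and E: "E \<in> null_sets lborel"
  shows "hausdorff_outer (DIM('a) - 1) \<Lambda> = 0"
proof -
  define m where "m = DIM('a) - 1"
  define T where "T v r = {z::'a. a \<le> norm z \<and> norm z \<le> 1 \<and> z /\<^sub>R norm z \<in> cball v r}" for v r
  have T[measurable]: "T v r \<in> sets borel" for v r
    unfolding T_def mem_cball by measurable
  define c1 where "c1 = (1 - a) / 4 * (a / 2) ^ m * measure lborel (ball (0::'a) 1)"
  have c1: "c1 > 0" using a content_ball_pos[of 1 "0::'a"] by (simp add: c1_def)
  define \<alpha> where "\<alpha> = (pi powr (real m / 2) / Gamma (real m / 2 + 1)) / 2 ^ m"
  have \<alpha>: "\<alpha> \<ge> 0" unfolding \<alpha>_def by (intro divide_nonneg_nonneg) (auto simp: Gamma_real_nonneg)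
  \<comment> \<open>The enlarged balls have diameter 10 r and gauge \<alpha> (10 r)^m, the tubes
    have volume at least c1 r^m; \<beta> is the ratio.\<close>
  define \<beta> where "\<beta> = \<alpha> * 10 ^ m / c1"
  have \<beta>: "\<beta> \<ge> 0" using \<alpha> c1 by (simp add: \<beta>_def)
  define cost where "cost C = (\<Sum>i. (if C i = {} then 0 else ennreal (\<alpha> * diameter (C i) ^ m)))"
    for C :: "nat \<Rightarrow> 'a set"
  define adm where "adm \<delta> = {C :: nat \<Rightarrow> 'a set. \<Lambda> \<subseteq> (\<Union>i. C i) \<and> (\<forall>i. bounded (C i) \<and> diameter (C i) \<le> \<delta>)}" for \<delta>
  have key: "\<exists>C\<in>adm \<delta>. cost C \<le> ennreal \<beta> * ennreal \<epsilon>" if \<delta>: "0 < \<delta>" and \<epsilon>: "0 < \<epsilon>" for \<delta> \<epsilon>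
  proof -
    obtain U where U: "open U" "E \<subseteq> U" "emeasure lborel (U - E) < ennreal \<epsilon>"
      using outer_regular_lborel[OF _ \<epsilon>, of E] null_setsD2[OF E] by auto
    have UE: "emeasure lborel U \<le> ennreal \<epsilon>"
    proof -
      have "emeasure lborel U \<le> emeasure lborel ((U - E) \<union> E)"
        using U E by (intro emeasure_mono) auto
      also have "\<dots> = emeasure lborel (U - E)" using E U by (intro emeasure_Un_null_set) auto
      finally show ?thesis using U by simp
    qed
    have "\<exists>r. 0 < r \<and> r \<le> 1 - a \<and> 10 * r \<le> \<delta> \<and> T v r \<subseteq> U" if v: "v \<in> \<Lambda>" for v
    proof -
      have nv: "norm v = 1" using v \<Lambda> by auto
      \<comment> \<open>The radial segment over v is a compact subset of the open set U, so U
        contains a uniform neighbourhood of it.\<close>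
      have "(\<lambda>s. s *\<^sub>R v) ` {a..1} \<subseteq> U"
      proof
        fix z assume "z \<in> (\<lambda>s. s *\<^sub>R v) ` {a..1}"
        then have "\<exists>s. z = s *\<^sub>R v \<and> a \<le> s \<and> s \<le> 1" by auto
        then obtain s where "z = s *\<^sub>R v" "a \<le> s" "s \<le> 1" by blast
        then show "z \<in> U" using sub U(2) nv v a by (intro subsetD[OF U(2)] subsetD[OF sub]) auto
      qed
      moreover have "compact ((\<lambda>s. s *\<^sub>R v) ` {a..1})"
        by (intro compact_continuous_image continuous_intros) auto
      ultimately obtain e where e: "e > 0" "(\<Union>x\<in>(\<lambda>s. s *\<^sub>R v) ` {a..1}. ball x e) \<subseteq> U"
        using compact_subset_open_imp_ball_epsilon_subset[OF _ U(1)] by metis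
      \<comment> \<open>The three bounds serve, in this order, the inclusion of the tube in U, the
        range allowed in \<open>tube_measure_ge\<close>, and a diameter of at most \<delta> after
        enlargement.\<close>
      define r where "r = Min {e / 2, 1 - a, \<delta> / 10}"
      have r: "0 < r" "r \<le> 1 - a" "10 * r \<le> \<delta>" "r < e" using e a \<delta> by (auto simp: r_def min_def)
      have "T v r \<subseteq> U"
      proof
        fix z assume "z \<in> T v r"
        then have z: "a \<le> norm z" "norm z \<le> 1" "norm (v - z /\<^sub>R norm z) \<le> r" "0 < norm z"
          using a by (auto simp: T_def dist_norm)
        have "dist (norm z *\<^sub>R v) z = norm (norm z *\<^sub>R (v - z /\<^sub>R norm z))"
          using z by (simp add: dist_norm algebra_simps)
        also have "\<dots> \<le> 1 * r" using z unfolding norm_scaleR by (intro mult_mono) auto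
        finally have "z \<in> ball (norm z *\<^sub>R v) e" using r by simp
        then show "z \<in> U" using e(2) z by force
      qed
      then show ?thesis using r by blast
    qed
    then obtain r where r: "\<And>v. v \<in> \<Lambda> \<Longrightarrow> 0 < r v \<and> r v \<le> 1 - a \<and> 10 * r v \<le> \<delta> \<and> T v (r v) \<subseteq> U"
      by metis
    have cov0: "\<Lambda> \<subseteq> (\<Union>v\<in>\<Lambda>. cball v (r v))" using r by force
    have rb: "0 < r v \<and> r v \<le> 1 - a" if "v \<in> \<Lambda>" for v using r[OF that] by blast
    obtain C where C: "countable C" "C \<subseteq> \<Lambda>" "pairwise (\<lambda>i j. disjnt (cball i (r i)) (cball j (r j))) C"
       and cov: "\<Lambda> \<subseteq> (\<Union>i\<in>C. cball i (5 * r i))"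
      by (rule Vitali_covering_lemma_cballs[where a = "\<lambda>v. v", OF cov0 rb])
    define J where "J = to_nat_on C ` C"
    define w where "w = from_nat_into C"
    have wC: "w i \<in> C" "to_nat_on C (w i) = i" if "i \<in> J" for i
      using that C(1) by (auto simp: J_def w_def)
    \<comment> \<open>The family C may be finite; the remaining indices get the empty set, whose
      contribution in \<open>hausdorff_outer\<close> is 0 by convention.\<close>
    define D where "D i = (if i \<in> J then cball (w i) (5 * r (w i)) else {})" for i
    define S where "S i = (if i \<in> J then T (w i) (r (w i)) else {})" for i
    have [measurable]: "S i \<in> sets lborel" for i by (simp add: S_def)
    have disj: "disjoint_family S"
      unfolding disjoint_family_on_def
    proof (intro ballI impI)
      fix i j :: nat assume ij: "i \<noteq> j"
      show "S i \<inter> S j = {}"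
      proof (cases "i \<in> J \<and> j \<in> J")
        case True
        then have "w i \<noteq> w j" using wC ij by metis
        \<comment> \<open>A common point of two tubes would have its direction in both of these
          disjoint balls.\<close>
        then have "disjnt (cball (w i) (r (w i))) (cball (w j) (r (w j)))"
          using C(3) wC True by (auto simp: pairwise_def)
        then show ?thesis using True by (auto simp: S_def T_def disjnt_def)
      qed (auto simp: S_def)
    qed
    have diam: "diameter (D i) = 10 * r (w i)" if "i \<in> J" for i
      using r[of "w i"] C(2) wC[OF that] that by (auto simp: D_def)
    have "D \<in> adm \<delta>"
    proof -
      have "\<Lambda> \<subseteq> (\<Union>i. D i)"
      proof
        fix x assume "x \<in> \<Lambda>"
        then obtain v where v: "v \<in> C" "x \<in> cball v (5 * r v)" using cov by auto
        then have "w (to_nat_on C v) = v" "to_nat_on C v \<in> J" using C(1) by (auto simp: J_def w_def)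
        then have "x \<in> D (to_nat_on C v)" using v by (simp add: D_def)
        then show "x \<in> (\<Union>i. D i)" by blast
      qed
      moreover have "bounded (D i) \<and> diameter (D i) \<le> \<delta>" for i
        using diam[of i] r[of "w i"] wC[of i] C(2) \<delta> by (cases "i \<in> J") (auto simp: D_def)
      ultimately show ?thesis by (auto simp: adm_def)
    qed
    moreover have "cost D \<le> ennreal \<beta> * ennreal \<epsilon>"
    proof -
      have "cost D \<le> (\<Sum>i. ennreal \<beta> * emeasure lborel (S i))"
        unfolding cost_def
      proof (intro suminf_le summableI)
        fix i
        show "(if D i = {} then 0 else ennreal (\<alpha> * diameter (D i) ^ m)) \<le> ennreal \<beta> * emeasure lborel (S i)"
        proof (cases "i \<in> J")
          case True
          then have wL: "w i \<in> \<Lambda>" using wC C(2) by auto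
          have "\<alpha> * diameter (D i) ^ m = \<beta> * (c1 * r (w i) ^ m)"
            using c1 by (simp add: diam[OF True] \<beta>_def power_mult_distrib)
          then have "ennreal (\<alpha> * diameter (D i) ^ m) = ennreal \<beta> * ennreal (c1 * r (w i) ^ m)"
            using \<beta> c1 r[OF wL] by (simp flip: ennreal_mult)
          also have "\<dots> \<le> ennreal \<beta> * emeasure lborel (T (w i) (r (w i)))"
            using tube_measure_ge[of "w i" a "r (w i)"] r[OF wL] \<Lambda> wL a
            unfolding c1_def m_def T_def by (intro mult_left_mono) auto
          finally show ?thesis using True by (simp add: S_def)
        qed (simp add: D_def)
      qed
      also have "\<dots> = ennreal \<beta> * (\<Sum>i. emeasure lborel (S i))" by simp
      also have "(\<Sum>i. emeasure lborel (S i)) = emeasure lborel (\<Union>i. S i)"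
        by (rule suminf_emeasure[OF _ disj]) (auto simp: S_def)
      also have "\<dots> \<le> emeasure lborel U"
      proof (rule emeasure_mono)
        have "S i \<subseteq> U" for i
          using r[of "w i"] wC(1)[of i] C(2) by (auto simp: S_def)
        then show "(\<Union>i. S i) \<subseteq> U" by blast
      qed (use U in simp)
      finally show ?thesis using UE by (meson mult_left_mono order_trans zero_le)
    qed
    ultimately show ?thesis by blast
  qed
  have "(INF C\<in>adm \<delta>. cost C) = 0" if \<delta>: "0 < \<delta>" for \<delta>
  proof (rule antisym)
    show "(INF C\<in>adm \<delta>. cost C) \<le> 0"
    proof (rule ennreal_le_epsilon)
      fix e :: real assume e: "0 < e"
      define \<epsilon> where "\<epsilon> = e / (\<beta> + 1)"
      have \<epsilon>: "\<epsilon> > 0" "\<beta> * \<epsilon> \<le> e" using e \<beta> by (auto simp: \<epsilon>_def field_simps)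
      obtain C where "C \<in> adm \<delta>" "cost C \<le> ennreal \<beta> * ennreal \<epsilon>" using key[OF \<delta> \<epsilon>(1)] by blast
      then have "(INF C\<in>adm \<delta>. cost C) \<le> ennreal \<beta> * ennreal \<epsilon>" by (metis INF_lower order_trans)
      also have "\<dots> \<le> 0 + ennreal e" using \<epsilon> \<beta> by (simp add: ennreal_leI flip: ennreal_mult)
      finally show "(INF C\<in>adm \<delta>. cost C) \<le> 0 + ennreal e" .
    qed
  qed simp
  then have "(SUP \<delta>\<in>{0<..}. INF C\<in>adm \<delta>. cost C) = (SUP \<delta>\<in>{0::real<..}. 0)"
    by (intro SUP_cong) auto
  then show ?thesis
    unfolding hausdorff_outer_def adm_def cost_def \<alpha>_def m_def by (simp add: bot_ennreal)
qed

section \<open>Completeness of \<open>L^p\<close>\<close>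

lemma norm_add_powr_le:
  fixes a b :: "'b::real_normed_vector"
  assumes "0 \<le> p"
  shows "norm (a + b) powr p \<le> 2 powr p * (norm a powr p + norm b powr p)"
proof -
  define m where "m = max (norm a) (norm b)"
  have "norm (a + b) \<le> 2 * m" using norm_triangle_ineq[of a b] by (simp add: m_def)
  then have "norm (a + b) powr p \<le> (2 * m) powr p" using assms by (intro powr_mono2) auto
  also have "\<dots> = 2 powr p * m powr p" by (simp add: powr_mult m_def)
  also have "m powr p \<le> norm a powr p + norm b powr p" by (auto simp: m_def max_def)
  finally show ?thesis by simp
qed

lemma norm_add3_powr_le:
  fixes a b c :: "'b::real_normed_vector"
  assumes "0 \<le> p"
  shows "norm (a + b + c) powr p \<le> 3 powr p * (norm a powr p + norm b powr p + norm c powr p)"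
proof -
  define m where "m = max (norm a) (max (norm b) (norm c))"
  have "norm (a + b + c) \<le> 3 * m"
    using norm_triangle_ineq[of a b] norm_triangle_ineq[of "a + b" c] by (simp add: m_def)
  then have "norm (a + b + c) powr p \<le> (3 * m) powr p" using assms by (intro powr_mono2) auto
  also have "\<dots> = 3 powr p * m powr p" by (simp add: powr_mult m_def)
  also have "m powr p \<le> norm a powr p + norm b powr p + norm c powr p" by (auto simp: m_def max_def)
  finally show ?thesis by simp
qed

lemma norm_powr_integral_le:
  fixes u v :: "'a \<Rightarrow> 'b::{real_normed_vector,second_countable_topology}"
  assumes p: "0 \<le> p" and [measurable]: "u \<in> borel_measurable M" "v \<in> borel_measurable M"
  shows "(\<integral>\<^sup>+ x. ennreal (norm (u x + v x) powr p) \<partial>M)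
     \<le> ennreal (2 powr p) * ((\<integral>\<^sup>+ x. ennreal (norm (u x) powr p) \<partial>M) + (\<integral>\<^sup>+ x. ennreal (norm (v x) powr p) \<partial>M))"
proof -
  have "(\<integral>\<^sup>+ x. ennreal (norm (u x + v x) powr p) \<partial>M)
      \<le> (\<integral>\<^sup>+ x. ennreal (2 powr p) * (ennreal (norm (u x) powr p) + ennreal (norm (v x) powr p)) \<partial>M)"
    using norm_add_powr_le[OF p] by (intro nn_integral_mono) (simp add: ennreal_leI flip: ennreal_mult ennreal_plus)
  also have "\<dots> = ennreal (2 powr p) * ((\<integral>\<^sup>+ x. ennreal (norm (u x) powr p) \<partial>M) + (\<integral>\<^sup>+ x. ennreal (norm (v x) powr p) \<partial>M))"
    by (simp add: nn_integral_cmult nn_integral_add)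
  finally show ?thesis .
qed

lemma ex_strict_mono_eventually:
  fixes P :: "nat \<Rightarrow> nat \<Rightarrow> bool"
  assumes "\<And>k. \<exists>K. \<forall>n\<ge>K. P k n"
  shows "\<exists>s. strict_mono s \<and> (\<forall>k. \<forall>n\<ge>s k. P k n)"
proof -
  obtain K where K: "\<And>k n. K k \<le> n \<Longrightarrow> P k n" using assms by metis
  \<comment> \<open>Partial sums of the \<open>Suc (K i)\<close> increase strictly and dominate
    \<open>K k\<close>.\<close>
  define s where "s k = (\<Sum>i\<le>k. Suc (K i))" for k
  have "strict_mono s" by (simp add: s_def strict_mono_Suc_iff)
  moreover have "K k \<le> s k" for k
    using member_le_sum[of k "{..k}" "\<lambda>i. Suc (K i)"] by (simp add: s_def)
  ultimately show ?thesis using K by (meson order_trans)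
qed

text \<open>The Riesz-Fischer argument. Weights 2^j on increments of size 4^(-j) replace Minkowski's
  inequality: a finite sum C of the (2^j d_j)^p forces d_j <= C^(1/p) 2^(-j), and almost every point
  has such a C.\<close>

lemma Lp_complete_subseq:
  fixes u :: "nat \<Rightarrow> 'a \<Rightarrow> 'b::euclidean_space"
  assumes p: "1 \<le> p" and u[measurable]: "\<And>n. u n \<in> borel_measurable M"
    and fin: "\<And>n. (\<integral>\<^sup>+ x. ennreal (norm (u n x) powr p) \<partial>M) < \<infinity>"
    and cauchy: "\<And>\<epsilon>. 0 < \<epsilon> \<Longrightarrow> \<exists>K. \<forall>k\<ge>K. \<forall>l\<ge>K. (\<integral>\<^sup>+ x. ennreal (norm (u l x - u k x) powr p) \<partial>M) \<le> ennreal \<epsilon>"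
  shows "\<exists>s g. strict_mono (s :: nat \<Rightarrow> nat) \<and> g \<in> borel_measurable M \<and>
    (\<integral>\<^sup>+ x. ennreal (norm (g x) powr p) \<partial>M) < \<infinity> \<and>
    (\<lambda>k. \<integral>\<^sup>+ x. ennreal (norm (u (s k) x - g x) powr p) \<partial>M) \<longlonglongrightarrow> 0"
proof -
  have tail: "\<exists>K. \<forall>k\<ge>K. \<forall>l\<ge>k. (\<integral>\<^sup>+ x. ennreal (norm (u l x - u k x) powr p) \<partial>M) \<le> ennreal (((1/4) ^ j) powr p)" for j :: nat
  proof -
    have "0 < ((1/4 :: real) ^ j) powr p" by simp
    from cauchy[OF this] obtain K where
      "\<And>k l. K \<le> k \<Longrightarrow> K \<le> l \<Longrightarrow> (\<integral>\<^sup>+ x. ennreal (norm (u l x - u k x) powr p) \<partial>M) \<le> ennreal (((1/4) ^ j) powr p)"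
      by blast
    then show ?thesis by (intro exI[of _ K]) auto
  qed
  have "\<exists>s. strict_mono s \<and> (\<forall>j. \<forall>k\<ge>s j. \<forall>l\<ge>k.
      (\<integral>\<^sup>+ x. ennreal (norm (u l x - u k x) powr p) \<partial>M) \<le> ennreal (((1/4) ^ j) powr p))"
    by (rule ex_strict_mono_eventually[OF tail])
  then obtain s where s: "strict_mono s"
    and sc: "\<And>j k l. s j \<le> k \<Longrightarrow> k \<le> l \<Longrightarrow> (\<integral>\<^sup>+ x. ennreal (norm (u l x - u k x) powr p) \<partial>M) \<le> ennreal (((1/4) ^ j) powr p)"
    by auto
  define v where "v j = u (s j)" for j
  have [measurable]: "v j \<in> borel_measurable M" for j by (simp add: v_def)
  define d where "d j x = norm (v (Suc j) x - v j x)" for j x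
  have [measurable]: "d j \<in> borel_measurable M" for j unfolding d_def[abs_def] by measurable
  have vc: "(\<integral>\<^sup>+ x. ennreal (norm (v l x - v j x) powr p) \<partial>M) \<le> ennreal (((1/4) ^ j) powr p)" if "j \<le> l" for j l
    unfolding v_def using that s by (intro sc) (auto simp: strict_mono_less_eq)
  have "(\<integral>\<^sup>+ x. (\<Sum>j. ennreal ((2 ^ j * d j x) powr p)) \<partial>M) = (\<Sum>j. \<integral>\<^sup>+ x. ennreal ((2 ^ j * d j x) powr p) \<partial>M)"
    by (intro nn_integral_suminf) measurable
  also have "\<dots> \<le> (\<Sum>j. ennreal ((1/2) ^ j))"
  proof (intro suminf_le summableI)
    fix j
    have "(\<integral>\<^sup>+ x. ennreal ((2 ^ j * d j x) powr p) \<partial>M) = (\<integral>\<^sup>+ x. ennreal ((2 ^ j) powr p) * ennreal (d j x powr p) \<partial>M)"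
      by (intro nn_integral_cong) (simp add: powr_mult d_def flip: ennreal_mult)
    also have "\<dots> = ennreal ((2 ^ j) powr p) * (\<integral>\<^sup>+ x. ennreal (d j x powr p) \<partial>M)"
      by (intro nn_integral_cmult) measurable
    also have "\<dots> \<le> ennreal ((2 ^ j) powr p) * ennreal (((1/4) ^ j) powr p)"
      unfolding d_def by (intro mult_left_mono vc) auto
    also have "\<dots> = ennreal (((1/2) ^ j) powr p)"
      by (simp flip: ennreal_mult powr_mult power_mult_distrib)
    also have "((1/2 :: real) ^ j) powr p \<le> ((1/2) ^ j) powr 1"
      using p by (intro powr_mono') (auto simp: power_le_one)
    finally show "(\<integral>\<^sup>+ x. ennreal ((2 ^ j * d j x) powr p) \<partial>M) \<le> ennreal ((1/2) ^ j)"
      by (simp add: ennreal_leI)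
  qed
  also have "\<dots> = ennreal 2"
    using geometric_sums[of "1 / 2 :: real"] by (intro suminf_ennreal_eq) auto
  also have "\<dots> < \<infinity>" by simp
  finally have finS: "(\<integral>\<^sup>+ x. (\<Sum>j. ennreal ((2 ^ j * d j x) powr p)) \<partial>M) \<noteq> \<infinity>" by simp
  have "AE x in M. (\<Sum>j. ennreal ((2 ^ j * d j x) powr p)) \<noteq> \<infinity>"
    by (rule nn_integral_PInf_AE[OF _ finS]) (intro borel_measurable_suminf_order, measurable)
  then have conv: "AE x in M. convergent (\<lambda>j. v j x)"
  proof eventually_elim
    case (elim x)
    define C where "C = enn2real (\<Sum>j. ennreal ((2 ^ j * d j x) powr p))"
    have C: "C \<ge> 0" "(\<Sum>j. ennreal ((2 ^ j * d j x) powr p)) = ennreal C"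
      using elim by (auto simp only: C_def enn2real_nonneg ennreal_enn2real less_top infinity_ennreal_def)
    have dle: "d j x \<le> C powr (1 / p) * (1/2) ^ j" for j
    proof -
      have "ennreal ((2 ^ j * d j x) powr p) = (\<Sum>i\<in>{j}. ennreal ((2 ^ i * d i x) powr p))" by simp
      also have "\<dots> \<le> ennreal C" unfolding C(2)[symmetric] by (intro sum_le_suminf summableI) auto
      finally have "(2 ^ j * d j x) powr p \<le> C" using C by simp
      then have "((2 ^ j * d j x) powr p) powr (1 / p) \<le> C powr (1 / p)" using p by (intro powr_mono2) auto
      moreover have "((2 ^ j * d j x) powr p) powr (1 / p) = 2 ^ j * d j x"
        using p by (simp add: powr_powr d_def)
      ultimately show ?thesis by (simp add: field_simps)
    qed
    have "summable (\<lambda>j. v (Suc j) x - v j x)"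
      by (rule summable_comparison_test'[of "\<lambda>j. C powr (1 / p) * (1/2) ^ j" 0])
         (use dle in \<open>auto simp: d_def intro!: summable_mult summable_geometric\<close>)
    then have "convergent (\<lambda>n. \<Sum>j<n. v (Suc j) x - v j x)" by (simp add: summable_iff_convergent)
    then have "convergent (\<lambda>n. v n x - v 0 x)" unfolding sum_lessThan_telescope[of "\<lambda>n. v n x"] .
    then have "convergent (\<lambda>n. (v n x - v 0 x) + v 0 x)" by (intro convergent_add convergent_const)
    then show ?case by simp
  qed
  \<comment> \<open>Defined by \<open>lim\<close> at every point, so that \<open>g\<close> is
    measurable; its value is the true limit almost everywhere.\<close>
  define g where "g x = lim (\<lambda>j. v j x)" for x
  have g[measurable]: "g \<in> borel_measurable M" unfolding g_def by measurable
  \<comment> \<open>Fatou's lemma in l turns the Cauchy bound between \<open>v l\<close> and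
    \<open>v k\<close> into a bound for the distance of \<open>v k\<close> to the limit.\<close>
  have bnd: "(\<integral>\<^sup>+ x. ennreal (norm (v k x - g x) powr p) \<partial>M) \<le> ennreal (((1/4) ^ k) powr p)" for k
  proof -
    have "(\<integral>\<^sup>+ x. ennreal (norm (v k x - g x) powr p) \<partial>M)
        = (\<integral>\<^sup>+ x. liminf (\<lambda>l. ennreal (norm (v l x - v k x) powr p)) \<partial>M)"
    proof (rule nn_integral_cong_AE)
      show "AE x in M. ennreal (norm (v k x - g x) powr p) = liminf (\<lambda>l. ennreal (norm (v l x - v k x) powr p))"
        using conv
      proof eventually_elim
        case (elim x)
        then have "(\<lambda>l. v l x) \<longlonglongrightarrow> g x" by (simp add: g_def convergent_LIMSEQ_iff)
        then have "(\<lambda>l. ennreal (norm (v l x - v k x) powr p)) \<longlonglongrightarrow> ennreal (norm (g x - v k x) powr p)"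
          using p by (intro tendsto_ennrealI tendsto_powr' tendsto_norm tendsto_diff tendsto_const) auto
        then have "liminf (\<lambda>l. ennreal (norm (v l x - v k x) powr p)) = ennreal (norm (g x - v k x) powr p)"
          by (rule lim_imp_Liminf[OF trivial_limit_sequentially])
        then show ?case by (simp add: norm_minus_commute)
      qed
    qed
    also have "\<dots> \<le> liminf (\<lambda>l. \<integral>\<^sup>+ x. ennreal (norm (v l x - v k x) powr p) \<partial>M)"
      by (rule nn_integral_liminf) measurable
    also have "\<dots> \<le> limsup (\<lambda>l. \<integral>\<^sup>+ x. ennreal (norm (v l x - v k x) powr p) \<partial>M)"
      by (rule Liminf_le_Limsup) simp
    also have "\<dots> \<le> ennreal (((1/4) ^ k) powr p)"
      using vc[of k] by (intro Limsup_bounded eventually_sequentiallyI[of k])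
    finally show ?thesis .
  qed
  have "(\<lambda>k. \<integral>\<^sup>+ x. ennreal (norm (v k x - g x) powr p) \<partial>M) \<longlonglongrightarrow> 0"
  proof (rule tendsto_sandwich[OF _ _ tendsto_const])
    show "\<forall>\<^sub>F k in sequentially. (\<integral>\<^sup>+ x. ennreal (norm (v k x - g x) powr p) \<partial>M) \<le> ennreal ((1/4) ^ k)"
    proof (intro always_eventually allI)
      fix k
      have "((1/4 :: real) ^ k) powr p \<le> ((1/4) ^ k) powr 1"
        using p by (intro powr_mono') (auto simp: power_le_one)
      then show "(\<integral>\<^sup>+ x. ennreal (norm (v k x - g x) powr p) \<partial>M) \<le> ennreal ((1/4) ^ k)"
        using bnd[of k] by (auto intro: order_trans ennreal_leI)
    qed
    have "(\<lambda>k. ennreal ((1/4) ^ k)) \<longlonglongrightarrow> ennreal 0"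
      by (intro tendsto_ennrealI LIMSEQ_power_zero) auto
    then show "(\<lambda>k. ennreal ((1/4) ^ k)) \<longlonglongrightarrow> 0" by simp
  qed simp
  moreover have "(\<integral>\<^sup>+ x. ennreal (norm (g x) powr p) \<partial>M) < \<infinity>"
  proof -
    have "(\<integral>\<^sup>+ x. ennreal (norm (g x) powr p) \<partial>M) = (\<integral>\<^sup>+ x. ennreal (norm ((g x - v 0 x) + v 0 x) powr p) \<partial>M)" by simp
    also have "\<dots> \<le> ennreal (2 powr p) * ((\<integral>\<^sup>+ x. ennreal (norm (g x - v 0 x) powr p) \<partial>M) + (\<integral>\<^sup>+ x. ennreal (norm (v 0 x) powr p) \<partial>M))"
      using p by (intro norm_powr_integral_le) auto
    also have "\<dots> < \<infinity>"
      using bnd[of 0] fin[of "s 0"]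
      by (auto simp: v_def norm_minus_commute ennreal_mult_less_top intro: le_less_trans)
    finally show ?thesis .
  qed
  ultimately show ?thesis using s unfolding v_def by (intro exI[of _ s] exI[of _ g]) auto
qed

section \<open>Directional averages\<close>

text \<open>Pairing with e gives the integral over E of (e . z)^2, which vanishes only if almost all
  of E lies in the hyperplane orthogonal to e; for e nonzero this is a null set. An injective linear
  map in finite dimension is bounded below.\<close>

lemma moment_matrix_bounded_below:
  fixes E :: "'a::euclidean_space set"
  assumes E[measurable]: "E \<in> sets borel" and sub: "E \<subseteq> cball 0 1" and pos: "emeasure lborel E > 0"
  shows "\<exists>c>0. \<forall>e. c * norm e \<le> norm (\<integral>z. indicator E z *\<^sub>R ((e \<bullet> z) *\<^sub>R z) \<partial>lborel)"
proof -
  define A where "A e = (\<integral>z. indicator E z *\<^sub>R ((e \<bullet> z) *\<^sub>R z) \<partial>lborel)" for e :: 'a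
  have iE: "integrable lborel (indicator E :: 'a \<Rightarrow> real)"
    using emeasure_bounded_finite[OF bounded_subset[OF bounded_cball sub]]
    by (intro integrable_real_indicator) (auto simp: less_top)
  have int: "integrable lborel (\<lambda>z. indicator E z *\<^sub>R ((e \<bullet> z) *\<^sub>R z))" for e
  proof (rule Bochner_Integration.integrable_bound)
    show "integrable lborel (\<lambda>z. norm e * indicator E z)" using iE by simp
    show "AE z in lborel. norm (indicat_real E z *\<^sub>R ((e \<bullet> z) *\<^sub>R z)) \<le> norm (norm e * indicat_real E z)"
    proof (intro always_eventually allI)
      fix z
      have "\<bar>e \<bullet> z\<bar> * norm z \<le> norm e * 1" if "z \<in> E"
      proof -
        have z: "norm z \<le> 1" using that sub by auto
        have "\<bar>e \<bullet> z\<bar> * norm z \<le> (norm e * norm z) * 1"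
          using z Cauchy_Schwarz_ineq2[of e z] by (intro mult_mono) auto
        also have "\<dots> \<le> norm e * 1" using z by (simp add: mult_left_le)
        finally show ?thesis .
      qed
      then show "norm (indicat_real E z *\<^sub>R ((e \<bullet> z) *\<^sub>R z)) \<le> norm (norm e * indicat_real E z)"
        by (auto simp: indicator_def)
    qed
  qed measurable
  have "linear A"
  proof (rule linearI)
    fix e f :: 'a and t :: real
    have "A (e + f) = (\<integral>z. indicator E z *\<^sub>R ((e \<bullet> z) *\<^sub>R z) + indicator E z *\<^sub>R ((f \<bullet> z) *\<^sub>R z) \<partial>lborel)"
      unfolding A_def by (intro Bochner_Integration.integral_cong) (auto simp: inner_add_left scaleR_add_left scaleR_add_right)
    also have "\<dots> = A e + A f" unfolding A_def by (intro Bochner_Integration.integral_add int)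
    finally show "A (e + f) = A e + A f" .
    have "A (t *\<^sub>R e) = (\<integral>z. t *\<^sub>R (indicator E z *\<^sub>R ((e \<bullet> z) *\<^sub>R z)) \<partial>lborel)"
      unfolding A_def by (intro Bochner_Integration.integral_cong) auto
    also have "\<dots> = t *\<^sub>R A e" unfolding A_def by (rule integral_scaleR_right)
    finally show "A (t *\<^sub>R e) = t *\<^sub>R A e" .
  qed
  moreover have "inj A"
  proof (subst linear_injective_0[OF \<open>linear A\<close>], intro allI impI)
    fix e assume "A e = 0"
    then have "0 = A e \<bullet> e" by simp
    also have "\<dots> = (\<integral>z. (indicator E z *\<^sub>R ((e \<bullet> z) *\<^sub>R z)) \<bullet> e \<partial>lborel)"
      unfolding A_def using int by (intro integral_inner_left[symmetric]) auto
    also have "\<dots> = (\<integral>z. indicator E z * (e \<bullet> z)\<^sup>2 \<partial>lborel)"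
      by (simp add: power2_eq_square inner_commute mult.assoc)
    finally have I0: "(\<integral>z. indicator E z * (e \<bullet> z)\<^sup>2 \<partial>lborel) = 0" by simp
    have "integrable lborel (\<lambda>z. (indicator E z *\<^sub>R ((e \<bullet> z) *\<^sub>R z)) \<bullet> e)"
      using int by (intro integrable_inner_left) auto
    then have "integrable lborel (\<lambda>z. indicator E z * (e \<bullet> z)\<^sup>2)"
      by (simp add: power2_eq_square inner_commute mult.assoc)
    then have "AE z in lborel. indicator E z * (e \<bullet> z)\<^sup>2 = 0"
      using I0 by (subst (asm) integral_nonneg_eq_0_iff_AE) auto
    then have ae: "AE z in lborel. z \<in> E \<longrightarrow> e \<bullet> z = 0" by eventually_elim auto
    show "e = 0"
    proof (rule ccontr)
      assume "e \<noteq> 0"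
      then have "negligible {z. e \<bullet> z = 0}" by (intro negligible_hyperplane) auto
      then have "{z. e \<bullet> z = 0} \<in> null_sets lebesgue" by (simp add: negligible_iff_null_sets)
      then have "{z. e \<bullet> z = 0} \<in> null_sets lborel"
        by (subst (asm) null_sets_completion_iff) auto
      then have "AE z in lborel. \<not> e \<bullet> z = 0" using AE_not_in by fastforce
      with ae have "AE z in lborel. z \<notin> E" by eventually_elim auto
      then have "emeasure lborel E = 0" by (simp add: AE_iff_measurable[of E])
      then show False using pos by simp
    qed
  qed
  ultimately obtain c where "c > 0" "\<And>e. c * norm e \<le> norm (A e)"
    using linear_inj_bounded_below_pos by blast
  then show ?thesis unfolding A_def by blast
qed

text \<open>Inner regularity, obtained from outer regularity of the complement with the measure of E
  as tolerance. Compactness is wanted because cutoffs built from the distance to a set converge to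
  the indicator of its closure.\<close>

lemma compact_subset_positive_measure:
  fixes E :: "'a::euclidean_space set"
  assumes E: "E \<in> sets borel" and bnd: "bounded E" and pos: "emeasure lborel E > 0"
  shows "\<exists>K. compact K \<and> K \<subseteq> E \<and> emeasure lborel K > 0"
proof -
  have "emeasure lborel E < \<infinity>" using emeasure_bounded_finite[OF bnd] .
  then have e: "emeasure lborel E = ennreal (measure lborel E)"
    by (intro emeasure_eq_ennreal_measure) simp
  then have "0 < measure lborel E" using pos by simp
  moreover have "- E \<in> sets borel" using E by (rule borel_comp)
  ultimately obtain U where U: "open U" "- E \<subseteq> U" "emeasure lborel (U - - E) < emeasure lborel E"
    unfolding e by (metis outer_regular_lborel)
  have K: "compact (- U)" "- U \<subseteq> E"
    using U bnd by (auto simp: compact_eq_bounded_closed closed_Compl intro: bounded_subset)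
  have "emeasure lborel (- U) \<noteq> 0"
  proof
    assume "emeasure lborel (- U) = 0"
    then have "- U \<in> null_sets lborel" using U(1) by (intro null_setsI) auto
    then have "emeasure lborel (E - - U) = emeasure lborel E" using E by (intro emeasure_Diff_null_set) auto
    moreover have "E - - U = U - - E" by auto
    ultimately show False using U(3) by simp
  qed
  then show ?thesis using K by (intro exI[of _ "- U"]) (simp add: zero_less_iff_neq_zero)
qed

section \<open>Averages of translates against a matrix kernel\<close>

lemma integral_lborel_translate:
  fixes f :: "'a::euclidean_space \<Rightarrow> 'b::{banach,second_countable_topology}"
  assumes "f \<in> borel_measurable borel"
  shows "(\<integral>x. f (c + x) \<partial>lborel) = (\<integral>x. f x \<partial>lborel)"
proof -
  have "(\<integral>x. f x \<partial>lborel) = (\<integral>x. f x \<partial>distr lborel borel ((+) c))"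
    by (simp add: lborel_distr_plus)
  also have "\<dots> = (\<integral>x. f (c + x) \<partial>lborel)" using assms by (intro integral_distr) auto
  finally show ?thesis ..
qed

text \<open>On a bounded set t <= 1 + t^p controls the L^1 norm by the L^p norm, and rescaling by
  \<delta> costs \<delta>^(-d) with d = \<open>DIM('a)\<close>. The bound is uniform in x.\<close>

lemma nn_integral_ball_shift_le:
  fixes w :: "'a::euclidean_space \<Rightarrow> 'b::{real_normed_vector,second_countable_topology}"
  assumes p: "1 \<le> p" and w[measurable]: "w \<in> borel_measurable borel" and \<delta>: "0 < \<delta>"
    and W: "(\<integral>\<^sup>+ x. ennreal (norm (w x) powr p) \<partial>lborel) \<le> ennreal W"
  shows "(\<integral>\<^sup>+ z. ennreal (indicator (cball 0 2) z * norm (w (x + \<delta> *\<^sub>R z))) \<partial>lborel)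
     \<le> ennreal (measure lborel (cball (0::'a) 2) + max W 0 / \<delta> ^ DIM('a))"
proof -
  have t: "t \<le> 1 + t powr p" if "t \<ge> 0" for t :: real
  proof (cases "t \<le> 1")
    case False
    then have "t powr 1 \<le> t powr p" using p by (intro powr_mono) auto
    then show ?thesis using False by simp
  qed (use add_increasing2[of "t powr p" t 1] in auto)
  have "(\<integral>\<^sup>+ z. ennreal (indicator (cball 0 2) z * norm (w (x + \<delta> *\<^sub>R z))) \<partial>lborel)
      \<le> (\<integral>\<^sup>+ z. indicator (cball 0 2) z + ennreal (norm (w (x + \<delta> *\<^sub>R z)) powr p) \<partial>lborel)"
  proof (rule nn_integral_mono)
    fix z :: 'a
    have "ennreal (norm (w (x + \<delta> *\<^sub>R z))) \<le> 1 + ennreal (norm (w (x + \<delta> *\<^sub>R z)) powr p)"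
      using t[of "norm (w (x + \<delta> *\<^sub>R z))"] ennreal_leI by (simp flip: ennreal_1 ennreal_plus)
    then show "ennreal (indicator (cball 0 2) z * norm (w (x + \<delta> *\<^sub>R z)))
        \<le> indicator (cball 0 2) z + ennreal (norm (w (x + \<delta> *\<^sub>R z)) powr p)"
      by (simp add: indicator_def)
  qed
  also have "\<dots> = emeasure lborel (cball (0::'a) 2) + (\<integral>\<^sup>+ z. ennreal (norm (w (x + \<delta> *\<^sub>R z)) powr p) \<partial>lborel)"
    by (subst nn_integral_add) (auto intro!: borel_measurable_indicator borel_closed)
  also have "\<dots> \<le> ennreal (measure lborel (cball (0::'a) 2)) + ennreal (max W 0 / \<delta> ^ DIM('a))"
  proof (rule add_mono)
    show "emeasure lborel (cball (0::'a) 2) \<le> ennreal (measure lborel (cball (0::'a) 2))"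
      using emeasure_lborel_cball_finite[of "0::'a" 2] by (subst emeasure_eq_ennreal_measure) auto
    have "(\<integral>\<^sup>+ y. ennreal (norm (w y) powr p) \<partial>lborel)
        = ennreal (\<delta> ^ DIM('a)) * (\<integral>\<^sup>+ z. ennreal (norm (w (x + \<delta> *\<^sub>R z)) powr p) \<partial>lborel)"
      using nn_integral_lborel_affine[where f = "\<lambda>y. ennreal (norm (w y) powr p)" and c = \<delta> and t = x] \<delta> by simp
    moreover have "ennreal W \<le> ennreal (max W 0)" by (simp add: ennreal_leI)
    ultimately have "ennreal (\<delta> ^ DIM('a)) * (\<integral>\<^sup>+ z. ennreal (norm (w (x + \<delta> *\<^sub>R z)) powr p) \<partial>lborel) \<le> ennreal (max W 0)"
      using W by (metis order_trans)
    then have le: "ennreal (1 / \<delta> ^ DIM('a)) * (ennreal (\<delta> ^ DIM('a)) * (\<integral>\<^sup>+ z. ennreal (norm (w (x + \<delta> *\<^sub>R z)) powr p) \<partial>lborel))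
        \<le> ennreal (1 / \<delta> ^ DIM('a)) * ennreal (max W 0)" by (rule mult_left_mono) simp
    have one: "ennreal (1 / \<delta> ^ DIM('a)) * ennreal (\<delta> ^ DIM('a)) = 1"
      using \<delta> by (subst ennreal_mult[symmetric]) auto
    have "ennreal (1 / \<delta> ^ DIM('a)) * ennreal (max W 0) = ennreal (max W 0 / \<delta> ^ DIM('a))"
      using \<delta> by (subst ennreal_mult[symmetric]) auto
    then show "(\<integral>\<^sup>+ z. ennreal (norm (w (x + \<delta> *\<^sub>R z)) powr p) \<partial>lborel) \<le> ennreal (max W 0 / \<delta> ^ DIM('a))"
      using le unfolding mult.assoc[symmetric] one mult_1 by (simp only:)
  qed
  also have "\<dots> = ennreal (measure lborel (cball (0::'a) 2) + max W 0 / \<delta> ^ DIM('a))"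
    using \<delta> by (intro ennreal_plus[symmetric]) auto
  finally show ?thesis .
qed

text \<open>The matrix \<phi>(z) z z^T applied to e. Integrated with \<phi> the indicator of a set,
  it is the moment matrix of \<open>moment_matrix_bounded_below\<close>.\<close>

definition quad_kernel :: "('a::euclidean_space \<Rightarrow> real) \<Rightarrow> 'a \<Rightarrow> 'a \<Rightarrow> 'a" where
  "quad_kernel \<phi> z e = \<phi> z *\<^sub>R ((e \<bullet> z) *\<^sub>R z)"

definition directional_average :: "('a::euclidean_space \<Rightarrow> real) \<Rightarrow> real \<Rightarrow> ('a \<Rightarrow> 'a) \<Rightarrow> 'a \<Rightarrow> 'a" where
  "directional_average \<phi> \<delta> w x = (\<integral>z. quad_kernel \<phi> z (w (x + \<delta> *\<^sub>R z)) \<partial>lborel)"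

lemma quad_kernel_measurable [measurable]:
  assumes [measurable]: "\<phi> \<in> borel_measurable borel" "f \<in> borel_measurable borel" "g \<in> borel_measurable borel"
  shows "(\<lambda>z. quad_kernel \<phi> (f z) (g z)) \<in> borel_measurable borel"
  unfolding quad_kernel_def by measurable

text \<open>The factor 4 is |z|^2 at the support radius 2. That radius leaves one unit of room for
  cutoffs around sets in the unit ball.\<close>

lemma norm_quad_kernel_le:
  assumes "\<And>z. \<bar>\<phi> z\<bar> \<le> 1" "\<And>z. 2 < norm z \<Longrightarrow> \<phi> z = 0"
  shows "norm (quad_kernel \<phi> z e) \<le> 4 * (indicator (cball 0 2) z * norm e)"
proof (cases "norm z \<le> 2")
  case True
  have "\<bar>\<phi> z\<bar> * (\<bar>e \<bullet> z\<bar> * norm z) \<le> 1 * ((norm e * 2) * 2)"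
    using True assms(1)[of z] Cauchy_Schwarz_ineq2[of e z]
    by (intro mult_mono order_trans[OF Cauchy_Schwarz_ineq2]) (auto intro: mult_left_mono)
  then show ?thesis using True by (simp add: quad_kernel_def abs_mult mult.assoc)
qed (use assms in \<open>simp add: quad_kernel_def\<close>)

text \<open>Product rule for three factors. The indicators on the right keep the bound localised, so
  that it can be integrated against a function that is only in L^p.\<close>

lemma quad_kernel_lipschitz:
  fixes \<phi> :: "'a::euclidean_space \<Rightarrow> real"
  assumes \<phi>: "\<And>z. \<bar>\<phi> z\<bar> \<le> 1" "\<And>z. 2 < norm z \<Longrightarrow> \<phi> z = 0"
    and L: "\<And>a b. \<bar>\<phi> a - \<phi> b\<bar> \<le> L * dist a b" "0 \<le> L"
  shows "norm (quad_kernel \<phi> a e - quad_kernel \<phi> b e)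
     \<le> (4 * L + 4) * dist a b * ((indicator (cball 0 2) a + indicator (cball 0 2) b) * norm e)"
proof -
  have aux: "norm (quad_kernel \<phi> a e - quad_kernel \<phi> b e) \<le> (4 * L + 4) * dist a b * norm e"
    if a: "norm a \<le> 2" for a b
  proof -
    \<comment> \<open>Wherever b itself occurs it is multiplied by \<open>\<phi> b\<close>, which
      vanishes outside the ball of radius 2, so only a has to be bounded.\<close>
    have "quad_kernel \<phi> a e - quad_kernel \<phi> b e
        = (\<phi> a - \<phi> b) *\<^sub>R ((e \<bullet> a) *\<^sub>R a) + \<phi> b *\<^sub>R ((e \<bullet> (a - b)) *\<^sub>R a + (e \<bullet> b) *\<^sub>R (a - b))"
      by (simp add: quad_kernel_def algebra_simps inner_diff_right)
    also have "norm \<dots> \<le> norm ((\<phi> a - \<phi> b) *\<^sub>R ((e \<bullet> a) *\<^sub>R a)) + norm (\<phi> b *\<^sub>R ((e \<bullet> (a - b)) *\<^sub>R a + (e \<bullet> b) *\<^sub>R (a - b)))"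
      by (rule norm_triangle_ineq)
    also have "norm ((\<phi> a - \<phi> b) *\<^sub>R ((e \<bullet> a) *\<^sub>R a)) \<le> (L * dist a b) * ((norm e * 2) * 2)"
      unfolding norm_scaleR using L(1)[of a b] a
      by (intro mult_mono order_trans[OF Cauchy_Schwarz_ineq2[of e a]]) (auto intro: mult_left_mono)
    also have "norm (\<phi> b *\<^sub>R ((e \<bullet> (a - b)) *\<^sub>R a + (e \<bullet> b) *\<^sub>R (a - b))) \<le> 4 * dist a b * norm e"
    proof (cases "norm b \<le> 2")
      case True
      have "norm ((e \<bullet> (a - b)) *\<^sub>R a + (e \<bullet> b) *\<^sub>R (a - b)) \<le> \<bar>e \<bullet> (a - b)\<bar> * norm a + \<bar>e \<bullet> b\<bar> * norm (a - b)"
        by (rule order_trans[OF norm_triangle_ineq]) simp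
      also have "\<bar>e \<bullet> (a - b)\<bar> * norm a \<le> (norm e * norm (a - b)) * 2"
        using a by (intro mult_mono Cauchy_Schwarz_ineq2) auto
      also have "\<bar>e \<bullet> b\<bar> * norm (a - b) \<le> (norm e * 2) * norm (a - b)"
        using True by (intro mult_right_mono order_trans[OF Cauchy_Schwarz_ineq2[of e b]] mult_left_mono) auto
      finally have "norm ((e \<bullet> (a - b)) *\<^sub>R a + (e \<bullet> b) *\<^sub>R (a - b)) \<le> 4 * dist a b * norm e"
        by (simp add: dist_norm algebra_simps)
      then have "\<bar>\<phi> b\<bar> * norm ((e \<bullet> (a - b)) *\<^sub>R a + (e \<bullet> b) *\<^sub>R (a - b)) \<le> 1 * (4 * dist a b * norm e)"
        using \<phi>(1)[of b] by (intro mult_mono) auto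
      then show ?thesis by simp
    qed (use \<phi>(2)[of b] in simp)
    finally show ?thesis by (simp add: algebra_simps)
  qed
  consider "norm a \<le> 2" | "norm b \<le> 2" | "2 < norm a" "2 < norm b" by linarith
  then show ?thesis
  proof cases
    case 1
    have "(4 * L + 4) * dist a b * norm e \<le> (4 * L + 4) * dist a b * ((indicator (cball 0 2) a + indicator (cball 0 2) b) * norm e)"
      using 1 L(2) by (intro mult_left_mono) (auto simp: indicator_def)
    then show ?thesis using aux[OF 1, of b] by linarith
  next
    case 2
    have "(4 * L + 4) * dist a b * norm e \<le> (4 * L + 4) * dist a b * ((indicator (cball 0 2) a + indicator (cball 0 2) b) * norm e)"
      using 2 L(2) by (intro mult_left_mono) (auto simp: indicator_def)
    then show ?thesis using aux[OF 2, of a] by (simp add: norm_minus_commute dist_commute)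
  next
    case 3
    then show ?thesis using \<phi>(2)[of a] \<phi>(2)[of b] by (simp add: quad_kernel_def)
  qed
qed

context
  fixes p \<delta> W :: real and w :: "'a::euclidean_space \<Rightarrow> 'a"
  assumes p: "1 \<le> p" and \<delta>: "0 < \<delta>" and w [measurable]: "w \<in> borel_measurable borel"
    and W: "(\<integral>\<^sup>+ x. ennreal (norm (w x) powr p) \<partial>lborel) \<le> ennreal W"
begin

lemma norm_integral_local_le:
  fixes F :: "'a \<Rightarrow> 'a"
  assumes [measurable]: "F \<in> borel_measurable borel" and C: "0 \<le> C"
    and F: "\<And>z. norm (F z) \<le> C * (indicator (cball 0 2) z * norm (w (x + \<delta> *\<^sub>R z)))"
  shows "integrable lborel F"
    and "norm (\<integral>z. F z \<partial>lborel) \<le> C * (measure lborel (cball (0::'a) 2) + max W 0 / \<delta> ^ DIM('a))"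
proof -
  define C0 where "C0 = measure lborel (cball (0::'a) 2) + max W 0 / \<delta> ^ DIM('a)"
  have C0: "C0 \<ge> 0" using \<delta> by (auto simp: C0_def)
  have "(\<integral>\<^sup>+ z. ennreal (norm (F z)) \<partial>lborel)
      \<le> (\<integral>\<^sup>+ z. ennreal C * ennreal (indicator (cball 0 2) z * norm (w (x + \<delta> *\<^sub>R z))) \<partial>lborel)"
    using F C by (intro nn_integral_mono) (simp add: ennreal_leI flip: ennreal_mult)
  also have "\<dots> = ennreal C * (\<integral>\<^sup>+ z. ennreal (indicator (cball 0 2) z * norm (w (x + \<delta> *\<^sub>R z))) \<partial>lborel)"
  proof (rule nn_integral_cmult)
    have [measurable]: "cball (0::'a) 2 \<in> sets borel" by (rule borel_closed) auto
    show "(\<lambda>z. ennreal (indicator (cball 0 2) z * norm (w (x + \<delta> *\<^sub>R z)))) \<in> borel_measurable lborel"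
      by measurable
  qed
  also have "\<dots> \<le> ennreal C * ennreal C0"
    unfolding C0_def by (intro mult_left_mono nn_integral_ball_shift_le[OF p w \<delta> W]) auto
  also have "\<dots> = ennreal (C * C0)" using C C0 by (simp add: ennreal_mult)
  finally have *: "(\<integral>\<^sup>+ z. ennreal (norm (F z)) \<partial>lborel) \<le> ennreal (C * C0)" .
  show int: "integrable lborel F"
    by (rule integrableI_bounded) (use * in \<open>auto intro: le_less_trans\<close>)
  have "ennreal (norm (\<integral>z. F z \<partial>lborel)) \<le> ennreal (C * C0)"
    using integral_norm_bound_ennreal[OF int] * by (rule order_trans)
  then show "norm (\<integral>z. F z \<partial>lborel) \<le> C * (measure lborel (cball (0::'a) 2) + max W 0 / \<delta> ^ DIM('a))"
    using C C0 unfolding C0_def[symmetric] by simp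
qed

context
  fixes \<phi> :: "'a \<Rightarrow> real"
  assumes \<phi>_meas [measurable]: "\<phi> \<in> borel_measurable borel"
    and \<phi>: "\<And>z. \<bar>\<phi> z\<bar> \<le> 1" "\<And>z. 2 < norm z \<Longrightarrow> \<phi> z = 0"
begin

lemma integrable_quad_kernel:
  "integrable lborel (\<lambda>z. quad_kernel \<phi> z (w (x + \<delta> *\<^sub>R z)))"
  by (rule norm_integral_local_le(1)[where C = 4 and x = x])
     (simp_all only: norm_quad_kernel_le[OF \<phi>], measurable)

lemma norm_directional_average_le:
  "norm (directional_average \<phi> \<delta> w x) \<le> 4 * (measure lborel (cball (0::'a) 2) + max W 0 / \<delta> ^ DIM('a))"
  unfolding directional_average_def
  by (rule norm_integral_local_le(2)[where C = 4 and x = x])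
     (simp_all only: norm_quad_kernel_le[OF \<phi>], measurable)

text \<open>Translating by h = (x - y)/\<delta> moves the difference from the rough function w to
  the Lipschitz kernel: both averages then contain w (x + \<delta> z). The factor 1/\<delta> comes
  from h, the factor 2 from the two supports.\<close>

lemma directional_average_lipschitz:
  assumes L: "\<And>a b. \<bar>\<phi> a - \<phi> b\<bar> \<le> L * dist a b" "0 \<le> L"
  shows "norm (directional_average \<phi> \<delta> w x - directional_average \<phi> \<delta> w y)
     \<le> 2 * (4 * L + 4) * (measure lborel (cball (0::'a) 2) + max W 0 / \<delta> ^ DIM('a)) / \<delta> * norm (x - y)"
proof -
  define C0 where "C0 = measure lborel (cball (0::'a) 2) + max W 0 / \<delta> ^ DIM('a)"
  have C0: "C0 \<ge> 0" using \<delta> by (auto simp: C0_def)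
  define h where "h = (x - y) /\<^sub>R \<delta>"
  have shift: "y + \<delta> *\<^sub>R (h + z) = x + \<delta> *\<^sub>R z" for z
    using \<delta> by (simp add: h_def scaleR_add_right)
  have [measurable]: "cball (0::'a) 2 \<in> sets borel" by (rule borel_closed) auto
  define f where "f z = quad_kernel \<phi> z (w (x + \<delta> *\<^sub>R z))" for z
  define g where "g z = quad_kernel \<phi> (h + z) (w (x + \<delta> *\<^sub>R z))" for z
  define a where "a z = ennreal (indicator (cball 0 2) z * norm (w (x + \<delta> *\<^sub>R z)))" for z
  define b where "b z = ennreal (indicator (cball 0 2) (h + z) * norm (w (x + \<delta> *\<^sub>R z)))" for z
  have [measurable]: "f \<in> borel_measurable borel" "g \<in> borel_measurable borel"
    "a \<in> borel_measurable borel" "b \<in> borel_measurable borel"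
    unfolding f_def[abs_def] g_def[abs_def] a_def[abs_def] b_def[abs_def] by measurable
  have a: "(\<integral>\<^sup>+ z. a z \<partial>lborel) \<le> ennreal C0"
    unfolding a_def C0_def by (rule nn_integral_ball_shift_le[OF p w \<delta> W])
  \<comment> \<open>Translated back by h, the mass over the shifted ball is the mass for the centre
    y.\<close>
  have b: "(\<integral>\<^sup>+ z. b z \<partial>lborel) \<le> ennreal C0"
  proof -
    have "(\<integral>\<^sup>+ z. b z \<partial>lborel) = (\<integral>\<^sup>+ z. ennreal (indicator (cball 0 2) z * norm (w (y + \<delta> *\<^sub>R z))) \<partial>lborel)"
      unfolding b_def
      using nn_integral_lborel_affine[where f = "\<lambda>z. ennreal (indicator (cball 0 2) z * norm (w (y + \<delta> *\<^sub>R z)))" and c = 1 and t = h]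
      by (simp add: shift)
    also have "\<dots> \<le> ennreal C0" unfolding C0_def by (rule nn_integral_ball_shift_le[OF p w \<delta> W])
    finally show ?thesis .
  qed
  have Vy: "directional_average \<phi> \<delta> w y = (\<integral>z. g z \<partial>lborel)"
    unfolding directional_average_def g_def
    using integral_lborel_translate[of "\<lambda>z. quad_kernel \<phi> z (w (y + \<delta> *\<^sub>R z))" h] by (simp add: shift)
  have Vx: "directional_average \<phi> \<delta> w x = (\<integral>z. f z \<partial>lborel)"
    unfolding directional_average_def f_def ..
  have intf: "integrable lborel f" unfolding f_def[abs_def] by (rule integrable_quad_kernel)
  have intg: "integrable lborel g"
  proof (rule integrableI_bounded)
    have "(\<integral>\<^sup>+ z. ennreal (norm (g z)) \<partial>lborel) \<le> (\<integral>\<^sup>+ z. ennreal 4 * b z \<partial>lborel)"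
      unfolding g_def b_def using norm_quad_kernel_le[OF \<phi>]
      by (intro nn_integral_mono) (subst ennreal_mult[symmetric], auto intro: ennreal_leI)
    also have "\<dots> = ennreal 4 * (\<integral>\<^sup>+ z. b z \<partial>lborel)" by (rule nn_integral_cmult) measurable
    also have "\<dots> < \<infinity>" using b by (auto simp: ennreal_mult_less_top intro: le_less_trans)
    finally show "(\<integral>\<^sup>+ z. ennreal (norm (g z)) \<partial>lborel) < \<infinity>" .
  qed measurable
  define K where "K = (4 * L + 4) * norm h"
  have K: "K \<ge> 0" using L by (simp add: K_def)
  have "ennreal (norm (\<integral>z. f z - g z \<partial>lborel)) \<le> (\<integral>\<^sup>+ z. ennreal (norm (f z - g z)) \<partial>lborel)"
    using intf intg by (intro integral_norm_bound_ennreal) auto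
  also have "\<dots> \<le> (\<integral>\<^sup>+ z. ennreal K * (a z + b z) \<partial>lborel)"
  proof (rule nn_integral_mono)
    fix z
    have "norm (f z - g z) \<le> K * ((indicator (cball 0 2) z + indicator (cball 0 2) (h + z)) * norm (w (x + \<delta> *\<^sub>R z)))"
      using quad_kernel_lipschitz[OF \<phi> L, of z "w (x + \<delta> *\<^sub>R z)" "h + z"]
      by (simp add: f_def g_def K_def dist_norm)
    then show "ennreal (norm (f z - g z)) \<le> ennreal K * (a z + b z)"
      unfolding a_def b_def using K by (simp add: ennreal_leI distrib_right flip: ennreal_plus ennreal_mult)
  qed
  also have "\<dots> = ennreal K * ((\<integral>\<^sup>+ z. a z \<partial>lborel) + (\<integral>\<^sup>+ z. b z \<partial>lborel))"
    by (simp add: nn_integral_cmult nn_integral_add)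
  also have "\<dots> \<le> ennreal K * (ennreal C0 + ennreal C0)"
    by (intro mult_left_mono add_mono a b) auto
  also have "\<dots> = ennreal (K * (C0 + C0))"
    using K C0 by (simp only: ennreal_plus[symmetric] ennreal_mult[symmetric] add_nonneg_nonneg)
  finally have "norm (\<integral>z. f z - g z \<partial>lborel) \<le> K * (C0 + C0)"
    using K C0 by simp
  also have "K * (C0 + C0) = 2 * (4 * L + 4) * C0 / \<delta> * norm (x - y)"
  proof -
    have "norm h = norm (x - y) / \<delta>" using \<delta> by (simp add: h_def divide_inverse mult.commute)
    then show ?thesis by (simp add: K_def)
  qed
  finally show ?thesis using intf intg unfolding Vx Vy C0_def by simp
qed

end

end

lemma directional_average_diff:
  fixes u v :: "'a::euclidean_space \<Rightarrow> 'a"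
  assumes "\<And>x. integrable lborel (\<lambda>z. quad_kernel \<phi> z (u (x + \<delta> *\<^sub>R z)))"
    and "\<And>x. integrable lborel (\<lambda>z. quad_kernel \<phi> z (v (x + \<delta> *\<^sub>R z)))"
  shows "directional_average \<phi> \<delta> (\<lambda>x. u x - v x) x = directional_average \<phi> \<delta> u x - directional_average \<phi> \<delta> v x"
proof -
  have "quad_kernel \<phi> z (e - f) = quad_kernel \<phi> z e - quad_kernel \<phi> z f" for z e f :: 'a
    by (simp add: quad_kernel_def inner_diff_left scaleR_diff_left scaleR_diff_right)
  then show ?thesis unfolding directional_average_def using assms by simp
qed

text \<open>The terms on the right come from the oscillation of w in the directions of E, from the
  cutoff replacing the indicator, and from the average on D. In the second, \<kappa>^(p-1) is due to
  Jensen's inequality and one more \<kappa> to the mass of the difference. The norm bound W is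
  global since x + \<delta> z may leave D.\<close>

lemma Lp_le_osc_average:
  fixes w :: "'a::euclidean_space \<Rightarrow> 'a" and \<phi> :: "'a \<Rightarrow> real"
  assumes p: "1 \<le> p" and \<delta>: "0 < \<delta>" and w[measurable]: "w \<in> borel_measurable borel"
    and W: "(\<integral>\<^sup>+ x. ennreal (norm (w x) powr p) \<partial>lborel) \<le> ennreal W" "0 \<le> W"
    and E[measurable]: "E \<in> sets borel" and sub: "E \<subseteq> cball 0 1"
    and c: "0 < c" "\<And>e. c * norm e \<le> norm (\<integral>z. indicator E z *\<^sub>R ((e \<bullet> z) *\<^sub>R z) \<partial>lborel)"
    and \<phi>_meas[measurable]: "\<phi> \<in> borel_measurable borel"
    and \<phi>: "\<And>z. indicator E z \<le> \<phi> z" "\<And>z. \<phi> z \<le> 1" "\<And>z. 2 < norm z \<Longrightarrow> \<phi> z = 0"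
    and \<kappa>: "0 < \<kappa>" "(\<integral>\<^sup>+ z. ennreal (\<phi> z - indicator E z) \<partial>lborel) \<le> ennreal \<kappa>"
    and D[measurable]: "D \<in> sets borel"
    and \<eta>: "0 \<le> \<eta>" "\<And>x. x \<in> D \<Longrightarrow> norm (directional_average \<phi> \<delta> w x) \<le> \<eta>"
  shows "(\<integral>\<^sup>+ x. indicator D x * ennreal (norm (w x) powr p) \<partial>lborel)
     \<le> ennreal ((3 / c) powr p) *
        (ennreal (measure lborel (cball (0::'a) 1) powr (p - 1)) *
           (\<integral>\<^sup>+ z. indicator E z * (\<integral>\<^sup>+ x. ennreal (\<bar>(w (x + \<delta> *\<^sub>R z) - w x) \<bullet> z\<bar> powr p) \<partial>lborel) \<partial>lborel)
         + ennreal (\<kappa> powr p * 4 powr p * W) + ennreal (\<eta> powr p) * emeasure lborel D)"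
proof -
  define V where "V = measure lborel (cball (0::'a) 1)"
  have V: "V > 0" unfolding V_def by (rule content_cball_pos) simp
  define T1 where "T1 x = (\<integral>\<^sup>+ z. ennreal (indicator E z * \<bar>(w (x + \<delta> *\<^sub>R z) - w x) \<bullet> z\<bar> powr p) \<partial>lborel)" for x
  define T2 where "T2 x = (\<integral>\<^sup>+ z. ennreal ((\<phi> z - indicator E z) * (4 * norm (w (x + \<delta> *\<^sub>R z))) powr p) \<partial>lborel)" for x
  have [measurable]: "T1 \<in> borel_measurable borel" "T2 \<in> borel_measurable borel"
    unfolding T1_def[abs_def] T2_def[abs_def] by measurable
  have \<phi>0: "0 \<le> \<phi> z" for z using \<phi>(1)[of z] by (rule order_trans[rotated]) simp
  have \<phi>abs: "\<bar>\<phi> z\<bar> \<le> 1" for z using \<phi>0[of z] \<phi>(2)[of z] by simp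
  have sub2: "2 < norm z \<Longrightarrow> z \<notin> E" for z using sub by fastforce
  have volE: "(\<integral>\<^sup>+ z. ennreal (indicator E z) \<partial>lborel) \<le> ennreal V"
  proof -
    have "(\<integral>\<^sup>+ z. ennreal (indicator E z) \<partial>lborel) = emeasure lborel E"
      by (simp add: ennreal_indicator)
    also have "\<dots> \<le> emeasure lborel (cball (0::'a) 1)" using sub by (intro emeasure_mono) auto
    also have "\<dots> = ennreal V" unfolding V_def
      using emeasure_lborel_cball_finite[of "0::'a" 1] by (intro emeasure_eq_ennreal_measure) auto
    finally show ?thesis .
  qed
  have point: "ennreal (norm (w x) powr p) \<le> ennreal ((3 / c) powr p) *
      (ennreal (V powr (p - 1)) * T1 x + ennreal (\<kappa> powr (p - 1)) * T2 x + ennreal (\<eta> powr p))"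
    if x: "x \<in> D" for x
  proof -
    \<comment> \<open>the moment matrix applied to \<open>w x\<close> splits into the oscillation, the error of replacing the
      indicator by the cutoff, and the directional average\<close>
    define F1 where "F1 z = indicator E z *\<^sub>R (((w x - w (x + \<delta> *\<^sub>R z)) \<bullet> z) *\<^sub>R z)" for z
    define F2 where "F2 z = (indicator E z - \<phi> z) *\<^sub>R ((w (x + \<delta> *\<^sub>R z) \<bullet> z) *\<^sub>R z)" for z
    define F3 where "F3 z = quad_kernel \<phi> z (w (x + \<delta> *\<^sub>R z))" for z
    define A where "A z = indicator E z *\<^sub>R ((w x \<bullet> z) *\<^sub>R z)" for z
    have [measurable]: "F1 \<in> borel_measurable borel" "F2 \<in> borel_measurable borel" "A \<in> borel_measurable borel"
      unfolding F1_def[abs_def] F2_def[abs_def] A_def[abs_def] by measurable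
    have F2q: "F2 z = quad_kernel (\<lambda>z. indicator E z - \<phi> z) z (w (x + \<delta> *\<^sub>R z))" for z
      by (simp add: F2_def quad_kernel_def)
    have i3: "integrable lborel F3"
      unfolding F3_def by (rule integrable_quad_kernel[OF p \<delta> w W(1) \<phi>_meas \<phi>abs \<phi>(3)])
    have i2: "integrable lborel F2"
      unfolding F2q
    proof (rule integrable_quad_kernel[OF p \<delta> w W(1)])
      show "\<bar>indicator E z - \<phi> z\<bar> \<le> 1" for z
        using \<phi>(1,2)[of z] \<phi>0[of z] by (auto simp: indicator_def split: if_splits)
      show "indicator E z - \<phi> z = 0" if "2 < norm z" for z
        using that \<phi>(3) sub2 by simp
    qed measurable
    have iE: "integrable lborel (indicator E :: 'a \<Rightarrow> real)"
      using emeasure_bounded_finite[OF bounded_subset[OF bounded_cball sub]]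
      by (intro integrable_real_indicator) (auto simp: less_top)
    have iA: "integrable lborel A"
    proof (rule Bochner_Integration.integrable_bound)
      show "integrable lborel (\<lambda>z. norm (w x) * indicator E z)" using iE by simp
      show "AE z in lborel. norm (A z) \<le> norm (norm (w x) * indicat_real E z)"
      proof (intro always_eventually allI)
        fix z
        have "\<bar>w x \<bullet> z\<bar> * norm z \<le> (norm (w x) * 1) * 1" if "z \<in> E"
          using that sub by (intro mult_mono order_trans[OF Cauchy_Schwarz_ineq2] mult_left_mono) auto
        then show "norm (A z) \<le> norm (norm (w x) * indicat_real E z)"
          by (auto simp: indicator_def A_def)
      qed
    qed measurable
    have sum: "A z = F1 z + F2 z + F3 z" for z
      unfolding A_def F1_def F2_def F3_def quad_kernel_def by (simp add: algebra_simps inner_diff_left)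
    have i1: "integrable lborel F1"
    proof -
      have "F1 = (\<lambda>z. A z - F2 z - F3 z)" using sum by (auto simp: fun_eq_iff)
      then show ?thesis using iA i2 i3 by simp
    qed
    have "(\<integral>z. A z \<partial>lborel) = (\<integral>z. F1 z \<partial>lborel) + (\<integral>z. F2 z \<partial>lborel) + (\<integral>z. F3 z \<partial>lborel)"
      unfolding sum using i1 i2 i3 by simp
    then have "c * norm (w x) \<le> norm ((\<integral>z. F1 z \<partial>lborel) + (\<integral>z. F2 z \<partial>lborel) + (\<integral>z. F3 z \<partial>lborel))"
      using c(2)[of "w x"] by (simp add: A_def)
    then have "(c * norm (w x)) powr p \<le> norm ((\<integral>z. F1 z \<partial>lborel) + (\<integral>z. F2 z \<partial>lborel) + (\<integral>z. F3 z \<partial>lborel)) powr p"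
      using p c by (intro powr_mono2) auto
    also have "\<dots> \<le> 3 powr p * (norm (\<integral>z. F1 z \<partial>lborel) powr p + norm (\<integral>z. F2 z \<partial>lborel) powr p + norm (\<integral>z. F3 z \<partial>lborel) powr p)"
      using p by (intro norm_add3_powr_le) simp
    also have "norm (\<integral>z. F3 z \<partial>lborel) powr p \<le> \<eta> powr p"
      using \<eta>(2)[OF x] p unfolding F3_def directional_average_def by (intro powr_mono2) auto
    finally have le: "norm (w x) powr p \<le> (3 / c) powr p * (norm (\<integral>z. F1 z \<partial>lborel) powr p + norm (\<integral>z. F2 z \<partial>lborel) powr p + \<eta> powr p)"
      using c by (simp add: powr_mult powr_divide field_simps)
    have b1: "ennreal (norm (\<integral>z. F1 z \<partial>lborel) powr p) \<le> ennreal (V powr (p - 1)) * T1 x"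
      unfolding T1_def
    proof (rule norm_integral_powr_le[OF p V _ _ _ _ volE])
      fix z
      show "norm (F1 z) \<le> indicator E z * \<bar>(w (x + \<delta> *\<^sub>R z) - w x) \<bullet> z\<bar>"
      proof (cases "z \<in> E")
        case True
        then have "norm z \<le> 1" using sub by auto
        then have "\<bar>(w x - w (x + \<delta> *\<^sub>R z)) \<bullet> z\<bar> * norm z \<le> \<bar>(w x - w (x + \<delta> *\<^sub>R z)) \<bullet> z\<bar>"
          by (intro mult_left_le) auto
        then show ?thesis using True by (simp add: F1_def inner_diff_left abs_minus_commute)
      qed (simp add: F1_def)
    qed simp_all
    have b2: "ennreal (norm (\<integral>z. F2 z \<partial>lborel) powr p) \<le> ennreal (\<kappa> powr (p - 1)) * T2 x"
      unfolding T2_def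
    proof (rule norm_integral_powr_le[OF p \<kappa>(1) _ _ _ _ \<kappa>(2)])
      fix z
      show "0 \<le> \<phi> z - indicator E z" using \<phi>(1)[of z] by simp
      show "norm (F2 z) \<le> (\<phi> z - indicator E z) * (4 * norm (w (x + \<delta> *\<^sub>R z)))"
      proof (cases "norm z \<le> 2")
        case True
        have "\<bar>w (x + \<delta> *\<^sub>R z) \<bullet> z\<bar> * norm z \<le> (norm (w (x + \<delta> *\<^sub>R z)) * 2) * 2"
          using True by (intro mult_mono order_trans[OF Cauchy_Schwarz_ineq2] mult_left_mono) auto
        then have "(\<phi> z - indicator E z) * (\<bar>w (x + \<delta> *\<^sub>R z) \<bullet> z\<bar> * norm z) \<le> (\<phi> z - indicator E z) * (4 * norm (w (x + \<delta> *\<^sub>R z)))"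
          using \<phi>(1)[of z] by (intro mult_left_mono) auto
        moreover have "norm (F2 z) = (\<phi> z - indicator E z) * (\<bar>w (x + \<delta> *\<^sub>R z) \<bullet> z\<bar> * norm z)"
          using \<phi>(1)[of z] by (simp add: F2_def abs_mult)
        ultimately show ?thesis by simp
      qed (use \<phi>(3)[of z] sub2[of z] in \<open>simp add: F2_def\<close>)
    qed simp_all
    have "ennreal (norm (w x) powr p) \<le> ennreal ((3 / c) powr p) * (ennreal (norm (\<integral>z. F1 z \<partial>lborel) powr p) + ennreal (norm (\<integral>z. F2 z \<partial>lborel) powr p) + ennreal (\<eta> powr p))"
      using le by (simp add: ennreal_leI flip: ennreal_mult ennreal_plus)
    also have "\<dots> \<le> ennreal ((3 / c) powr p) *
      (ennreal (V powr (p - 1)) * T1 x + ennreal (\<kappa> powr (p - 1)) * T2 x + ennreal (\<eta> powr p))"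
      by (intro mult_left_mono add_mono b1 b2) auto
    finally show ?thesis .
  qed
  have X1: "(\<integral>\<^sup>+ x. T1 x \<partial>lborel) = (\<integral>\<^sup>+ z. indicator E z * (\<integral>\<^sup>+ x. ennreal (\<bar>(w (x + \<delta> *\<^sub>R z) - w x) \<bullet> z\<bar> powr p) \<partial>lborel) \<partial>lborel)"
  proof -
    have "(\<integral>\<^sup>+ x. T1 x \<partial>lborel) = (\<integral>\<^sup>+ x. (\<integral>\<^sup>+ z. indicator E z * ennreal (\<bar>(w (x + \<delta> *\<^sub>R z) - w x) \<bullet> z\<bar> powr p) \<partial>lborel) \<partial>lborel)"
      unfolding T1_def by (intro nn_integral_cong) (simp add: indicator_def)
    also have "\<dots> = (\<integral>\<^sup>+ z. (\<integral>\<^sup>+ x. indicator E z * ennreal (\<bar>(w (x + \<delta> *\<^sub>R z) - w x) \<bullet> z\<bar> powr p) \<partial>lborel) \<partial>lborel)"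
      by (rule lborel_pair.Fubini') measurable
    also have "\<dots> = (\<integral>\<^sup>+ z. indicator E z * (\<integral>\<^sup>+ x. ennreal (\<bar>(w (x + \<delta> *\<^sub>R z) - w x) \<bullet> z\<bar> powr p) \<partial>lborel) \<partial>lborel)"
      by (intro nn_integral_cong nn_integral_cmult) measurable
    finally show ?thesis .
  qed
  have X2: "(\<integral>\<^sup>+ x. T2 x \<partial>lborel) \<le> ennreal (\<kappa> * 4 powr p * W)"
  proof -
    have g0: "0 \<le> \<phi> z - indicator E z" for z using \<phi>(1)[of z] by simp
    have "(\<integral>\<^sup>+ x. T2 x \<partial>lborel)
        = (\<integral>\<^sup>+ x. (\<integral>\<^sup>+ z. ennreal ((\<phi> z - indicator E z) * 4 powr p) * ennreal (norm (w (x + \<delta> *\<^sub>R z)) powr p) \<partial>lborel) \<partial>lborel)"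
      unfolding T2_def using g0 by (intro nn_integral_cong) (simp add: powr_mult mult.assoc flip: ennreal_mult)
    also have "\<dots> = (\<integral>\<^sup>+ z. (\<integral>\<^sup>+ x. ennreal ((\<phi> z - indicator E z) * 4 powr p) * ennreal (norm (w (x + \<delta> *\<^sub>R z)) powr p) \<partial>lborel) \<partial>lborel)"
      by (rule lborel_pair.Fubini') measurable
    also have "\<dots> \<le> (\<integral>\<^sup>+ z. ennreal (4 powr p * W) * ennreal (\<phi> z - indicator E z) \<partial>lborel)"
    proof (rule nn_integral_mono)
      fix z :: 'a
      have "(\<integral>\<^sup>+ x. ennreal (norm (w (x + \<delta> *\<^sub>R z)) powr p) \<partial>lborel) = (\<integral>\<^sup>+ x. ennreal (norm (w x) powr p) \<partial>lborel)"
        using nn_integral_lborel_affine[where f = "\<lambda>x. ennreal (norm (w x) powr p)" and c = 1 and t = "\<delta> *\<^sub>R z"]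
        by (simp add: add.commute)
      then have s: "(\<integral>\<^sup>+ x. ennreal (norm (w (x + \<delta> *\<^sub>R z)) powr p) \<partial>lborel) \<le> ennreal W" using W by simp
      have "(\<integral>\<^sup>+ x. ennreal ((\<phi> z - indicator E z) * 4 powr p) * ennreal (norm (w (x + \<delta> *\<^sub>R z)) powr p) \<partial>lborel)
          = ennreal ((\<phi> z - indicator E z) * 4 powr p) * (\<integral>\<^sup>+ x. ennreal (norm (w (x + \<delta> *\<^sub>R z)) powr p) \<partial>lborel)"
        by (rule nn_integral_cmult) measurable
      also have "\<dots> \<le> ennreal ((\<phi> z - indicator E z) * 4 powr p) * ennreal W"
        by (intro mult_left_mono s) auto
      also have "\<dots> = ennreal (4 powr p * W) * ennreal (\<phi> z - indicator E z)"
        using g0[of z] W by (subst (1 2) ennreal_mult[symmetric]) (auto simp: mult_ac)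
      finally show "(\<integral>\<^sup>+ x. ennreal ((\<phi> z - indicator E z) * 4 powr p) * ennreal (norm (w (x + \<delta> *\<^sub>R z)) powr p) \<partial>lborel)
        \<le> ennreal (4 powr p * W) * ennreal (\<phi> z - indicator E z)" .
    qed
    also have "\<dots> = ennreal (4 powr p * W) * (\<integral>\<^sup>+ z. ennreal (\<phi> z - indicator E z) \<partial>lborel)"
      by (rule nn_integral_cmult) measurable
    also have "\<dots> \<le> ennreal (4 powr p * W) * ennreal \<kappa>" by (intro mult_left_mono \<kappa>) auto
    also have "\<dots> = ennreal (\<kappa> * 4 powr p * W)" using W \<kappa> by (subst ennreal_mult[symmetric]) (auto simp: mult_ac)
    finally show ?thesis .
  qed
  have "(\<integral>\<^sup>+ x. indicator D x * ennreal (norm (w x) powr p) \<partial>lborel)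
     \<le> (\<integral>\<^sup>+ x. ennreal ((3 / c) powr p) * (ennreal (V powr (p - 1)) * T1 x + ennreal (\<kappa> powr (p - 1)) * T2 x
          + ennreal (\<eta> powr p) * indicator D x) \<partial>lborel)"
    using point by (intro nn_integral_mono) (auto simp: indicator_def)
  also have "\<dots> = ennreal ((3 / c) powr p) * (ennreal (V powr (p - 1)) * (\<integral>\<^sup>+ x. T1 x \<partial>lborel)
      + ennreal (\<kappa> powr (p - 1)) * (\<integral>\<^sup>+ x. T2 x \<partial>lborel) + ennreal (\<eta> powr p) * emeasure lborel D)"
    by (simp add: nn_integral_cmult nn_integral_add)
  also have "\<dots> \<le> ennreal ((3 / c) powr p) * (ennreal (V powr (p - 1)) * (\<integral>\<^sup>+ x. T1 x \<partial>lborel)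
      + ennreal (\<kappa> powr (p - 1)) * ennreal (\<kappa> * 4 powr p * W) + ennreal (\<eta> powr p) * emeasure lborel D)"
    by (intro mult_left_mono add_mono X2) auto
  also have "ennreal (\<kappa> powr (p - 1)) * ennreal (\<kappa> * 4 powr p * W) = ennreal (\<kappa> powr p * 4 powr p * W)"
    using \<kappa>(1) W by (subst ennreal_mult[symmetric]) (auto simp: powr_diff)
  finally show ?thesis unfolding X1 V_def .
qed

section \<open>Compactness\<close>

text \<open>Distance cutoffs of slope m + 1 tend to the indicator of K because K is closed, so
  dominated convergence makes the error small at the price of a large Lipschitz constant. Points of
  norm above 2 have distance at least 1 from K, where every cutoff is 0.\<close>

lemma lipschitz_cutoff_exists:
  fixes K :: "'a::euclidean_space set"
  assumes K: "compact K" "K \<subseteq> cball 0 1" "K \<noteq> {}" and \<kappa>: "0 < \<kappa>"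
  shows "\<exists>\<phi> L. \<phi> \<in> borel_measurable borel \<and> (\<forall>z. indicator K z \<le> \<phi> z) \<and> (\<forall>z. \<phi> z \<le> 1) \<and>
     (\<forall>z. 2 < norm z \<longrightarrow> \<phi> z = 0) \<and> (\<forall>a b. \<bar>\<phi> a - \<phi> b\<bar> \<le> L * dist a b) \<and> 0 \<le> L \<and>
     (\<integral>\<^sup>+ z. ennreal (\<phi> z - indicator K z) \<partial>lborel) \<le> ennreal \<kappa>"
proof -
  define \<phi> where "\<phi> m z = max 0 (1 - real (Suc m) * infdist z K)" for m z
  have cont: "continuous_on UNIV (\<phi> m)" for m
    unfolding \<phi>_def by (intro continuous_intros)
  then have meas: "\<phi> m \<in> borel_measurable borel" for m by (rule borel_measurable_continuous_onI)
  have Kb: "K \<in> sets borel" using K(1) by (intro borel_closed compact_imp_closed)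
  have ge: "indicator K z \<le> \<phi> m z" for m z by (auto simp: \<phi>_def indicator_def)
  have le: "\<phi> m z \<le> 1" for m z by (simp add: \<phi>_def infdist_nonneg)
  have supp: "\<phi> m z = 0" if "2 < norm z" for m z
  proof -
    have "1 \<le> infdist z K"
      unfolding infdist_notempty[OF K(3)]
    proof (rule cINF_greatest[OF K(3)])
      fix a assume "a \<in> K"
      then have "norm a \<le> 1" using K(2) by auto
      then show "1 \<le> dist z a" using that norm_triangle_ineq2[of z a] by (simp add: dist_norm)
    qed
    then have "1 * 1 \<le> real (Suc m) * infdist z K" by (intro mult_mono) auto
    then show ?thesis by (simp add: \<phi>_def)
  qed
  have lip: "\<bar>\<phi> m a - \<phi> m b\<bar> \<le> real (Suc m) * dist a b" for m a b
  proof -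
    have "\<bar>\<phi> m a - \<phi> m b\<bar> \<le> \<bar>real (Suc m) * infdist a K - real (Suc m) * infdist b K\<bar>"
      unfolding \<phi>_def by linarith
    also have "\<dots> = real (Suc m) * \<bar>infdist a K - infdist b K\<bar>"
      by (simp only: right_diff_distrib[symmetric] abs_mult abs_of_nat)
    also have "\<dots> \<le> real (Suc m) * dist a b" by (intro mult_left_mono infdist_triangle_abs) auto
    finally show ?thesis .
  qed
  have lim: "(\<lambda>m. \<phi> m z - indicator K z) \<longlonglongrightarrow> 0" for z
  proof (cases "z \<in> K")
    case False
    then have pos: "infdist z K > 0"
      using K in_closed_iff_infdist_zero[of K z] infdist_nonneg[of z K] compact_imp_closed by fastforce
    have "\<forall>\<^sub>F m in sequentially. \<phi> m z - indicator K z = 0"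
    proof (rule eventually_sequentiallyI[of "nat \<lceil>1 / infdist z K\<rceil>"])
      fix m assume "nat \<lceil>1 / infdist z K\<rceil> \<le> m"
      then have "1 / infdist z K \<le> real (Suc m)" by linarith
      then have "1 \<le> real (Suc m) * infdist z K" using pos by (simp add: pos_divide_le_eq)
      then show "\<phi> m z - indicator K z = 0" using False by (simp add: \<phi>_def)
    qed
    then show ?thesis by (rule tendsto_eventually)
  qed (simp add: \<phi>_def)
  have "(\<lambda>m. \<integral>\<^sup>+ z. ennreal (\<phi> m z - indicator K z) \<partial>lborel) \<longlonglongrightarrow> (\<integral>\<^sup>+ z. 0 \<partial>(lborel :: 'a measure))"
  proof (rule nn_integral_dominated_convergence[where w = "indicator (cball 0 2)"])
    show "AE z in lborel. ennreal (\<phi> m z - indicator K z) \<le> indicator (cball 0 2) z" for m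
    proof (intro always_eventually allI)
      fix z
      show "ennreal (\<phi> m z - indicator K z) \<le> indicator (cball 0 2) z"
      proof (cases "norm z \<le> 2")
        case True
        have "\<phi> m z - indicator K z \<le> 1" using le[of m z] by (simp add: indicator_def)
        then show ?thesis using True by (simp add: ennreal_le_1)
      qed (simp add: supp ennreal_neg)
    qed
    show "(\<integral>\<^sup>+ z. indicator (cball (0::'a) 2) z \<partial>lborel) < \<infinity>"
      using emeasure_lborel_cball_finite[of "0::'a" 2] by simp
    show "AE z in lborel. (\<lambda>m. ennreal (\<phi> m z - indicator K z)) \<longlonglongrightarrow> 0"
      using tendsto_ennrealI[OF lim] by (intro always_eventually allI) simp
  qed (use meas Kb in \<open>auto intro!: borel_measurable_diff borel_measurable_indicator measurable_compose[OF _ measurable_ennreal]\<close>)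
  then have "\<forall>\<^sub>F m in sequentially. (\<integral>\<^sup>+ z. ennreal (\<phi> m z - indicator K z) \<partial>lborel) < ennreal \<kappa>"
    using \<kappa> by (intro order_tendstoD(2)[of _ 0]) auto
  then obtain m where "(\<integral>\<^sup>+ z. ennreal (\<phi> m z - indicator K z) \<partial>lborel) < ennreal \<kappa>"
    by (auto simp: eventually_sequentially)
  then show ?thesis using meas ge le supp lip
    by (intro exI[of _ "\<phi> m"] exI[of _ "real (Suc m)"]) (auto intro: less_imp_le)
qed

lemma uniformly_Cauchy_subseq:
  fixes F :: "nat \<Rightarrow> 'a::euclidean_space \<Rightarrow> 'b::{real_normed_vector,heine_borel}"
  assumes S: "compact S" and bound: "\<And>n x. norm (F n x) \<le> B"
    and lip: "\<And>n x y. norm (F n x - F n y) \<le> C * norm (x - y)"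
  shows "\<exists>r. strict_mono (r :: nat \<Rightarrow> nat) \<and>
    (\<forall>e>0. \<exists>N. \<forall>k\<ge>N. \<forall>l\<ge>N. \<forall>x\<in>S. norm (F (r k) x - F (r l) x) \<le> e)"
proof -
  have eq: "\<exists>d. 0 < d \<and> (\<forall>n y. y \<in> S \<and> norm (x - y) < d \<longrightarrow> norm (F n x - F n y) < e)" if "0 < e" for x e
  proof (intro exI conjI allI impI)
    \<comment> \<open>The sign of \<open>C\<close> is unknown, hence the modulus; adding 1 keeps the
      denominator positive.\<close>
    show "0 < e / (\<bar>C\<bar> + 1)" using that by simp
    fix n y assume "y \<in> S \<and> norm (x - y) < e / (\<bar>C\<bar> + 1)"
    then have "(\<bar>C\<bar> + 1) * norm (x - y) < e" by (simp add: field_simps)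
    moreover have "C * norm (x - y) \<le> (\<bar>C\<bar> + 1) * norm (x - y)" by (intro mult_right_mono) auto
    ultimately show "norm (F n x - F n y) < e" using lip[of n x y] by linarith
  qed
  obtain g r where r: "strict_mono (r :: nat \<Rightarrow> nat)"
    and g: "\<And>e. 0 < e \<Longrightarrow> \<exists>N. \<forall>n x. n \<ge> N \<and> x \<in> S \<longrightarrow> norm (F (r n) x - g x) < e"
    using Arzela_Ascoli[OF S bound eq] by metis
  have "\<exists>N. \<forall>k\<ge>N. \<forall>l\<ge>N. \<forall>x\<in>S. norm (F (r k) x - F (r l) x) \<le> e" if e: "0 < e" for e
  proof -
    obtain N where N: "\<And>n x. n \<ge> N \<Longrightarrow> x \<in> S \<Longrightarrow> norm (F (r n) x - g x) < e / 2"
      using g[OF half_gt_zero[OF e]] by blast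
    have "norm (F (r k) x - F (r l) x) \<le> e" if "k \<ge> N" "l \<ge> N" "x \<in> S" for k l x
    proof -
      have "norm ((F (r k) x - g x) - (F (r l) x - g x)) \<le> norm (F (r k) x - g x) + norm (F (r l) x - g x)"
        by (rule norm_triangle_ineq4)
      moreover have "norm (F (r k) x - g x) < e / 2" "norm (F (r l) x - g x) < e / 2"
        using N that by blast+
      ultimately show ?thesis by simp
    qed
    then show ?thesis by blast
  qed
  then show ?thesis using r by blast
qed

text \<open>Being uniformly Cauchy on S passes to subsequences, which is what the diagonal
  construction requires of the j-th property.\<close>

lemma diagonal_uniformly_Cauchy:
  fixes F :: "nat \<Rightarrow> nat \<Rightarrow> 'a::euclidean_space \<Rightarrow> 'b::{real_normed_vector,heine_borel}"
  assumes S: "compact S" and bound: "\<And>j n x. norm (F j n x) \<le> B j"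
    and lip: "\<And>j n x y. norm (F j n x - F j n y) \<le> C j * norm (x - y)"
  shows "\<exists>r. strict_mono (r :: nat \<Rightarrow> nat) \<and>
    (\<forall>j. \<forall>e>0. \<exists>N. \<forall>k\<ge>N. \<forall>l\<ge>N. \<forall>x\<in>S. norm (F j (r k) x - F j (r l) x) \<le> e)"
proof -
  define P where "P j r \<longleftrightarrow> (\<forall>e>0. \<exists>N. \<forall>k\<ge>N. \<forall>l\<ge>N. \<forall>x\<in>S. norm (F j (r k) x - F j (r l) x) \<le> e)"
    for j and r :: "nat \<Rightarrow> nat"
  interpret subseqs P
  proof
    fix j and s :: "nat \<Rightarrow> nat"
    show "\<exists>r. strict_mono r \<and> P j (s \<circ> r)"
      using uniformly_Cauchy_subseq[OF S, of "\<lambda>n. F j (s n)" "B j" "C j"] bound lip by (simp add: P_def)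
  qed
  have stable: "P j (s \<circ> r)" if r: "strict_mono r" and P: "P j s" for j s r
    unfolding P_def
  proof (intro allI impI)
    fix e :: real assume "0 < e"
    then obtain N where N: "\<And>k l x. k \<ge> N \<Longrightarrow> l \<ge> N \<Longrightarrow> x \<in> S \<Longrightarrow> norm (F j (s k) x - F j (s l) x) \<le> e"
      using P unfolding P_def by meson
    have "norm (F j ((s \<circ> r) k) x - F j ((s \<circ> r) l) x) \<le> e" if "k \<ge> N" "l \<ge> N" "x \<in> S" for k l x
      using N[of "r k" "r l" x] seq_suble[OF r, of k] seq_suble[OF r, of l] that by simp
    then show "\<exists>N. \<forall>k\<ge>N. \<forall>l\<ge>N. \<forall>x\<in>S. norm (F j ((s \<circ> r) k) x - F j ((s \<circ> r) l) x) \<le> e" by blast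
  qed
  have "\<exists>N. \<forall>k\<ge>N. \<forall>l\<ge>N. \<forall>x\<in>S. norm (F j (diagseq k) x - F j (diagseq l) x) \<le> e" if e: "0 < e" for j e
  proof -
    \<comment> \<open>The diagonal sequence is used as a subsequence of the j-th chosen one from
      index \<open>Suc j\<close> on; the shift is absorbed into the threshold afterwards.\<close>
    have "P j (diagseq \<circ> ((+) (Suc j)))" by (rule diagseq_holds[OF stable])
    then obtain N where N: "\<And>k l x. k \<ge> N \<Longrightarrow> l \<ge> N \<Longrightarrow> x \<in> S \<Longrightarrow>
        norm (F j (diagseq (Suc j + k)) x - F j (diagseq (Suc j + l)) x) \<le> e"
      using e unfolding P_def o_def by blast
    have "norm (F j (diagseq k) x - F j (diagseq l) x) \<le> e" if "k \<ge> Suc j + N" "l \<ge> Suc j + N" "x \<in> S" for k l x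
      using N[of "k - Suc j" "l - Suc j" x] that by simp
    then show ?thesis by blast
  qed
  then show ?thesis using subseq_diagseq by blast
qed

text \<open>For each tolerance 1/(j+1) a scale and a cutoff are fixed before the subsequence is
  extracted, so one diagonal subsequence has uniformly Cauchy averages for all j.
  \<open>Lp_le_osc_average\<close> is then applied to differences.\<close>

lemma directional_osc_compactness:
  fixes u :: "nat \<Rightarrow> 'a::euclidean_space \<Rightarrow> 'a"
  assumes p: "1 \<le> p" and u[measurable]: "\<And>n. u n \<in> borel_measurable borel"
    and M: "0 \<le> M" "\<And>n. (\<integral>\<^sup>+ x. ennreal (norm (u n x) powr p) \<partial>lborel) \<le> ennreal M"
    and E: "E \<in> sets borel" "E \<subseteq> cball 0 1" "emeasure lborel E > 0"
    and osc: "\<And>\<epsilon>. 0 < \<epsilon> \<Longrightarrow> \<exists>\<delta>>0. \<forall>n.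
      (\<integral>\<^sup>+ z. indicator E z * (\<integral>\<^sup>+ x. ennreal (\<bar>(u n (x + \<delta> *\<^sub>R z) - u n x) \<bullet> z\<bar> powr p) \<partial>lborel) \<partial>lborel) \<le> ennreal \<epsilon>"
    and D[measurable]: "D \<in> sets borel" and bD: "bounded D"
  shows "\<exists>s g. strict_mono (s :: nat \<Rightarrow> nat) \<and> g \<in> borel_measurable borel \<and>
    (\<integral>\<^sup>+ x. indicator D x * ennreal (norm (g x) powr p) \<partial>lborel) < \<infinity> \<and>
    (\<lambda>k. \<integral>\<^sup>+ x. indicator D x * ennreal (norm (u (s k) x - g x) powr p) \<partial>lborel) \<longlonglongrightarrow> 0"
proof -
  obtain K where K: "compact K" "K \<subseteq> E" "emeasure lborel K > 0"
    using compact_subset_positive_measure[OF E(1) bounded_subset[OF bounded_cball E(2)] E(3)] by blast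
  have Kb[measurable]: "K \<in> sets borel" using K(1) by (intro borel_closed compact_imp_closed)
  have Kc: "K \<subseteq> cball 0 1" using K E by blast
  have Kne: "K \<noteq> {}" using K(3) by auto
  obtain c where c: "0 < c" "\<And>e. c * norm e \<le> norm (\<integral>z. indicator K z *\<^sub>R ((e \<bullet> z) *\<^sub>R z) \<partial>lborel)"
    using moment_matrix_bounded_below[OF Kb Kc K(3)] by blast
  define t where "t j = 1 / real (Suc j)" for j
  have t: "0 < t j" "t j \<le> 1" for j by (auto simp: t_def)
  define X where "X w \<delta> = (\<integral>\<^sup>+ z. indicator K z * (\<integral>\<^sup>+ x. ennreal (\<bar>(w (x + \<delta> *\<^sub>R z) - w x) \<bullet> z\<bar> powr p) \<partial>lborel) \<partial>lborel)"
    for w :: "'a \<Rightarrow> 'a" and \<delta>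
  have "\<exists>\<delta>>0. \<forall>n. X (u n) \<delta> \<le> ennreal (t j)" for j
  proof -
    obtain \<delta> where \<delta>: "0 < \<delta>" "\<And>n. (\<integral>\<^sup>+ z. indicator E z * (\<integral>\<^sup>+ x. ennreal (\<bar>(u n (x + \<delta> *\<^sub>R z) - u n x) \<bullet> z\<bar> powr p) \<partial>lborel) \<partial>lborel) \<le> ennreal (t j)"
      using osc[OF t(1)[of j]] by blast
    have "X (u n) \<delta> \<le> (\<integral>\<^sup>+ z. indicator E z * (\<integral>\<^sup>+ x. ennreal (\<bar>(u n (x + \<delta> *\<^sub>R z) - u n x) \<bullet> z\<bar> powr p) \<partial>lborel) \<partial>lborel)" for n
      unfolding X_def using K(2) by (intro nn_integral_mono mult_right_mono) (auto simp: indicator_def)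
    then show ?thesis using \<delta> by (meson order_trans)
  qed
  then obtain \<delta> where \<delta>: "\<And>j. 0 < \<delta> j" and Xu: "\<And>j n. X (u n) (\<delta> j) \<le> ennreal (t j)" by metis
  have "\<forall>j. \<exists>\<phi> L. \<phi> \<in> borel_measurable borel \<and> (\<forall>z. indicator K z \<le> \<phi> z) \<and> (\<forall>z. \<phi> z \<le> 1) \<and>
     (\<forall>z. 2 < norm z \<longrightarrow> \<phi> z = 0) \<and> (\<forall>a b. \<bar>\<phi> a - \<phi> b\<bar> \<le> L * dist a b) \<and> 0 \<le> L \<and>
     (\<integral>\<^sup>+ z. ennreal (\<phi> z - indicator K z) \<partial>lborel) \<le> ennreal (t j)"
    using lipschitz_cutoff_exists[OF K(1) Kc Kne t(1)] by blast
  from choice[OF this] obtain \<phi> where "\<forall>j. \<exists>L. \<phi> j \<in> borel_measurable borel \<and> (\<forall>z. indicator K z \<le> \<phi> j z) \<and> (\<forall>z. \<phi> j z \<le> 1) \<and>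
     (\<forall>z. 2 < norm z \<longrightarrow> \<phi> j z = 0) \<and> (\<forall>a b. \<bar>\<phi> j a - \<phi> j b\<bar> \<le> L * dist a b) \<and> 0 \<le> L \<and>
     (\<integral>\<^sup>+ z. ennreal (\<phi> j z - indicator K z) \<partial>lborel) \<le> ennreal (t j)" ..
  from choice[OF this] obtain L where \<phi>L: "\<forall>j. \<phi> j \<in> borel_measurable borel \<and> (\<forall>z. indicator K z \<le> \<phi> j z) \<and> (\<forall>z. \<phi> j z \<le> 1) \<and>
     (\<forall>z. 2 < norm z \<longrightarrow> \<phi> j z = 0) \<and> (\<forall>a b. \<bar>\<phi> j a - \<phi> j b\<bar> \<le> L j * dist a b) \<and> 0 \<le> L j \<and>
     (\<integral>\<^sup>+ z. ennreal (\<phi> j z - indicator K z) \<partial>lborel) \<le> ennreal (t j)" ..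
  have \<phi>m: "\<phi> j \<in> borel_measurable borel" for j using \<phi>L by blast
  have \<phi>ge: "indicator K z \<le> \<phi> j z" and \<phi>le: "\<phi> j z \<le> 1" and \<phi>s: "2 < norm z \<Longrightarrow> \<phi> j z = 0" for j z
    using \<phi>L by blast+
  have L: "\<bar>\<phi> j a - \<phi> j b\<bar> \<le> L j * dist a b" "0 \<le> L j" for j a b using \<phi>L by blast+
  have \<phi>\<kappa>: "(\<integral>\<^sup>+ z. ennreal (\<phi> j z - indicator K z) \<partial>lborel) \<le> ennreal (t j)" for j using \<phi>L by blast
  have \<phi>abs: "\<bar>\<phi> j z\<bar> \<le> 1" for j z
    using order_trans[OF indicator_pos_le \<phi>ge] \<phi>le[of j z] by (simp add: abs_le_iff)
  define F where "F j n = directional_average (\<phi> j) (\<delta> j) (u n)" for j n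
  obtain r where r: "strict_mono (r :: nat \<Rightarrow> nat)"
    and rF: "\<And>j e. 0 < e \<Longrightarrow> \<exists>N. \<forall>k\<ge>N. \<forall>l\<ge>N. \<forall>x\<in>closure D. norm (F j (r k) x - F j (r l) x) \<le> e"
  proof -
    have "\<exists>r. strict_mono (r :: nat \<Rightarrow> nat) \<and>
      (\<forall>j. \<forall>e>0. \<exists>N. \<forall>k\<ge>N. \<forall>l\<ge>N. \<forall>x\<in>closure D. norm (F j (r k) x - F j (r l) x) \<le> e)"
      unfolding F_def
    proof (rule diagonal_uniformly_Cauchy)
      show "compact (closure D)" using bD by (simp add: compact_closure)
      show "norm (directional_average (\<phi> j) (\<delta> j) (u n) x)
          \<le> 4 * (measure lborel (cball (0::'a) 2) + max M 0 / \<delta> j ^ DIM('a))" for j n x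
        by (rule norm_directional_average_le[OF p \<delta> u M(2) \<phi>m \<phi>abs \<phi>s])
      show "norm (directional_average (\<phi> j) (\<delta> j) (u n) x - directional_average (\<phi> j) (\<delta> j) (u n) y)
          \<le> 2 * (4 * L j + 4) * (measure lborel (cball (0::'a) 2) + max M 0 / \<delta> j ^ DIM('a)) / \<delta> j * norm (x - y)" for j n x y
        by (rule directional_average_lipschitz[OF p \<delta> u M(2) \<phi>m \<phi>abs \<phi>s L])
    qed
    then show ?thesis using that by blast
  qed
  define v where "v k = u (r k)" for k
  have v[measurable]: "v k \<in> borel_measurable borel" for k by (simp add: v_def)
  define V where "V = measure lborel (cball (0::'a) 1)"
  define b where "b = measure lborel D"
  have bE: "emeasure lborel D = ennreal b"
    unfolding b_def using emeasure_bounded_finite[OF bD] by (intro emeasure_eq_ennreal_measure) auto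
  have b0: "b \<ge> 0" by (simp add: b_def)
  \<comment> \<open>Collects what multiplies \<open>t j\<close>: the oscillation of a difference is
    at most 2^p times 2 \<open>t j\<close>, and the L^p bound W of a difference is 2^p times 2
    M.\<close>
  define C1 where "C1 = V powr (p - 1) * (2 powr p * 2) + 4 powr p * (2 powr p * (2 * M))"
  have C1: "C1 \<ge> 0" using M by (simp add: C1_def)
  have diff: "(\<integral>\<^sup>+ x. indicator D x * ennreal (norm (v l x - v k x) powr p) \<partial>lborel)
      \<le> ennreal ((3 / c) powr p * (C1 * t j + \<eta> powr p * b))"
    if \<eta>: "0 \<le> \<eta>" and close: "\<And>x. x \<in> D \<Longrightarrow> norm (F j (r l) x - F j (r k) x) \<le> \<eta>" for j k l \<eta>
  proof -
    define w where "w x = v l x - v k x" for x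
    have w[measurable]: "w \<in> borel_measurable borel" unfolding w_def[abs_def] by measurable
    define W where "W = 2 powr p * (2 * M)"
    have W0: "0 \<le> W" using M by (simp add: W_def)
    have W: "(\<integral>\<^sup>+ x. ennreal (norm (w x) powr p) \<partial>lborel) \<le> ennreal W"
    proof -
      have "(\<integral>\<^sup>+ x. ennreal (norm (w x) powr p) \<partial>lborel) = (\<integral>\<^sup>+ x. ennreal (norm (v l x + - v k x) powr p) \<partial>lborel)"
        by (simp add: w_def)
      also have "\<dots> \<le> ennreal (2 powr p) * ((\<integral>\<^sup>+ x. ennreal (norm (v l x) powr p) \<partial>lborel) + (\<integral>\<^sup>+ x. ennreal (norm (- v k x) powr p) \<partial>lborel))"
        using p by (intro norm_powr_integral_le) auto
      also have "\<dots> \<le> ennreal (2 powr p) * (ennreal M + ennreal M)"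
        using M(2) by (intro mult_left_mono add_mono) (auto simp: v_def)
      also have "ennreal M + ennreal M = ennreal (2 * M)"
        using M(1) by (subst ennreal_plus[symmetric]) auto
      also have "ennreal (2 powr p) * ennreal (2 * M) = ennreal W"
        unfolding W_def using M(1) by (intro ennreal_mult[symmetric]) auto
      finally show ?thesis .
    qed
    have Xw: "X w (\<delta> j) \<le> ennreal (2 powr p * 2 * t j)"
    proof -
      define a where "a i z x = (v i (x + \<delta> j *\<^sub>R z) - v i x) \<bullet> z" for i z x
      define A where "A i z = (\<integral>\<^sup>+ x. ennreal (\<bar>a i z x\<bar> powr p) \<partial>lborel)" for i z
      have [measurable]: "A i \<in> borel_measurable borel" for i
        unfolding A_def[abs_def] a_def by measurable
      have XA: "X (v i) (\<delta> j) = (\<integral>\<^sup>+ z. indicator K z * A i z \<partial>lborel)" for i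
        unfolding X_def A_def a_def ..
      have "X w (\<delta> j) \<le> (\<integral>\<^sup>+ z. ennreal (2 powr p) * (indicator K z * A l z + indicator K z * A k z) \<partial>lborel)"
        unfolding X_def
      proof (rule nn_integral_mono)
        fix z
        have "(\<integral>\<^sup>+ x. ennreal (\<bar>(w (x + \<delta> j *\<^sub>R z) - w x) \<bullet> z\<bar> powr p) \<partial>lborel)
            = (\<integral>\<^sup>+ x. ennreal (norm (a l z x + - a k z x) powr p) \<partial>lborel)"
          by (simp add: w_def a_def algebra_simps inner_diff_left)
        also have "\<dots> \<le> ennreal (2 powr p) * ((\<integral>\<^sup>+ x. ennreal (norm (a l z x) powr p) \<partial>lborel) + (\<integral>\<^sup>+ x. ennreal (norm (- a k z x) powr p) \<partial>lborel))"
          using p unfolding a_def by (intro norm_powr_integral_le) auto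
        also have "\<dots> = ennreal (2 powr p) * (A l z + A k z)" by (simp add: A_def)
        finally show "indicator K z * (\<integral>\<^sup>+ x. ennreal (\<bar>(w (x + \<delta> j *\<^sub>R z) - w x) \<bullet> z\<bar> powr p) \<partial>lborel)
          \<le> ennreal (2 powr p) * (indicator K z * A l z + indicator K z * A k z)"
          by (auto simp: indicator_def)
      qed
      also have "\<dots> = ennreal (2 powr p) * (X (v l) (\<delta> j) + X (v k) (\<delta> j))"
        unfolding XA by (simp add: nn_integral_cmult nn_integral_add)
      also have "\<dots> \<le> ennreal (2 powr p) * (ennreal (t j) + ennreal (t j))"
        unfolding v_def by (intro mult_left_mono add_mono Xu) auto
      also have "ennreal (t j) + ennreal (t j) = ennreal (2 * t j)"
        using t(1)[of j] by (subst ennreal_plus[symmetric]) auto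
      also have "ennreal (2 powr p) * ennreal (2 * t j) = ennreal (2 powr p * (2 * t j))"
        using t(1)[of j] by (intro ennreal_mult[symmetric]) auto
      finally show ?thesis by (simp only: mult.assoc)
    qed
    have avg: "norm (directional_average (\<phi> j) (\<delta> j) w x) \<le> \<eta>" if "x \<in> D" for x
    proof -
      have "directional_average (\<phi> j) (\<delta> j) w x = F j (r l) x - F j (r k) x"
        unfolding F_def w_def v_def
        by (intro directional_average_diff integrable_quad_kernel[OF p \<delta> u M(2) \<phi>m \<phi>abs \<phi>s])
      then show ?thesis using close[OF that] by simp
    qed
    \<comment> \<open>Makes the cutoff error linear in \<open>t j\<close>, like the oscillation
      term.\<close>
    have tp: "t j powr p \<le> t j"
      using powr_mono'[of 1 p "t j"] p t[of j] by simp
    have "(\<integral>\<^sup>+ x. indicator D x * ennreal (norm (w x) powr p) \<partial>lborel)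
     \<le> ennreal ((3 / c) powr p) * (ennreal (V powr (p - 1)) * X w (\<delta> j)
         + ennreal (t j powr p * 4 powr p * W) + ennreal (\<eta> powr p) * emeasure lborel D)"
      unfolding X_def V_def
      by (rule Lp_le_osc_average[OF p \<delta> w W W0 Kb Kc c \<phi>m \<phi>ge \<phi>le \<phi>s t(1) \<phi>\<kappa> D \<eta> avg])
    also have "\<dots> \<le> ennreal ((3 / c) powr p) * (ennreal (V powr (p - 1)) * ennreal (2 powr p * 2 * t j)
         + ennreal (t j * 4 powr p * W) + ennreal (\<eta> powr p) * ennreal b)"
      unfolding bE using tp W0 by (intro mult_left_mono add_mono Xw ennreal_leI mult_right_mono) auto
    also have "\<dots> = ennreal ((3 / c) powr p * (V powr (p - 1) * (2 powr p * 2 * t j) + t j * 4 powr p * W + \<eta> powr p * b))"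
      using t(1)[of j] W0 b0 by (simp add: ennreal_mult)
    also have "V powr (p - 1) * (2 powr p * 2 * t j) + t j * 4 powr p * W + \<eta> powr p * b = C1 * t j + \<eta> powr p * b"
      by (simp add: C1_def W_def algebra_simps)
    finally show ?thesis unfolding w_def .
  qed
  \<comment> \<open>A density in place of a restricted space keeps Borel functions on the whole
    space measurable.\<close>
  define \<mu> where "\<mu> = density lborel (indicator D :: 'a \<Rightarrow> ennreal)"
  have \<mu>: "(\<integral>\<^sup>+ x. f x \<partial>\<mu>) = (\<integral>\<^sup>+ x. indicator D x * f x \<partial>lborel)" if "f \<in> borel_measurable borel" for f
    unfolding \<mu>_def using that by (intro nn_integral_density) auto
  have "\<exists>s g. strict_mono (s :: nat \<Rightarrow> nat) \<and> g \<in> borel_measurable \<mu> \<and>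
    (\<integral>\<^sup>+ x. ennreal (norm (g x) powr p) \<partial>\<mu>) < \<infinity> \<and>
    (\<lambda>k. \<integral>\<^sup>+ x. ennreal (norm (v (s k) x - g x) powr p) \<partial>\<mu>) \<longlonglongrightarrow> 0"
  proof (rule Lp_complete_subseq[OF p])
    show "v n \<in> borel_measurable \<mu>" for n using v unfolding \<mu>_def by simp
    show "(\<integral>\<^sup>+ x. ennreal (norm (v n x) powr p) \<partial>\<mu>) < \<infinity>" for n
    proof -
      have "(\<integral>\<^sup>+ x. ennreal (norm (v n x) powr p) \<partial>\<mu>) = (\<integral>\<^sup>+ x. indicator D x * ennreal (norm (v n x) powr p) \<partial>lborel)"
        by (rule \<mu>) measurable
      also have "\<dots> \<le> (\<integral>\<^sup>+ x. ennreal (norm (v n x) powr p) \<partial>lborel)"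
        by (intro nn_integral_mono) (auto simp: indicator_def)
      also have "\<dots> \<le> ennreal M" unfolding v_def by (rule M)
      finally show ?thesis by (auto intro: le_less_trans)
    qed
    fix \<epsilon> :: real assume \<epsilon>: "0 < \<epsilon>"
    define Q where "Q = (3 / c) powr p"
    have Q: "Q > 0" using c by (simp add: Q_def)
    obtain j where j: "Q * (C1 * t j) \<le> \<epsilon> / 2"
    proof -
      have "0 < \<epsilon> / 2 / (Q * C1 + 1)" using \<epsilon> Q C1 by (intro divide_pos_pos add_nonneg_pos) auto
      then obtain j where "t j < \<epsilon> / 2 / (Q * C1 + 1)"
        unfolding t_def using nat_approx_posE by blast
      moreover have "Q * C1 + 1 > 0" using Q C1 by (intro add_nonneg_pos) auto
      ultimately have "t j * (Q * C1 + 1) < \<epsilon> / 2" by (simp only: pos_less_divide_eq)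
      then have "Q * (C1 * t j) \<le> \<epsilon> / 2" using t(1)[of j] by (simp add: algebra_simps)
      then show ?thesis using that by blast
    qed
    \<comment> \<open>The number \<eta> will satisfy \<eta>^p = y; dividing by b + 1 instead of b
      covers a domain of measure 0.\<close>
    define y where "y = \<epsilon> / 2 / (Q * (b + 1))"
    have y: "y > 0" using \<epsilon> Q b0 by (simp add: y_def)
    define \<eta> where "\<eta> = y powr (1 / p)"
    have \<eta>: "\<eta> > 0" "\<eta> powr p = y" using y p by (auto simp: \<eta>_def powr_powr)
    have "Q * (y * b) \<le> Q * (y * (b + 1))" using Q y by (intro mult_left_mono) auto
    also have "\<dots> = \<epsilon> / 2" using Q b0 by (simp add: y_def)
    finally have yb: "Q * (y * b) \<le> \<epsilon> / 2" .
    \<comment> \<open>The index j is fixed by now: N may depend on the scale and the cutoff.\<close>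
    obtain N where N: "\<And>k l x. k \<ge> N \<Longrightarrow> l \<ge> N \<Longrightarrow> x \<in> closure D \<Longrightarrow> norm (F j (r k) x - F j (r l) x) \<le> \<eta>"
      using rF[OF \<eta>(1), of j] by blast
    have "(\<integral>\<^sup>+ x. ennreal (norm (v l x - v k x) powr p) \<partial>\<mu>) \<le> ennreal \<epsilon>" if "k \<ge> N" "l \<ge> N" for k l
    proof -
      have "(\<integral>\<^sup>+ x. ennreal (norm (v l x - v k x) powr p) \<partial>\<mu>)
          = (\<integral>\<^sup>+ x. indicator D x * ennreal (norm (v l x - v k x) powr p) \<partial>lborel)"
        by (rule \<mu>) measurable
      also have "\<dots> \<le> ennreal (Q * (C1 * t j + \<eta> powr p * b))"
        unfolding Q_def
      proof (rule diff)
        show "0 \<le> \<eta>" using \<eta> by simp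
        show "norm (F j (r l) x - F j (r k) x) \<le> \<eta>" if "x \<in> D" for x
          using N[OF \<open>l \<ge> N\<close> \<open>k \<ge> N\<close>] that closure_subset by blast
      qed
      also have "\<dots> \<le> ennreal \<epsilon>"
        using j yb by (intro ennreal_leI) (simp add: \<eta>(2) distrib_left)
      finally show ?thesis .
    qed
    then show "\<exists>N. \<forall>k\<ge>N. \<forall>l\<ge>N. (\<integral>\<^sup>+ x. ennreal (norm (v l x - v k x) powr p) \<partial>\<mu>) \<le> ennreal \<epsilon>" by blast
  qed
  then obtain s g where s: "strict_mono (s :: nat \<Rightarrow> nat)" and g: "g \<in> borel_measurable \<mu>"
    and gf: "(\<integral>\<^sup>+ x. ennreal (norm (g x) powr p) \<partial>\<mu>) < \<infinity>"
    and lim: "(\<lambda>k. \<integral>\<^sup>+ x. ennreal (norm (v (s k) x - g x) powr p) \<partial>\<mu>) \<longlonglongrightarrow> 0" by blast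
  have g'[measurable]: "g \<in> borel_measurable borel" using g by (simp add: \<mu>_def)
  have "(\<integral>\<^sup>+ x. ennreal (norm (g x) powr p) \<partial>\<mu>) = (\<integral>\<^sup>+ x. indicator D x * ennreal (norm (g x) powr p) \<partial>lborel)"
    by (rule \<mu>) measurable
  moreover have "(\<integral>\<^sup>+ x. ennreal (norm (v (s k) x - g x) powr p) \<partial>\<mu>)
      = (\<integral>\<^sup>+ x. indicator D x * ennreal (norm (u ((r \<circ> s) k) x - g x) powr p) \<partial>lborel)" for k
    unfolding v_def o_def by (rule \<mu>) measurable
  moreover have "strict_mono (r \<circ> s)" using r s by (rule strict_mono_o)
  ultimately show ?thesis using gf lim g' by (intro exI[of _ "r \<circ> s"] exI[of _ g]) simp
qed

section \<open>From the kernel hypothesis to the uniform oscillation bound\<close>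

lemma ennreal_le_of_ratio_less:
  fixes X m :: ennreal and a C e :: real
  assumes mul: "m * X \<le> ennreal (C * a)" and ratio: "ennreal a / m < ennreal e"
    and a: "0 < a" and C: "0 \<le> C" and e: "0 < e"
  shows "X \<le> ennreal (C * e)"
proof (cases "m = \<infinity>")
  \<comment> \<open>An infinite m leaves X = 0 as the only value with a finite product.\<close>
  case True
  then have "X = 0" using mul by (cases "X = 0") (auto simp: ennreal_top_mult top_unique)
  then show ?thesis by simp
next
  case False
  \<comment> \<open>For m = 0 the extended quotient would be infinite.\<close>
  have "m \<noteq> 0" using ratio a by (auto simp: ennreal_divide_zero top_unique)
  then obtain r where r: "m = ennreal r" "0 < r" using False by (cases m) (auto simp: less_le)
  have "a / r < e" using ratio r a e by (simp add: divide_ennreal ennreal_less_iff)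
  then have "a < e * r" using r by (simp add: pos_divide_less_eq)
  show ?thesis
  proof (cases X)
    case (real x)
    then have "r * x \<le> C * a" using mul r C a by (simp flip: ennreal_mult)
    also have "\<dots> \<le> C * (e * r)" using \<open>a < e * r\<close> C by (intro mult_left_mono) auto
    finally have "x \<le> C * e" using r by (simp add: mult.commute mult.left_commute)
    then show ?thesis using real by (simp add: ennreal_leI)
  next
    case top
    then have "m * X = top" using \<open>m \<noteq> 0\<close> by (simp add: ennreal_mult_top)
    then show ?thesis using mul by (simp add: top_unique)
  qed
qed

text \<open>The infimum is tested with one admissible factor s. The constant is made independent of
  s because s will vary with z, r and k.\<close>

lemma rho_theta_le_kernel_rep:
  assumes p: "0 \<le> p" and \<theta>: "0 < \<theta>0" "\<theta>0 \<le> s" "s \<le> 1"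
  shows "rho_theta f p \<theta>0 x \<le> ennreal (\<theta>0 powr - p) * kernel_rep f (s *\<^sub>R x)"
proof -
  have "rho_theta f p \<theta>0 x \<le> kernel_rep f (s *\<^sub>R x) * ennreal (s powr - p)"
    unfolding rho_theta_def using \<theta> by (intro INF_lower) auto
  also have "\<dots> \<le> kernel_rep f (s *\<^sub>R x) * ennreal (\<theta>0 powr - p)"
    using p \<theta> by (intro mult_left_mono ennreal_leI powr_mono2') auto
  finally show ?thesis by (simp add: mult.commute)
qed

text \<open>The set \<open>\<Lambda>\<close> need not be measurable, so the cone over it is replaced by the measurable set of all
  points at which the countably many kernel inequalities used in the estimate hold.\<close>

lemma uniform_directional_osc:
  fixes \<rho> :: "'a::euclidean_space \<Rightarrow> real" and u :: "nat \<Rightarrow> 'a \<Rightarrow> 'a"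
  assumes p: "1 \<le> p"
    and K: "kernel_rep \<rho> \<in> borel_measurable borel"
    and theta0: "0 < \<theta>0" "\<theta>0 < 1"
    and Lambda_sphere: "\<Lambda> \<subseteq> sphere 0 1"
    and Lambda_pos: "hausdorff_outer (DIM('a) - 1) \<Lambda> > 0"
    and radial: "\<And>v r. v \<in> \<Lambda> \<Longrightarrow> r > 0 \<Longrightarrow>
                   rho_theta \<rho> p \<theta>0 (r *\<^sub>R v) = rho_theta \<rho> p \<theta>0 (r *\<^sub>R v0)"
    and lim: "((\<lambda>\<delta>. ennreal (\<delta> powr p) /
                 (\<integral>\<^sup>+ r\<in>{0<..<\<delta>}. rho_theta \<rho> p \<theta>0 (r *\<^sub>R v0) * ennreal (r ^ (DIM('a) - 1)) \<partial>lborel))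
               \<longlongrightarrow> 0) (at_right 0)"
    and u: "\<And>n. u n \<in> borel_measurable borel"
    and M: "0 \<le> M" "\<And>n. (\<integral>\<^sup>+ z. kernel_rep \<rho> z * (ennreal (norm z powr (- 2 * p)) * pair_osc p (u n) z) \<partial>lborel) \<le> ennreal M"
  shows "\<exists>E. E \<in> sets borel \<and> E \<subseteq> cball 0 1 \<and> emeasure lborel E > 0 \<and>
    (\<forall>\<epsilon>>0. \<exists>\<delta>>0. \<forall>n. (\<integral>\<^sup>+ z. indicator E z *
       (\<integral>\<^sup>+ x. ennreal (\<bar>(u n (x + \<delta> *\<^sub>R z) - u n x) \<bullet> z\<bar> powr p) \<partial>lborel) \<partial>lborel) \<le> ennreal \<epsilon>)"
proof -
  note K[measurable]
  \<comment> \<open>Any value strictly between \<theta>0 and 1 would do; the excess over \<theta>0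
    absorbs the factor (k-1)/k below.\<close>
  define \<theta> where "\<theta> = (1 + \<theta>0) / 2"
  have \<theta>: "0 < \<theta>" "\<theta> < 1" "\<theta>0 < \<theta>" using theta0 by (auto simp: \<theta>_def)
  \<comment> \<open>The threshold \<theta>/(\<theta> - \<theta>0) is the solution k of \<theta>
    (k-1)/k = \<theta>0.\<close>
  obtain k1 :: nat where k1: "\<theta> / (\<theta> - \<theta>0) < real k1" using reals_Archimedean2 by blast
  define k0 where "k0 = k1 + 2"
  have k0: "2 \<le> k0" by (simp add: k0_def)
  have k\<theta>: "\<theta>0 \<le> \<theta> * (real k - 1) / real k" if "k0 \<le> k" for k
  proof -
    have "\<theta> / (\<theta> - \<theta>0) < real k" using k1 that by (simp add: k0_def)
    then have "\<theta> < real k * (\<theta> - \<theta>0)" using \<theta> by (simp add: pos_divide_less_eq)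
    then show ?thesis using that k0 by (simp add: pos_le_divide_eq algebra_simps)
  qed
  define Q where "Q r = rho_theta \<rho> p \<theta>0 (r *\<^sub>R v0)" for r
  define d where "d j = 1 / real (Suc j)" for j
  have d: "0 < d j" for j by (simp add: d_def)
  define P where "P j k = (SUP r\<in>{d j / real k..d j / (real k - 1)}. Q r)" for j k
  define c where "c = ennreal (\<theta>0 powr - p)"
  define E where "E = {z. \<theta> \<le> norm z \<and> norm z \<le> 1 \<and>
      (\<forall>j k. k0 \<le> k \<longrightarrow> P j k \<le> c * kernel_rep \<rho> ((d j / real k) *\<^sub>R z))}"
  \<comment> \<open>Countably many conditions, each comparing the number \<open>P j k\<close> with a
    Borel function of z.\<close>
  have E: "E \<in> sets borel" unfolding E_def by measurable
  have Ec: "E \<subseteq> cball 0 1" by (auto simp: E_def)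
  have sub: "{z. \<theta> \<le> norm z \<and> norm z \<le> 1 \<and> z /\<^sub>R norm z \<in> \<Lambda>} \<subseteq> E"
  proof safe
    fix z assume z: "\<theta> \<le> norm z" "norm z \<le> 1" "z /\<^sub>R norm z \<in> \<Lambda>"
    define v where "v = z /\<^sub>R norm z"
    have nz: "norm z > 0" using z \<theta> by linarith
    have zv: "z = norm z *\<^sub>R v" using nz by (simp add: v_def)
    have "P j k \<le> c * kernel_rep \<rho> ((d j / real k) *\<^sub>R z)" if k: "k0 \<le> k" for j k
      unfolding P_def
    proof (rule SUP_least)
      fix r assume "r \<in> {d j / real k..d j / (real k - 1)}"
      then have r: "d j / real k \<le> r" "r \<le> d j / (real k - 1)" by auto
      have kk: "2 \<le> real k" using k k0 by simp
      have r0: "r > 0" using r(1) d[of j] kk by (intro less_le_trans[OF _ r(1)] divide_pos_pos) auto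
      \<comment> \<open>The number with s r v = (\<open>d j\<close>/k) z. The ranges of r and
        \<open>norm z\<close> put it between \<theta> (k-1)/k and 1, so it is admissible in the
        infimum defining \<open>rho_theta\<close>.\<close>
      define s where "s = d j * norm z / (real k * r)"
      have "\<theta>0 \<le> s"
      proof -
        have "r * (real k - 1) \<le> d j" using r(2) kk by (simp add: pos_le_divide_eq)
        then have "(real k - 1) / real k \<le> d j / (real k * r)"
          using kk r0 divide_right_mono[of "r * (real k - 1)" "d j" "real k * r"] by simp
        then have "\<theta> * ((real k - 1) / real k) \<le> norm z * (d j / (real k * r))"
          using z \<theta> kk by (intro mult_mono) auto
        then show ?thesis using k\<theta>[OF k] by (simp add: s_def mult.commute)
      qed
      moreover have "s \<le> 1"
      proof -
        have "d j \<le> r * real k" using r(1) kk by (simp add: pos_divide_le_eq)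
        then have "d j * norm z \<le> (r * real k) * 1" using z d[of j] by (intro mult_mono) auto
        then show ?thesis using kk r0 by (simp add: s_def mult.commute)
      qed
      ultimately have "rho_theta \<rho> p \<theta>0 (r *\<^sub>R v) \<le> ennreal (\<theta>0 powr - p) * kernel_rep \<rho> (s *\<^sub>R (r *\<^sub>R v))"
        using p theta0 by (intro rho_theta_le_kernel_rep) auto
      moreover have "s *\<^sub>R (r *\<^sub>R v) = (d j / real k) *\<^sub>R z"
      proof -
        have "s * r = d j / real k * norm z" using r0 kk by (simp add: s_def)
        then show ?thesis using zv by (metis scaleR_scaleR)
      qed
      moreover have "rho_theta \<rho> p \<theta>0 (r *\<^sub>R v) = Q r"
        unfolding Q_def using radial[of v r] z(3) r0 by (simp add: v_def)
      ultimately show "Q r \<le> c * kernel_rep \<rho> ((d j / real k) *\<^sub>R z)" by (simp only: c_def)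
    qed
    then show "z \<in> E" using z by (simp add: E_def)
  qed
  have Epos: "emeasure lborel E > 0"
  proof (rule ccontr)
    assume "\<not> emeasure lborel E > 0"
    then have "E \<in> null_sets lborel" using E by (auto simp: null_sets_def)
    then show False using hausdorff_outer_null_cone[OF Lambda_sphere \<theta>(1,2) sub] Lambda_pos by simp
  qed
  define X where "X n \<delta> = (\<integral>\<^sup>+ z. indicator E z *
       (\<integral>\<^sup>+ x. ennreal (\<bar>(u n (x + \<delta> *\<^sub>R z) - u n x) \<bullet> z\<bar> powr p) \<partial>lborel) \<partial>lborel)" for n \<delta>
  define m where "m \<delta> = (\<integral>\<^sup>+ r\<in>{0<..<\<delta>}. Q r * ennreal (r ^ (DIM('a) - 1)) \<partial>lborel)" for \<delta>
  \<comment> \<open>The factor (k0-1)^p turns \<open>d j\<close>^p into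
    (\<open>d j\<close>/(k0-1))^p, because the radial integral extends only up to
    \<open>d j\<close>/(k0-1).\<close>
  define C where "C = 2 ^ DIM('a) / \<theta> * (real k0 - 1) powr p * (\<theta>0 powr - p * M)"
  have C: "0 \<le> C" using \<theta> M by (simp add: C_def)
  have key: "m (d j / (real k0 - 1)) * X n (d j) \<le> ennreal (C * (d j / (real k0 - 1)) powr p)" for j n
  proof -
    have "m (d j / (real k0 - 1)) * X n (d j) \<le> ennreal (2 ^ DIM('a) / \<theta> * d j powr p)
            * (c * (\<integral>\<^sup>+ z. kernel_rep \<rho> z * (ennreal (norm z powr (- 2 * p)) * pair_osc p (u n) z) \<partial>lborel))"
      unfolding m_def X_def
      by (rule scaled_osc_estimate[OF p u K E _ \<theta>(1) d k0]) (auto simp: E_def P_def)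
    also have "\<dots> \<le> ennreal (2 ^ DIM('a) / \<theta> * d j powr p) * (c * ennreal M)"
      by (intro mult_left_mono M) auto
    also have "\<dots> = ennreal (2 ^ DIM('a) / \<theta> * d j powr p * (\<theta>0 powr - p * M))"
      unfolding c_def using \<theta>(1) M(1) by (simp flip: ennreal_mult)
    also have "2 ^ DIM('a) / \<theta> * d j powr p * (\<theta>0 powr - p * M) = C * (d j / (real k0 - 1)) powr p"
      using k0 d[of j] by (simp add: C_def powr_divide)
    finally show ?thesis .
  qed
  have "\<exists>\<delta>>0. \<forall>n. X n \<delta> \<le> ennreal \<epsilon>" if \<epsilon>: "0 < \<epsilon>" for \<epsilon>
  proof -
    define e where "e = \<epsilon> / (C + 1)"
    have e: "0 < e" "C * e \<le> \<epsilon>" using \<epsilon> C by (auto simp: e_def field_simps)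
    have "\<forall>\<^sub>F \<delta> in at_right 0. ennreal (\<delta> powr p) / m \<delta> < ennreal e"
      using lim e unfolding m_def Q_def by (intro order_tendstoD(2)[of _ 0]) auto
    moreover have "filterlim (\<lambda>j. d j / (real k0 - 1)) (at_right 0) sequentially"
    proof -
      have "(\<lambda>j. d j / (real k0 - 1)) \<longlonglongrightarrow> 0 / (real k0 - 1)"
        unfolding d_def using LIMSEQ_inverse_real_of_nat k0
        by (intro tendsto_divide tendsto_const) (auto simp: inverse_eq_divide)
      moreover have "d j \<noteq> 0" for j using d[of j] by simp
      ultimately show ?thesis using d k0 by (auto simp: filterlim_at)
    qed
    ultimately have "\<forall>\<^sub>F j in sequentially. ennreal ((d j / (real k0 - 1)) powr p) / m (d j / (real k0 - 1)) < ennreal e"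
      by (rule eventually_compose_filterlim)
    then obtain j where j: "ennreal ((d j / (real k0 - 1)) powr p) / m (d j / (real k0 - 1)) < ennreal e"
      by (auto simp: eventually_sequentially)
    have "X n (d j) \<le> ennreal (C * e)" for n
      by (rule ennreal_le_of_ratio_less[OF key j _ C e(1)]) (use d[of j] k0 in auto)
    then have "X n (d j) \<le> ennreal \<epsilon>" for n
      using e(2) by (meson ennreal_leI order_trans)
    then show ?thesis using d by blast
  qed
  then show ?thesis using E Ec Epos unfolding X_def by blast
qed

theorem theorem1p2:
  fixes \<rho> :: "'a::euclidean_space \<Rightarrow> real"
    and p \<theta>0 :: real
    and \<Lambda> :: "'a set"
    and v0 :: 'a
    and u :: "nat \<Rightarrow> 'a \<Rightarrow> 'a"
  assumes p: "1 \<le> p"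
    and rho_int: "integrable lebesgue \<rho>"
    and rho_nonneg: "\<And>x. 0 \<le> \<rho> x"
    and theta0: "0 < \<theta>0" "\<theta>0 < 1"
    and Lambda_sphere: "\<Lambda> \<subseteq> sphere 0 1"
    and Lambda_pos: "hausdorff_outer (DIM('a) - 1) \<Lambda> > 0"
    and v0: "v0 \<in> \<Lambda>"
    and radial: "\<And>v r. v \<in> \<Lambda> \<Longrightarrow> r > 0 \<Longrightarrow>
                   rho_theta \<rho> p \<theta>0 (r *\<^sub>R v) = rho_theta \<rho> p \<theta>0 (r *\<^sub>R v0)"
    and lim: "((\<lambda>\<delta>. ennreal (\<delta> powr p) /
                 (\<integral>\<^sup>+ r\<in>{0<..<\<delta>}. rho_theta \<rho> p \<theta>0 (r *\<^sub>R v0) * ennreal (r ^ (DIM('a) - 1)) \<partial>lborel))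
               \<longlongrightarrow> 0) (at_right 0)"
    and meas: "\<And>n. u n \<in> borel_measurable lebesgue"
    and bdd: "\<exists>M::real. \<forall>n. Lp_pow p UNIV (u n) \<le> ennreal M \<and> S_seminorm_p \<rho> p (u n) \<le> ennreal M"
    and D: "open D" "bounded D"
  shows "\<exists>r g. strict_mono r \<and> g \<in> borel_measurable lebesgue \<and> Lp_pow p D g < \<infinity> \<and>
           ((\<lambda>k. Lp_pow p D (\<lambda>x. u (r k) x - g x)) \<longlongrightarrow> 0) sequentially"
proof -
  have K: "kernel_rep \<rho> \<in> borel_measurable borel" by (rule kernel_rep_measurable[OF rho_int])
  obtain M0 where M0: "\<And>n. Lp_pow p UNIV (u n) \<le> ennreal M0" "\<And>n. S_seminorm_p \<rho> p (u n) \<le> ennreal M0"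
    using bdd by blast
  \<comment> \<open>The given bound may be negative as a real number, where \<open>ennreal\<close>
    truncates it to 0; the estimates use a nonnegative one.\<close>
  define M where "M = max M0 0"
  have M: "0 \<le> M" "ennreal M0 \<le> ennreal M" by (auto simp: M_def intro: ennreal_leI)
  have "\<exists>u'. u' \<in> borel_measurable borel \<and> (AE x in lborel. u n x = u' x)" for n
    using borel_version_lebesgue[OF meas[of n]] by blast
  then obtain u' where u': "\<And>n. u' n \<in> borel_measurable borel" and eq: "\<And>n. AE x in lborel. u n x = u' n x"
    by metis
  \<comment> \<open>Carries both the norm bound (with g = 0) and the final convergence between u and
    its Borel version.\<close>
  have Lp: "Lp_pow p A (\<lambda>x. u n x - g x) = (\<integral>\<^sup>+ x. indicator A x * ennreal (norm (u' n x - g x) powr p) \<partial>lborel)" for A n g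
    unfolding Lp_pow_def nn_integral_completion
    by (rule nn_integral_cong_AE, use eq[of n] in eventually_elim) (simp add: mult.commute)
  have Lu: "(\<integral>\<^sup>+ x. ennreal (norm (u' n x) powr p) \<partial>lborel) \<le> ennreal M" for n
    using Lp[of UNIV n "\<lambda>_. 0"] M0(1)[of n] M(2) by simp
  have S: "(\<integral>\<^sup>+ z. kernel_rep \<rho> z * (ennreal (norm z powr (- 2 * p)) * pair_osc p (u' n) z) \<partial>lborel) \<le> ennreal M" for n
    unfolding nn_integral_kernel_pair_osc[OF K u' eq] using M0(2) M(2) by (rule order_trans)
  have "\<exists>E. E \<in> sets borel \<and> E \<subseteq> cball 0 1 \<and> emeasure lborel E > 0 \<and>
    (\<forall>\<epsilon>>0. \<exists>\<delta>>0. \<forall>n. (\<integral>\<^sup>+ z. indicator E z *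
       (\<integral>\<^sup>+ x. ennreal (\<bar>(u' n (x + \<delta> *\<^sub>R z) - u' n x) \<bullet> z\<bar> powr p) \<partial>lborel) \<partial>lborel) \<le> ennreal \<epsilon>)"
    by (rule uniform_directional_osc[OF p K theta0 Lambda_sphere Lambda_pos radial lim u' M(1) S])
  then obtain E where E: "E \<in> sets borel" "E \<subseteq> cball 0 1" "emeasure lborel E > 0"
    and osc: "\<forall>\<epsilon>>0. \<exists>\<delta>>0. \<forall>n. (\<integral>\<^sup>+ z. indicator E z *
       (\<integral>\<^sup>+ x. ennreal (\<bar>(u' n (x + \<delta> *\<^sub>R z) - u' n x) \<bullet> z\<bar> powr p) \<partial>lborel) \<partial>lborel) \<le> ennreal \<epsilon>"
    by (elim exE conjE)
  have "\<exists>s g. strict_mono (s :: nat \<Rightarrow> nat) \<and> g \<in> borel_measurable borel \<and>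
    (\<integral>\<^sup>+ x. indicator D x * ennreal (norm (g x) powr p) \<partial>lborel) < \<infinity> \<and>
    (\<lambda>k. \<integral>\<^sup>+ x. indicator D x * ennreal (norm (u' (s k) x - g x) powr p) \<partial>lborel) \<longlonglongrightarrow> 0"
    by (rule directional_osc_compactness[OF p u' M(1) Lu E osc[rule_format] borel_open[OF D(1)] D(2)])
  then obtain s g where s: "strict_mono (s :: nat \<Rightarrow> nat)" and g: "g \<in> borel_measurable borel"
    and gf: "(\<integral>\<^sup>+ x. indicator D x * ennreal (norm (g x) powr p) \<partial>lborel) < \<infinity>"
    and conv: "(\<lambda>k. \<integral>\<^sup>+ x. indicator D x * ennreal (norm (u' (s k) x - g x) powr p) \<partial>lborel) \<longlonglongrightarrow> 0"
    by (elim exE conjE)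
  have "g \<in> borel_measurable lborel" using g by simp
  then have "g \<in> borel_measurable lebesgue" by (rule measurable_completion)
  moreover have "Lp_pow p D g < \<infinity>"
    using gf unfolding Lp_pow_def nn_integral_completion by (simp add: mult.commute)
  moreover have "(\<lambda>k. Lp_pow p D (\<lambda>x. u (s k) x - g x)) \<longlonglongrightarrow> 0"
    using conv by (simp only: Lp)
  ultimately show ?thesis using s by blast
qed

end
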